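(* For any real $p\geq 1$, neither $\mathbb{R}^{\mathbb{N}}/l_p$ nor $\mathbb{R}^{\mathbb{N}}/c_0$ is Borel reducible to $E(T,(t_n))$, where $T$ is the Tsirelson space and $\{t_n\}$ is its unit vector basis.
   Context: $\mathbb{N}=\{0,1,2,\ldots\}$; Banach spaces are over $\mathbb{R}$. For a basic sequence $\{x_n\}$ in a Banach space $X$ (a Schauder basis, indexed by $\mathbb{N}$, of its closed linear span), $\mathrm{coef}(X,(x_n))$ is the set of all $a=(a_n)\in\mathbb{R}^{\mathbb{N}}$ such that $\sum_n a_nx_n$ converges in $X$, and $E(X,(x_n))$ is the (Borel) equivalence relation on $\mathbb{R}^{\mathbb{N}}$ given by $(x,y)\in E(X,(x_n)) \iff x-y\in \mathrm{coef}(X,(x_n))$. $\mathbb{R}^{\mathbb{N}}/l_p$ and $\mathbb{R}^{\mathbb{N}}/c_0$ denote the equivalence relations on $\mathbb{R}^{\mathbb{N}}$ given by $x-y\in l_p$, respectively $x-y\in c_0$. An equivalence relation $E$ on a Polish space $P$ is Borel reducible to $F$ on a Polish space $Q$ ($E\leq_B F$) if there is a Borel $\theta:P\to Q$ with $xEy\iff\theta(x)F\theta(y)$ for all $x,y\in P$. Tsirelson space: for finite nonempty sets $E,F$ of natural numbers, $E<F$ means $\max E<\min F$, and $k\leq E$ means $k\leq\min E$. For $x=(a_n)\in c_{00}$ (eventually zero real sequences), $Ex$ denotes the sequence agreeing with $x$ on $E$ and $0$ elsewhere. For $\alpha\in(0,1)$ define norms on $c_{00}$ by $\|x\|_0=\max_n|a_n|$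 and, for $m\ge 0$, $$\|x\|_{m+1}=\max\Big\{\|x\|_m,\ \alpha\cdot\max\Big[\sum_{j=1}^k\|E_jx\|_m\Big]\Big\},$$ where the inner max is over all $k$ and all choices of finite subsets $E_1,\ldots,E_k$ of $\mathbb{N}$ with $k\leq E_1<E_2<\cdots<E_k$. Then $\|x\|=\lim_m\|x\|_m$ is a norm on $c_{00}$, and $T_\alpha$ is the completion of $c_{00}$ in this norm. $T=T_{1/2}$, and $\{t_n\}$ is the sequence of unit vectors, which is a basis of $T$. *)

theory Defs
  imports "HOL-Analysis.Analysis"
begin

section \<open>Borel reducibility and equivalence relations on \<open>\<real>\<^sup>\<nat>\<close>\<close>

text \<open>The type \<^typ>\<open>nat \<Rightarrow> real\<close> carries the product topology and is an instance of
  \<^class>\<open>polish_space\<close>.\<close>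

definition borel_reducible :: "('a::polish_space) rel \<Rightarrow> ('b::polish_space) rel \<Rightarrow> bool"
    (infix \<open>\<le>\<^sub>B\<close> 50)
  where "E \<le>\<^sub>B F \<longleftrightarrow>
    (\<exists>\<theta> \<in> borel_measurable borel. \<forall>x y. (x, y) \<in> E \<longleftrightarrow> (\<theta> x, \<theta> y) \<in> F)"

definition coef :: "(nat \<Rightarrow> 'a::real_normed_vector) \<Rightarrow> (nat \<Rightarrow> real) set"
  where "coef x = {a. summable (\<lambda>n. a n *\<^sub>R x n)}"

definition E_rel :: "(nat \<Rightarrow> 'a::real_normed_vector) \<Rightarrow> (nat \<Rightarrow> real) rel"
  where "E_rel x = {(a, b). (\<lambda>n. a n - b n) \<in> coef x}"

definition lp_space :: "real \<Rightarrow> (nat \<Rightarrow> real) set"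
  where "lp_space p = {a. summable (\<lambda>n. \<bar>a n\<bar> powr p)}"

definition lp_rel :: "real \<Rightarrow> (nat \<Rightarrow> real) rel"
  where "lp_rel p = {(a, b). (\<lambda>n. a n - b n) \<in> lp_space p}"

definition c0_space :: "(nat \<Rightarrow> real) set"
  where "c0_space = {a. a \<longlonglongrightarrow> 0}"

definition c0_rel :: "(nat \<Rightarrow> real) rel"
  where "c0_rel = {(a, b). (\<lambda>n. a n - b n) \<in> c0_space}"


section \<open>The Tsirelson norms on finitely supported sequences\<close>

definition restr :: "nat set \<Rightarrow> (nat \<Rightarrow> real) \<Rightarrow> nat \<Rightarrow> real"
  where "restr E x = (\<lambda>n. if n \<in> E then x n else 0)"

text \<open>Only the values \<open>E 1, \<dots>, E k\<close> of the family are relevant.\<close>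

definition admissible :: "nat \<Rightarrow> (nat \<Rightarrow> nat set) \<Rightarrow> bool"
  where "admissible k E \<longleftrightarrow> 1 \<le> k \<and> (\<forall>j\<in>{1..k}. finite (E j) \<and> E j \<noteq> {}) \<and>
    k \<le> Min (E 1) \<and> (\<forall>j\<in>{1..<k}. Max (E j) < Min (E (Suc j)))"

text \<open>The arguments of \<^const>\<open>Max\<close> below are finite sets whenever \<open>x\<close> is finitely supported
  (\<open>fin_supp_finite_range\<close> and \<open>finite_admissible_sums\<close>).\<close>

primrec tsirelson_step :: "real \<Rightarrow> nat \<Rightarrow> (nat \<Rightarrow> real) \<Rightarrow> real" where
  "tsirelson_step \<alpha> 0 x = Max (range (\<lambda>n. \<bar>x n\<bar>))"
| "tsirelson_step \<alpha> (Suc m) x = max (tsirelson_step \<alpha> m x)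
     (\<alpha> * Max {\<Sum>j=1..k. tsirelson_step \<alpha> m (restr (E j) x) | k E. admissible k E})"

definition tsirelson_norm :: "real \<Rightarrow> (nat \<Rightarrow> real) \<Rightarrow> real"
  where "tsirelson_norm \<alpha> x = lim (\<lambda>m. tsirelson_step \<alpha> m x)"

abbreviation fin_supp :: "(nat \<Rightarrow> real) \<Rightarrow> bool"
  where "fin_supp x \<equiv> finite {n. x n \<noteq> 0}"

lemma fin_supp_restr: "fin_supp x \<Longrightarrow> fin_supp (restr E x)"
  by (rule finite_subset[of _ "{n. x n \<noteq> 0}"]) (auto simp: restr_def)

lemma fin_supp_add: "fin_supp x \<Longrightarrow> fin_supp y \<Longrightarrow> fin_supp (\<lambda>n. x n + y n)"
  by (rule finite_subset[of _ "{n. x n \<noteq> 0} \<union> {n. y n \<noteq> 0}"]) auto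

lemma fin_supp_scale: "fin_supp x \<Longrightarrow> fin_supp (\<lambda>n. c * x n)"
  by (rule finite_subset[of _ "{n. x n \<noteq> 0}"]) auto

lemma restr_add: "restr E (\<lambda>n. x n + y n) = (\<lambda>n. restr E x n + restr E y n)"
  by (auto simp: restr_def)

lemma restr_scale: "restr E (\<lambda>n. c * x n) = (\<lambda>n. c * restr E x n)"
  by (auto simp: restr_def)

lemma fin_supp_finite_range:
  assumes "fin_supp x" shows "finite (range (\<lambda>n. \<bar>x n\<bar>))"
proof -
  have "range (\<lambda>n. \<bar>x n\<bar>) \<subseteq> insert 0 ((\<lambda>n. \<bar>x n\<bar>) ` {n. x n \<noteq> 0})" by auto
  then show ?thesis using assms by (metis finite_imageI finite_insert finite_subset)
qed

lemma admissible_singleton: "admissible 1 (\<lambda>_. {1})"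
  by (simp add: admissible_def)

lemma admissible_less:
  assumes "admissible k E" "1 \<le> i" "i < j" "j \<le> k" "a \<in> E i" "b \<in> E j"
  shows "a < b"
proof -
  have *: "finite (E l) \<and> E l \<noteq> {}" if "1 \<le> l" "l \<le> k" for l
    using assms(1) that by (auto simp: admissible_def)
  have step: "Max (E l) < Min (E (Suc l))" if "1 \<le> l" "l < k" for l
    using assms(1) that by (auto simp: admissible_def)
  have "j \<le> k \<longrightarrow> Max (E i) < Min (E j)"
    using \<open>i < j\<close>
  proof (induction j)
    case 0 then show ?case by simp
  next
    case (Suc j)
    show ?case
    proof (intro impI)
      assume k: "Suc j \<le> k"
      show "Max (E i) < Min (E (Suc j))"
      proof (cases "i = j")
        case True then show ?thesis using step[of i] k assms(2) by simp
      next
        case False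
        then have ij: "i < j" using Suc.prems by simp
        have "Max (E i) < Min (E j)" using Suc.IH ij k by simp
        also have "Min (E j) \<le> Max (E j)" using *[of j] ij k by simp
        also have "\<dots> < Min (E (Suc j))" using step[of j] ij k by simp
        finally show ?thesis .
      qed
    qed
  qed
  then have "Max (E i) < Min (E j)" using assms(4) by simp
  moreover have "a \<le> Max (E i)" using *[of i] assms by simp
  moreover have "Min (E j) \<le> b" using *[of j] assms by simp
  ultimately show ?thesis by simp
qed

lemma admissible_disjoint:
  assumes "admissible k E" "i \<in> {1..k}" "j \<in> {1..k}" "i \<noteq> j"
  shows "E i \<inter> E j = {}"
proof (rule ccontr)
  assume "E i \<inter> E j \<noteq> {}"
  then obtain a where a: "a \<in> E i" "a \<in> E j" by blast
  have "i < j \<or> j < i" using assms(4) by arith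
  then show False
    using admissible_less[OF assms(1), of i j a a] admissible_less[OF assms(1), of j i a a] assms a by auto
qed

lemma finite_admissible_sums:
  assumes x: "fin_supp x" and f0: "f (\<lambda>n. 0) = 0"
  shows "finite {\<Sum>j=1..k. f (restr (E j) x) | k E. admissible k E}"
proof -
  let ?S = "{n. x n \<noteq> 0}"
  have "{\<Sum>j=1..k. f (restr (E j) x) | k E. admissible k E}
      \<subseteq> (\<lambda>F. \<Sum>A\<in>F. f (restr A x)) ` Pow (Pow ?S)"
  proof clarify
    fix k E assume adm: "admissible k E"
    have *: "restr (E j) x = restr (E j \<inter> ?S) x" for j by (auto simp: restr_def)
    have "(\<Sum>A\<in>(\<lambda>j. E j \<inter> ?S) ` {1..k}. f (restr A x)) = (\<Sum>j=1..k. f (restr (E j \<inter> ?S) x))"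
    proof (subst sum.reindex_nontrivial)
      fix i j assume "i \<in> {1..k}" "j \<in> {1..k}" "i \<noteq> j" "E i \<inter> ?S = E j \<inter> ?S"
      then have "E i \<inter> ?S = {}" using admissible_disjoint[OF adm, of i j] by blast
      then show "f (restr (E i \<inter> ?S) x) = 0" using f0 by (simp add: restr_def)
    qed auto
    then have "(\<Sum>j=1..k. f (restr (E j) x)) = (\<Sum>A\<in>(\<lambda>j. E j \<inter> ?S) ` {1..k}. f (restr A x))"
      using * by simp
    moreover have "(\<lambda>j. E j \<inter> ?S) ` {1..k} \<in> Pow (Pow ?S)" by auto
    ultimately show "(\<Sum>j=1..k. f (restr (E j) x)) \<in> (\<lambda>F. \<Sum>A\<in>F. f (restr A x)) ` Pow (Pow ?S)"
      by (rule image_eqI)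
  qed
  then show ?thesis
    by (rule finite_subset) (intro finite_imageI, simp add: x)
qed

lemma admissible_sums_nonempty: "{\<Sum>j=1..k. f (restr (E j) x) | k E. admissible k E} \<noteq> {}"
  using admissible_singleton by blast

lemma tsirelson_step_zero: "tsirelson_step \<alpha> m (\<lambda>n. 0) = 0"
proof (induction m)
  case 0 then show ?case by simp
next
  case (Suc m)
  have "restr E (\<lambda>n. 0) = (\<lambda>n. 0)" for E by (auto simp: restr_def)
  then have "{\<Sum>j=1..k. tsirelson_step \<alpha> m (restr (E j) (\<lambda>n. 0)) | k E. admissible k E} = {0}"
    using Suc admissible_singleton by auto
  then show ?case using Suc by simp
qed

lemma finite_tsirelson_sums:
  "fin_supp x \<Longrightarrow> finite {\<Sum>j=1..k. tsirelson_step \<alpha> m (restr (E j) x) | k E. admissible k E}"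
  by (rule finite_admissible_sums) (simp_all add: tsirelson_step_zero)

lemma tsirelson_step_ge:
  assumes "fin_supp x" shows "\<bar>x n\<bar> \<le> tsirelson_step \<alpha> m x"
proof (induction m)
  case 0 then show ?case using fin_supp_finite_range[OF assms] by simp
qed auto

lemma tsirelson_step_nonneg: "fin_supp x \<Longrightarrow> 0 \<le> tsirelson_step \<alpha> m x"
  using tsirelson_step_ge[of x 0 \<alpha> m] by linarith

lemma tsirelson_step_mono: "m \<le> n \<Longrightarrow> tsirelson_step \<alpha> m x \<le> tsirelson_step \<alpha> n x"
  by (rule lift_Suc_mono_le) auto

lemma tsirelson_step_SucI:
  assumes "fin_supp x" "0 \<le> \<alpha>" "tsirelson_step \<alpha> m x \<le> C"
    and "\<And>k E. admissible k E \<Longrightarrow> \<alpha> * (\<Sum>j=1..k. tsirelson_step \<alpha> m (restr (E j) x)) \<le> C"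
  shows "tsirelson_step \<alpha> (Suc m) x \<le> C"
proof -
  let ?A = "{\<Sum>j=1..k. tsirelson_step \<alpha> m (restr (E j) x) | k E. admissible k E}"
  have "Max ?A \<in> ?A"
    by (intro Max_in finite_tsirelson_sums admissible_sums_nonempty assms)
  then have "\<alpha> * Max ?A \<le> C" using assms(4) by auto
  then show ?thesis using assms(3) by simp
qed

lemma tsirelson_step_Suc_ge:
  assumes "fin_supp x" "0 \<le> \<alpha>" "admissible k E"
  shows "\<alpha> * (\<Sum>j=1..k. tsirelson_step \<alpha> m (restr (E j) x)) \<le> tsirelson_step \<alpha> (Suc m) x"
proof -
  have "(\<Sum>j=1..k. tsirelson_step \<alpha> m (restr (E j) x))
      \<le> Max {\<Sum>j=1..k. tsirelson_step \<alpha> m (restr (E j) x) | k E. admissible k E}"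
    using assms by (intro Max_ge finite_tsirelson_sums) auto
  then have "\<alpha> * (\<Sum>j=1..k. tsirelson_step \<alpha> m (restr (E j) x))
      \<le> \<alpha> * Max {\<Sum>j=1..k. tsirelson_step \<alpha> m (restr (E j) x) | k E. admissible k E}"
    using assms(2) by (rule mult_left_mono)
  then show ?thesis by simp
qed

lemma tsirelson_step_le_sum:
  assumes "0 \<le> \<alpha>" "\<alpha> \<le> 1" "finite S" "{n. x n \<noteq> 0} \<subseteq> S"
  shows "tsirelson_step \<alpha> m x \<le> (\<Sum>n\<in>S. \<bar>x n\<bar>)"
  using assms(4)
proof (induction m arbitrary: x)
  case 0
  have fs: "fin_supp x" using 0 assms(3) finite_subset by blast
  have "\<bar>x n\<bar> \<le> (\<Sum>n\<in>S. \<bar>x n\<bar>)" for n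
  proof (cases "n \<in> S")
    case True then show ?thesis using member_le_sum[of n S "\<lambda>n. \<bar>x n\<bar>"] assms(3) by simp
  next
    case False then have "x n = 0" using 0 by blast
    then show ?thesis by (simp add: sum_nonneg)
  qed
  then show ?case using fin_supp_finite_range[OF fs] by simp
next
  case (Suc m)
  have fs: "fin_supp x" using Suc.prems assms(3) finite_subset by blast
  show ?case
  proof (rule tsirelson_step_SucI[OF fs assms(1)])
    show "tsirelson_step \<alpha> m x \<le> (\<Sum>n\<in>S. \<bar>x n\<bar>)" using Suc by blast
    fix k E assume adm: "admissible k E"
    have "(\<Sum>j=1..k. tsirelson_step \<alpha> m (restr (E j) x)) \<le> (\<Sum>j=1..k. \<Sum>n\<in>S. \<bar>restr (E j) x n\<bar>)"
      using Suc.prems by (intro sum_mono Suc.IH) (auto simp: restr_def)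
    also have "\<dots> = (\<Sum>j=1..k. \<Sum>n\<in>E j \<inter> S. \<bar>x n\<bar>)"
    proof (rule sum.cong[OF refl])
      fix j
      have "(\<Sum>n\<in>S. \<bar>restr (E j) x n\<bar>) = (\<Sum>n\<in>S. if n \<in> E j then \<bar>x n\<bar> else 0)"
        by (intro sum.cong) (auto simp: restr_def)
      also have "\<dots> = (\<Sum>n\<in>E j \<inter> S. \<bar>x n\<bar>)"
        using assms(3) by (simp add: sum.inter_restrict[symmetric] Int_commute)
      finally show "(\<Sum>n\<in>S. \<bar>restr (E j) x n\<bar>) = (\<Sum>n\<in>E j \<inter> S. \<bar>x n\<bar>)" .
    qed
    also have "\<dots> = (\<Sum>n\<in>(\<Union>j\<in>{1..k}. E j \<inter> S). \<bar>x n\<bar>)"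
      using assms(3) admissible_disjoint[OF adm]
      by (intro sum.UNION_disjoint[symmetric]) (auto, blast)
    also have "\<dots> \<le> (\<Sum>n\<in>S. \<bar>x n\<bar>)"
      using assms(3) by (intro sum_mono2) auto
    finally have *: "(\<Sum>j=1..k. tsirelson_step \<alpha> m (restr (E j) x)) \<le> (\<Sum>n\<in>S. \<bar>x n\<bar>)" .
    have "\<alpha> * (\<Sum>j=1..k. tsirelson_step \<alpha> m (restr (E j) x)) \<le> 1 * (\<Sum>j=1..k. tsirelson_step \<alpha> m (restr (E j) x))"
      using assms(2) fs by (intro mult_right_mono sum_nonneg tsirelson_step_nonneg fin_supp_restr)
    then show "\<alpha> * (\<Sum>j=1..k. tsirelson_step \<alpha> m (restr (E j) x)) \<le> (\<Sum>n\<in>S. \<bar>x n\<bar>)"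
      using * by simp
  qed
qed

lemma tsirelson_step_triangle:
  assumes "0 \<le> \<alpha>" "fin_supp x" "fin_supp y"
  shows "tsirelson_step \<alpha> m (\<lambda>n. x n + y n) \<le> tsirelson_step \<alpha> m x + tsirelson_step \<alpha> m y"
  using assms(2,3)
proof (induction m arbitrary: x y)
  case 0
  have "\<bar>x n + y n\<bar> \<le> tsirelson_step \<alpha> 0 x + tsirelson_step \<alpha> 0 y" for n
    using tsirelson_step_ge[OF 0(1), of n \<alpha> 0] tsirelson_step_ge[OF 0(2), of n \<alpha> 0] by linarith
  then show ?case using fin_supp_finite_range[OF fin_supp_add[OF 0]] by simp
next
  case (Suc m)
  show ?case
  proof (rule tsirelson_step_SucI[OF fin_supp_add[OF Suc.prems] assms(1)])
    have "tsirelson_step \<alpha> m (\<lambda>n. x n + y n) \<le> tsirelson_step \<alpha> m x + tsirelson_step \<alpha> m y"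
      by (rule Suc.IH[OF Suc.prems])
    also have "\<dots> \<le> tsirelson_step \<alpha> (Suc m) x + tsirelson_step \<alpha> (Suc m) y"
      by (intro add_mono tsirelson_step_mono) auto
    finally show "tsirelson_step \<alpha> m (\<lambda>n. x n + y n)
      \<le> tsirelson_step \<alpha> (Suc m) x + tsirelson_step \<alpha> (Suc m) y" .
    fix k E assume adm: "admissible k E"
    have "(\<Sum>j=1..k. tsirelson_step \<alpha> m (restr (E j) (\<lambda>n. x n + y n)))
        \<le> (\<Sum>j=1..k. tsirelson_step \<alpha> m (restr (E j) x) + tsirelson_step \<alpha> m (restr (E j) y))"
      unfolding restr_add using Suc.prems by (intro sum_mono Suc.IH fin_supp_restr)
    then have "\<alpha> * (\<Sum>j=1..k. tsirelson_step \<alpha> m (restr (E j) (\<lambda>n. x n + y n)))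
        \<le> \<alpha> * (\<Sum>j=1..k. tsirelson_step \<alpha> m (restr (E j) x) + tsirelson_step \<alpha> m (restr (E j) y))"
      using assms(1) by (rule mult_left_mono)
    also have "\<dots> = \<alpha> * (\<Sum>j=1..k. tsirelson_step \<alpha> m (restr (E j) x))
        + \<alpha> * (\<Sum>j=1..k. tsirelson_step \<alpha> m (restr (E j) y))"
      by (simp add: sum.distrib distrib_left)
    also have "\<dots> \<le> tsirelson_step \<alpha> (Suc m) x + tsirelson_step \<alpha> (Suc m) y"
      by (intro add_mono tsirelson_step_Suc_ge Suc.prems assms(1) adm)
    finally show "\<alpha> * (\<Sum>j=1..k. tsirelson_step \<alpha> m (restr (E j) (\<lambda>n. x n + y n)))
        \<le> tsirelson_step \<alpha> (Suc m) x + tsirelson_step \<alpha> (Suc m) y" .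
  qed
qed

lemma tsirelson_step_scale_le:
  assumes "0 \<le> \<alpha>" "fin_supp x"
  shows "tsirelson_step \<alpha> m (\<lambda>n. c * x n) \<le> \<bar>c\<bar> * tsirelson_step \<alpha> m x"
  using assms(2)
proof (induction m arbitrary: x)
  case 0
  have "\<bar>c * x n\<bar> \<le> \<bar>c\<bar> * tsirelson_step \<alpha> 0 x" for n
    unfolding abs_mult by (intro mult_left_mono tsirelson_step_ge 0) simp
  then show ?case using fin_supp_finite_range[OF fin_supp_scale[OF 0, of c]] by simp
next
  case (Suc m)
  show ?case
  proof (rule tsirelson_step_SucI[OF fin_supp_scale[OF Suc.prems] assms(1)])
    have "tsirelson_step \<alpha> m (\<lambda>n. c * x n) \<le> \<bar>c\<bar> * tsirelson_step \<alpha> m x"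
      by (rule Suc.IH[OF Suc.prems])
    also have "\<dots> \<le> \<bar>c\<bar> * tsirelson_step \<alpha> (Suc m) x"
      by (intro mult_left_mono tsirelson_step_mono) auto
    finally show "tsirelson_step \<alpha> m (\<lambda>n. c * x n) \<le> \<bar>c\<bar> * tsirelson_step \<alpha> (Suc m) x" .
    fix k E assume adm: "admissible k E"
    have "(\<Sum>j=1..k. tsirelson_step \<alpha> m (restr (E j) (\<lambda>n. c * x n)))
        \<le> (\<Sum>j=1..k. \<bar>c\<bar> * tsirelson_step \<alpha> m (restr (E j) x))"
      unfolding restr_scale using Suc.prems by (intro sum_mono Suc.IH fin_supp_restr)
    then have "\<alpha> * (\<Sum>j=1..k. tsirelson_step \<alpha> m (restr (E j) (\<lambda>n. c * x n)))
        \<le> \<alpha> * (\<Sum>j=1..k. \<bar>c\<bar> * tsirelson_step \<alpha> m (restr (E j) x))"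
      using assms(1) by (rule mult_left_mono)
    also have "\<dots> = \<bar>c\<bar> * (\<alpha> * (\<Sum>j=1..k. tsirelson_step \<alpha> m (restr (E j) x)))"
      by (simp add: sum_distrib_left mult.left_commute)
    also have "\<dots> \<le> \<bar>c\<bar> * tsirelson_step \<alpha> (Suc m) x"
      by (intro mult_left_mono tsirelson_step_Suc_ge Suc.prems assms(1) adm) simp
    finally show "\<alpha> * (\<Sum>j=1..k. tsirelson_step \<alpha> m (restr (E j) (\<lambda>n. c * x n)))
        \<le> \<bar>c\<bar> * tsirelson_step \<alpha> (Suc m) x" .
  qed
qed

lemma tsirelson_norm_tendsto:
  assumes "0 \<le> \<alpha>" "\<alpha> \<le> 1" "fin_supp x"
  shows "(\<lambda>m. tsirelson_step \<alpha> m x) \<longlonglongrightarrow> tsirelson_norm \<alpha> x"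
proof -
  have "incseq (\<lambda>m. tsirelson_step \<alpha> m x)"
    by (intro incseq_SucI) simp
  moreover have "tsirelson_step \<alpha> m x \<le> (\<Sum>n\<in>{n. x n \<noteq> 0}. \<bar>x n\<bar>)" for m
    by (rule tsirelson_step_le_sum) (use assms in auto)
  ultimately have "convergent (\<lambda>m. tsirelson_step \<alpha> m x)"
    by (metis incseq_convergent convergentI)
  then show ?thesis
    unfolding tsirelson_norm_def by (simp add: convergent_LIMSEQ_iff)
qed

lemma tsirelson_norm_ge:
  assumes "0 \<le> \<alpha>" "\<alpha> \<le> 1" "fin_supp x"
  shows "\<bar>x n\<bar> \<le> tsirelson_norm \<alpha> x"
  using LIMSEQ_le_const[OF tsirelson_norm_tendsto[OF assms]] tsirelson_step_ge[OF assms(3)] by blast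

lemma tsirelson_norm_zero: "tsirelson_norm \<alpha> (\<lambda>n. 0) = 0"
  by (simp add: tsirelson_norm_def tsirelson_step_zero)

lemma tsirelson_norm_triangle:
  assumes "0 \<le> \<alpha>" "\<alpha> \<le> 1" "fin_supp x" "fin_supp y"
  shows "tsirelson_norm \<alpha> (\<lambda>n. x n + y n) \<le> tsirelson_norm \<alpha> x + tsirelson_norm \<alpha> y"
  by (rule LIMSEQ_le[OF tsirelson_norm_tendsto tendsto_add[OF tsirelson_norm_tendsto tsirelson_norm_tendsto]])
    (use assms fin_supp_add tsirelson_step_triangle in auto)

lemma tsirelson_norm_scale_le:
  assumes "0 \<le> \<alpha>" "\<alpha> \<le> 1" "fin_supp x"
  shows "tsirelson_norm \<alpha> (\<lambda>n. c * x n) \<le> \<bar>c\<bar> * tsirelson_norm \<alpha> x"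
  by (rule LIMSEQ_le[OF tsirelson_norm_tendsto tendsto_mult_left[OF tsirelson_norm_tendsto]])
    (use assms fin_supp_scale tsirelson_step_scale_le in auto)

lemma tsirelson_norm_scale:
  assumes "0 \<le> \<alpha>" "\<alpha> \<le> 1" "fin_supp x"
  shows "tsirelson_norm \<alpha> (\<lambda>n. c * x n) = \<bar>c\<bar> * tsirelson_norm \<alpha> x"
proof (cases "c = 0")
  case True then show ?thesis by (simp add: tsirelson_norm_zero)
next
  case False
  have "tsirelson_norm \<alpha> (\<lambda>n. inverse c * (c * x n)) \<le> \<bar>inverse c\<bar> * tsirelson_norm \<alpha> (\<lambda>n. c * x n)"
    by (rule tsirelson_norm_scale_le[OF assms(1,2) fin_supp_scale[OF assms(3)]])
  moreover have "(\<lambda>n. inverse c * (c * x n)) = x" using False by auto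
  ultimately have "\<bar>c\<bar> * tsirelson_norm \<alpha> x \<le> tsirelson_norm \<alpha> (\<lambda>n. c * x n)"
    using False by (simp add: field_simps)
  then show ?thesis using tsirelson_norm_scale_le[OF assms, of c] by simp
qed


section \<open>The completion of a normed space\<close>

text \<open>Cauchy sequences modulo null sequences.\<close>

quotient_type (overloaded) 'a banach_completion = "nat \<Rightarrow> 'a::real_normed_vector" / partial:
  "\<lambda>X Y. Cauchy X \<and> Cauchy Y \<and> (\<lambda>n. X n - Y n) \<longlonglongrightarrow> 0"
proof (rule part_equivpI)
  show "\<exists>X::nat \<Rightarrow> 'a. Cauchy X \<and> Cauchy X \<and> (\<lambda>n. X n - X n) \<longlonglongrightarrow> 0"
    by (rule exI[of _ "\<lambda>_. 0"]) (simp add: convergent_Cauchy convergent_const)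
  show "symp (\<lambda>X Y::nat \<Rightarrow> 'a. Cauchy X \<and> Cauchy Y \<and> (\<lambda>n. X n - Y n) \<longlonglongrightarrow> 0)"
  proof (rule sympI, safe)
    fix X Y :: "nat \<Rightarrow> 'a"
    assume "(\<lambda>n. X n - Y n) \<longlonglongrightarrow> 0"
    from tendsto_minus[OF this] show "(\<lambda>n. Y n - X n) \<longlonglongrightarrow> 0" by simp
  qed
  show "transp (\<lambda>X Y::nat \<Rightarrow> 'a. Cauchy X \<and> Cauchy Y \<and> (\<lambda>n. X n - Y n) \<longlonglongrightarrow> 0)"
  proof (rule transpI, safe)
    fix X Y Z :: "nat \<Rightarrow> 'a"
    assume "(\<lambda>n. X n - Y n) \<longlonglongrightarrow> 0" "(\<lambda>n. Y n - Z n) \<longlonglongrightarrow> 0"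
    from tendsto_add[OF this] show "(\<lambda>n. X n - Z n) \<longlonglongrightarrow> 0" by simp
  qed
qed

lemma Cauchy_norm_convergent:
  fixes X :: "nat \<Rightarrow> 'a::real_normed_vector"
  assumes "Cauchy X" shows "convergent (\<lambda>n. norm (X n))"
proof (rule Cauchy_convergent, rule metric_CauchyI)
  fix e :: real assume "0 < e"
  then obtain M where M: "\<And>m n. m \<ge> M \<Longrightarrow> n \<ge> M \<Longrightarrow> dist (X m) (X n) < e"
    using assms by (metis metric_CauchyD)
  have "dist (norm (X m)) (norm (X n)) < e" if "m \<ge> M" "n \<ge> M" for m n
    using M[OF that] norm_triangle_ineq3[of "X m" "X n"] by (simp add: dist_norm)
  then show "\<exists>M. \<forall>m\<ge>M. \<forall>n\<ge>M. dist (norm (X m)) (norm (X n)) < e" by blast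
qed

lemma Cauchy_const: "Cauchy (\<lambda>_. c::'a::real_normed_vector)"
  by (simp add: convergent_Cauchy convergent_const)

lemma Cauchy_plus:
  fixes X Y :: "nat \<Rightarrow> 'a::real_normed_vector"
  assumes "Cauchy X" "Cauchy Y" shows "Cauchy (\<lambda>n. X n + Y n)"
proof (rule metric_CauchyI)
  fix e :: real assume "0 < e"
  then have "0 < e / 2" by simp
  then obtain M N where M: "\<And>m n. m \<ge> M \<Longrightarrow> n \<ge> M \<Longrightarrow> dist (X m) (X n) < e / 2"
    and N: "\<And>m n. m \<ge> N \<Longrightarrow> n \<ge> N \<Longrightarrow> dist (Y m) (Y n) < e / 2"
    using assms by (metis metric_CauchyD)
  have "dist (X m + Y m) (X n + Y n) < e" if "m \<ge> max M N" "n \<ge> max M N" for m n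
    using M[of m n] N[of m n] that dist_triangle_add[of "X m" "Y m" "X n" "Y n"] by simp
  then show "\<exists>M. \<forall>m\<ge>M. \<forall>n\<ge>M. dist (X m + Y m) (X n + Y n) < e" by blast
qed

lemma Cauchy_scale:
  fixes X :: "nat \<Rightarrow> 'a::real_normed_vector"
  assumes "Cauchy X" shows "Cauchy (\<lambda>n. c *\<^sub>R X n)"
  using bounded_linear.Cauchy[OF bounded_linear_scaleR_right assms] .

instantiation banach_completion :: (real_normed_vector) real_normed_vector
begin

lift_definition zero_banach_completion :: "'a banach_completion" is "\<lambda>_. 0"
  by (simp add: Cauchy_const)

lift_definition plus_banach_completion ::
    "'a banach_completion \<Rightarrow> 'a banach_completion \<Rightarrow> 'a banach_completion" is "\<lambda>X Y n. X n + Y n"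
proof (safe intro!: Cauchy_plus)
  fix X X' Y Y' :: "nat \<Rightarrow> 'a"
  assume "(\<lambda>n. X n - X' n) \<longlonglongrightarrow> 0" "(\<lambda>n. Y n - Y' n) \<longlonglongrightarrow> 0"
  from tendsto_add[OF this] show "(\<lambda>n. X n + Y n - (X' n + Y' n)) \<longlonglongrightarrow> 0"
    by (simp add: algebra_simps)
qed

lift_definition scaleR_banach_completion ::
    "real \<Rightarrow> 'a banach_completion \<Rightarrow> 'a banach_completion" is "\<lambda>c X n. c *\<^sub>R X n"
proof (safe intro!: Cauchy_scale)
  fix c and X X' :: "nat \<Rightarrow> 'a"
  assume "(\<lambda>n. X n - X' n) \<longlonglongrightarrow> 0"
  from tendsto_scaleR[OF tendsto_const[of c] this] show "(\<lambda>n. c *\<^sub>R X n - c *\<^sub>R X' n) \<longlonglongrightarrow> 0"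
    by (simp add: scaleR_diff_right)
qed

definition uminus_banach_completion :: "'a banach_completion \<Rightarrow> 'a banach_completion"
  where "- x = (-1) *\<^sub>R (x :: 'a banach_completion)"

definition minus_banach_completion ::
    "'a banach_completion \<Rightarrow> 'a banach_completion \<Rightarrow> 'a banach_completion"
  where "x - y = x + - (y :: 'a banach_completion)"

lift_definition norm_banach_completion :: "'a banach_completion \<Rightarrow> real" is "\<lambda>X. lim (\<lambda>n. norm (X n))"
proof safe
  fix X X' :: "nat \<Rightarrow> 'a"
  assume "Cauchy X" "Cauchy X'" and d: "(\<lambda>n. X n - X' n) \<longlonglongrightarrow> 0"
  then have l: "(\<lambda>n. norm (X n)) \<longlonglongrightarrow> lim (\<lambda>n. norm (X n))" "(\<lambda>n. norm (X' n)) \<longlonglongrightarrow> lim (\<lambda>n. norm (X' n))"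
    using Cauchy_norm_convergent convergent_LIMSEQ_iff by blast+
  have "(\<lambda>n. norm (X n) - norm (X' n)) \<longlonglongrightarrow> 0"
    by (rule Lim_null_comparison[OF _ tendsto_norm_zero[OF d]]) (simp add: norm_triangle_ineq3)
  then show "lim (\<lambda>n. norm (X n)) = lim (\<lambda>n. norm (X' n))"
    using LIMSEQ_unique[OF tendsto_diff[OF l]] by force
qed

definition sgn_banach_completion :: "'a banach_completion \<Rightarrow> 'a banach_completion"
  where "sgn_banach_completion x = inverse (norm x) *\<^sub>R x"

definition dist_banach_completion :: "'a banach_completion \<Rightarrow> 'a banach_completion \<Rightarrow> real"
  where "dist_banach_completion x y = norm (x - y)"

definition uniformity_banach_completion :: "('a banach_completion \<times> 'a banach_completion) filter"
  where "uniformity_banach_completion = (INF e\<in>{0<..}. principal {(x, y). dist x y < e})"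

definition open_banach_completion :: "'a banach_completion set \<Rightarrow> bool"
  where "open_banach_completion S \<longleftrightarrow> (\<forall>x\<in>S. \<forall>\<^sub>F (x', y) in uniformity. x' = x \<longrightarrow> y \<in> S)"

instance
proof
  fix a b :: real and x y z :: "'a banach_completion"
  show "x + y + z = x + (y + z)"
    by transfer (auto intro!: Cauchy_plus simp: add.assoc)
  show "x + y = y + x"
    by transfer (auto intro!: Cauchy_plus simp: add.commute)
  show "0 + x = x"
    by transfer auto
  show "- x + x = 0"
    unfolding uminus_banach_completion_def
  proof (transfer, intro conjI)
    fix X :: "nat \<Rightarrow> 'a" assume X: "Cauchy X \<and> Cauchy X \<and> (\<lambda>n. X n - X n) \<longlonglongrightarrow> 0"
    show "Cauchy (\<lambda>n. (- 1) *\<^sub>R X n + X n)"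
      using X by (intro Cauchy_plus Cauchy_scale) auto
  qed (simp_all add: Cauchy_const)
  show "x - y = x + - y"
    by (simp add: minus_banach_completion_def)
  show "a *\<^sub>R (x + y) = a *\<^sub>R x + a *\<^sub>R y"
    by transfer (auto intro!: Cauchy_plus Cauchy_scale simp: scaleR_add_right)
  show "(a + b) *\<^sub>R x = a *\<^sub>R x + b *\<^sub>R x"
    by transfer (auto intro!: Cauchy_plus Cauchy_scale simp: scaleR_add_left)
  show "a *\<^sub>R b *\<^sub>R x = (a * b) *\<^sub>R x"
    by transfer (auto intro!: Cauchy_scale)
  show "1 *\<^sub>R x = x"
    by transfer auto
  show "sgn x = inverse (norm x) *\<^sub>R x"
    by (simp add: sgn_banach_completion_def)
  show "dist x y = norm (x - y)"
    by (simp add: dist_banach_completion_def)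
  show "(uniformity :: ('a banach_completion \<times> 'a banach_completion) filter)
      = (INF e\<in>{0<..}. principal {(x, y). dist x y < e})"
    by (simp add: uniformity_banach_completion_def)
  show "open S \<longleftrightarrow> (\<forall>x\<in>S. \<forall>\<^sub>F (x', y) in uniformity. x' = x \<longrightarrow> y \<in> S)"
    for S :: "'a banach_completion set"
    by (simp add: open_banach_completion_def)
  show "norm x = 0 \<longleftrightarrow> x = 0"
  proof (transfer, safe)
    fix X :: "nat \<Rightarrow> 'a" assume X: "Cauchy X" and l: "lim (\<lambda>n. norm (X n)) = 0"
    show "Cauchy (\<lambda>_. 0::'a)" by (rule Cauchy_const)
    have "(\<lambda>n. norm (X n)) \<longlonglongrightarrow> 0"
      using Cauchy_norm_convergent[OF X] l by (simp add: convergent_LIMSEQ_iff)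
    then show "(\<lambda>n. X n - 0) \<longlonglongrightarrow> 0" by (simp add: tendsto_norm_zero_iff)
  next
    fix X :: "nat \<Rightarrow> 'a" assume "(\<lambda>n. X n - 0) \<longlonglongrightarrow> 0"
    then show "lim (\<lambda>n. norm (X n)) = 0" by (intro limI) (simp add: tendsto_norm_zero)
  qed
  show "norm (x + y) \<le> norm x + norm y"
  proof (transfer, safe)
    fix X Y :: "nat \<Rightarrow> 'a" assume X: "Cauchy X" and Y: "Cauchy Y"
    note * = Cauchy_norm_convergent[unfolded convergent_LIMSEQ_iff]
    show "lim (\<lambda>n. norm (X n + Y n)) \<le> lim (\<lambda>n. norm (X n)) + lim (\<lambda>n. norm (Y n))"
      by (rule LIMSEQ_le[OF *[OF Cauchy_plus[OF X Y]] tendsto_add[OF *[OF X] *[OF Y]]])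
        (simp add: norm_triangle_ineq)
  qed
  show "norm (a *\<^sub>R x) = \<bar>a\<bar> * norm x"
  proof (transfer, safe)
    fix a and X :: "nat \<Rightarrow> 'a" assume X: "Cauchy X"
    have "(\<lambda>n. \<bar>a\<bar> * norm (X n)) \<longlonglongrightarrow> \<bar>a\<bar> * lim (\<lambda>n. norm (X n))"
      using Cauchy_norm_convergent[OF X] by (intro tendsto_mult_left) (simp add: convergent_LIMSEQ_iff)
    then show "lim (\<lambda>n. norm (a *\<^sub>R X n)) = \<bar>a\<bar> * lim (\<lambda>n. norm (X n))"
      by (intro limI) simp
  qed
qed

end

lift_definition to_completion :: "'a::real_normed_vector \<Rightarrow> 'a banach_completion" is "\<lambda>v _. v"
  by (simp add: Cauchy_const)

lemma to_completion_add: "to_completion (v + w) = to_completion v + to_completion w"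
  by transfer (auto simp: Cauchy_const)

lemma to_completion_scaleR: "to_completion (c *\<^sub>R v) = c *\<^sub>R to_completion v"
  by transfer (auto simp: Cauchy_const)

lemma norm_to_completion: "norm (to_completion v) = norm v"
  by transfer simp

lemma linear_to_completion: "linear to_completion"
  by (rule linearI) (simp_all add: to_completion_add to_completion_scaleR)

lemma to_completion_diff: "to_completion (v - w) = to_completion v - to_completion w"
  by (rule linear_diff[OF linear_to_completion])

lemma dist_to_completion: "dist (to_completion v) (to_completion w) = dist v w"
  by (simp add: dist_norm to_completion_diff[symmetric] norm_to_completion)

lemma to_completion_dense:
  assumes "0 < e" shows "\<exists>v. dist (to_completion v) x < e"
proof -
  have "\<exists>v. norm (to_completion v + (-1) *\<^sub>R x) < e"
    using assms
  proof (transfer, safe)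
    fix e :: real and X :: "nat \<Rightarrow> 'a" assume e: "0 < e" and X: "Cauchy X"
    from e have "0 < e / 2" by simp
    then obtain M where M: "\<And>m n. m \<ge> M \<Longrightarrow> n \<ge> M \<Longrightarrow> dist (X m) (X n) < e / 2"
      using metric_CauchyD[OF X] by metis
    have "convergent (\<lambda>n. norm (X M + (-1) *\<^sub>R X n))"
      by (intro Cauchy_norm_convergent Cauchy_plus Cauchy_const Cauchy_scale X)
    then have "(\<lambda>n. norm (X M + (-1) *\<^sub>R X n)) \<longlonglongrightarrow> lim (\<lambda>n. norm (X M + (-1) *\<^sub>R X n))"
      by (simp only: convergent_LIMSEQ_iff)
    moreover have "\<forall>n\<ge>M. norm (X M + (-1) *\<^sub>R X n) \<le> e / 2"
      using M[of M] by (auto simp: dist_norm less_imp_le)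
    ultimately have "lim (\<lambda>n. norm (X M + (-1) *\<^sub>R X n)) \<le> e / 2"
      using LIMSEQ_le_const2 by blast
    then have "lim (\<lambda>n. norm (X M + (-1) *\<^sub>R X n)) < e" using e by simp
    then show "\<exists>v. lim (\<lambda>n. norm (v + (-1) *\<^sub>R X n)) < e" by blast
  qed
  then show ?thesis by (simp add: dist_norm)
qed

lemma closure_range_to_completion: "closure (range to_completion) = UNIV"
  using to_completion_dense by (auto simp: closure_approachable)

lemma abs_completion_tendsto:
  assumes "Cauchy X"
  shows "(\<lambda>n. to_completion (X n)) \<longlonglongrightarrow> abs_banach_completion X"
proof (rule metric_LIMSEQ_I)
  fix e :: real assume e: "0 < e"
  then have "0 < e / 2" by simp
  then obtain M where M: "\<And>m n. m \<ge> M \<Longrightarrow> n \<ge> M \<Longrightarrow> dist (X m) (X n) < e / 2"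
    using metric_CauchyD[OF assms] by metis
  have "dist (to_completion (X m)) (abs_banach_completion X) < e" if "m \<ge> M" for m
  proof -
    let ?Z = "\<lambda>n. X m + (-1) *\<^sub>R X n"
    have X1: "Cauchy (\<lambda>n. (-1) *\<^sub>R X n)" and Z: "Cauchy ?Z"
      by (intro Cauchy_plus Cauchy_const Cauchy_scale assms)+
    have "abs_banach_completion ?Z
        = abs_banach_completion (\<lambda>_. X m) + abs_banach_completion (\<lambda>n. (-1) *\<^sub>R X n)"
      by (rule plus_banach_completion.abs_eq[symmetric]) (auto simp: Cauchy_const X1[simplified])
    also have "abs_banach_completion (\<lambda>n. (-1) *\<^sub>R X n) = (-1) *\<^sub>R abs_banach_completion X"
      by (rule scaleR_banach_completion.abs_eq[symmetric]) (simp add: assms)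
    also have "abs_banach_completion (\<lambda>_. X m) = to_completion (X m)"
      by (simp add: to_completion.abs_eq)
    finally have "to_completion (X m) - abs_banach_completion X = abs_banach_completion ?Z"
      by simp
    moreover have "norm (abs_banach_completion ?Z) = lim (\<lambda>n. norm (?Z n))"
      by (rule norm_banach_completion.abs_eq) (use Z in simp)
    ultimately have d: "dist (to_completion (X m)) (abs_banach_completion X) = lim (\<lambda>n. norm (?Z n))"
      by (simp only: dist_norm)
    have "convergent (\<lambda>n. norm (X m + (-1) *\<^sub>R X n))"
      by (intro Cauchy_norm_convergent Cauchy_plus Cauchy_const Cauchy_scale assms)
    then have "(\<lambda>n. norm (X m + (-1) *\<^sub>R X n)) \<longlonglongrightarrow> lim (\<lambda>n. norm (X m + (-1) *\<^sub>R X n))"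
      by (simp only: convergent_LIMSEQ_iff)
    moreover have "\<forall>n\<ge>M. norm (X m + (-1) *\<^sub>R X n) \<le> e / 2"
      using M[OF that] by (auto simp: dist_norm less_imp_le)
    ultimately have "lim (\<lambda>n. norm (X m + (-1) *\<^sub>R X n)) \<le> e / 2"
      using LIMSEQ_le_const2 by blast
    then show ?thesis using e d by simp
  qed
  then show "\<exists>M. \<forall>m\<ge>M. dist (to_completion (X m)) (abs_banach_completion X) < e" by blast
qed

instance banach_completion :: (real_normed_vector) banach
proof
  fix Y :: "nat \<Rightarrow> 'a banach_completion" assume Y: "Cauchy Y"
  have "\<exists>v. dist (to_completion v) (Y n) < inverse (real (Suc n))" for n
    by (rule to_completion_dense) simp
  then obtain v where v: "\<And>n. dist (to_completion (v n)) (Y n) < inverse (real (Suc n))"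
    by metis
  have diff: "(\<lambda>n. to_completion (v n) - Y n) \<longlonglongrightarrow> 0"
    by (rule Lim_null_comparison[OF _ LIMSEQ_inverse_real_of_nat])
      (use v in \<open>auto simp: dist_norm less_imp_le\<close>)
  have "Cauchy (\<lambda>n. (to_completion (v n) - Y n) + Y n)"
    by (intro Cauchy_plus Y LIMSEQ_imp_Cauchy[OF diff])
  then have "Cauchy (\<lambda>n. to_completion (v n))" by simp
  then have "Cauchy v" by (simp add: Cauchy_def dist_to_completion)
  from tendsto_diff[OF abs_completion_tendsto[OF this] diff]
  have "Y \<longlonglongrightarrow> abs_banach_completion v" by simp
  then show "convergent Y" by (rule convergentI)
qed


section \<open>Tsirelson space\<close>

text \<open>The space \<open>c\<^sub>0\<^sub>0\<close> of eventually zero sequences, under the Tsirelson norm for \<open>\<alpha> = 1/2\<close>.\<close>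

typedef tsirelson_c00 = "{x :: nat \<Rightarrow> real. finite {n. x n \<noteq> 0}}"
  morphisms c00_seq Abs_c00
  by (rule exI[of _ "\<lambda>_. 0"]) simp

setup_lifting type_definition_tsirelson_c00

lemma fin_supp_c00_seq: "fin_supp (c00_seq x)"
  using c00_seq by simp

instantiation tsirelson_c00 :: real_normed_vector
begin

lift_definition zero_tsirelson_c00 :: tsirelson_c00 is "\<lambda>_. 0"
  by simp

lift_definition plus_tsirelson_c00 :: "tsirelson_c00 \<Rightarrow> tsirelson_c00 \<Rightarrow> tsirelson_c00"
  is "\<lambda>x y n. x n + y n"
  by (rule fin_supp_add)

lift_definition scaleR_tsirelson_c00 :: "real \<Rightarrow> tsirelson_c00 \<Rightarrow> tsirelson_c00"
  is "\<lambda>c x n. c * x n"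
  by (rule fin_supp_scale)

lift_definition uminus_tsirelson_c00 :: "tsirelson_c00 \<Rightarrow> tsirelson_c00"
  is "\<lambda>x n. - x n"
  by simp

lift_definition minus_tsirelson_c00 :: "tsirelson_c00 \<Rightarrow> tsirelson_c00 \<Rightarrow> tsirelson_c00"
  is "\<lambda>x y n. x n - y n"
  subgoal for x y
    by (rule finite_subset[of _ "{n. x n \<noteq> 0} \<union> {n. y n \<noteq> 0}"]) auto
  done

lift_definition norm_tsirelson_c00 :: "tsirelson_c00 \<Rightarrow> real" is "tsirelson_norm (1/2)" .

definition sgn_tsirelson_c00 :: "tsirelson_c00 \<Rightarrow> tsirelson_c00"
  where "sgn_tsirelson_c00 x = inverse (norm x) *\<^sub>R x"

definition dist_tsirelson_c00 :: "tsirelson_c00 \<Rightarrow> tsirelson_c00 \<Rightarrow> real"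
  where "dist_tsirelson_c00 x y = norm (x - y)"

definition uniformity_tsirelson_c00 :: "(tsirelson_c00 \<times> tsirelson_c00) filter"
  where "uniformity_tsirelson_c00 = (INF e\<in>{0<..}. principal {(x, y). dist x y < e})"

definition open_tsirelson_c00 :: "tsirelson_c00 set \<Rightarrow> bool"
  where "open_tsirelson_c00 S \<longleftrightarrow> (\<forall>x\<in>S. \<forall>\<^sub>F (x', y) in uniformity. x' = x \<longrightarrow> y \<in> S)"

instance
proof
  fix a b :: real and x y z :: tsirelson_c00
  show "x + y + z = x + (y + z)" by transfer (simp add: add.assoc)
  show "x + y = y + x" by transfer (simp add: add.commute)
  show "0 + x = x" by transfer simp
  show "- x + x = 0" by transfer simp
  show "x - y = x + - y" by transfer simp
  show "a *\<^sub>R (x + y) = a *\<^sub>R x + a *\<^sub>R y" by transfer (simp add: distrib_left)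
  show "(a + b) *\<^sub>R x = a *\<^sub>R x + b *\<^sub>R x" by transfer (simp add: distrib_right)
  show "a *\<^sub>R b *\<^sub>R x = (a * b) *\<^sub>R x" by transfer (simp add: mult.assoc)
  show "1 *\<^sub>R x = x" by transfer simp
  show "sgn x = inverse (norm x) *\<^sub>R x" by (simp add: sgn_tsirelson_c00_def)
  show "dist x y = norm (x - y)" by (simp add: dist_tsirelson_c00_def)
  show "(uniformity :: (tsirelson_c00 \<times> tsirelson_c00) filter)
      = (INF e\<in>{0<..}. principal {(x, y). dist x y < e})"
    by (simp add: uniformity_tsirelson_c00_def)
  show "open S \<longleftrightarrow> (\<forall>x\<in>S. \<forall>\<^sub>F (x', y) in uniformity. x' = x \<longrightarrow> y \<in> S)"
    for S :: "tsirelson_c00 set"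
    by (simp add: open_tsirelson_c00_def)
  show "norm x = 0 \<longleftrightarrow> x = 0"
  proof (transfer, safe)
    fix x :: "nat \<Rightarrow> real" assume "fin_supp x" "tsirelson_norm (1/2) x = 0"
    then have "\<bar>x n\<bar> \<le> 0" for n using tsirelson_norm_ge[of "1/2" x n] by simp
    then show "x = (\<lambda>_. 0)" by auto
  qed (rule tsirelson_norm_zero)
  show "norm (x + y) \<le> norm x + norm y"
    by transfer (rule tsirelson_norm_triangle, auto)
  show "norm (a *\<^sub>R x) = \<bar>a\<bar> * norm x"
    by transfer (rule tsirelson_norm_scale, auto)
qed

end

type_synonym tsirelson = "tsirelson_c00 banach_completion"

lift_definition c00_unit :: "nat \<Rightarrow> tsirelson_c00" is "\<lambda>n i. if i = n then 1 else 0"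
  by simp

definition tsirelson_unit :: "nat \<Rightarrow> tsirelson"
  where "tsirelson_unit n = to_completion (c00_unit n)"

end

theory Submission
  imports Defs
begin

text \<open>A reduction is tested on sequences that take only two values in each coordinate. Let
  \<open>l\<close> be a function on \<open>\<nat>\<close> all of whose fibres are infinite, and send a point \<open>x\<close> of the Cantor
  space to the sequence that is \<open>w k\<close> where \<open>x k\<close> holds and \<open>0\<close> elsewhere, with
  \<open>w k = 2 powr (- l k / p)\<close> for \<open>l\<^sub>p\<close> and \<open>w k = 2 powr (- l k)\<close> for \<open>c\<^sub>0\<close>. On such sequences the two relations become
  equality modulo an ideal of sets: for every \<open>p\<close> the summable ideal
  \<open>{A. (\<Sum>k\<in>A. 2 powr (- l k)) < \<infinity>}\<close>, and for \<open>c\<^sub>0\<close> the ideal of the sets that meet every fibre of \<open>l\<close> in a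
  finite set.

  A fusion argument based on Baire category (\<open>fusion\<close>) finds coordinates
  \<open>b\<^sub>0 < b\<^sub>1 < \<dots>\<close> with \<open>l (b i) = l i\<close>, fixed values for all other coordinates, and successive
  intervals \<open>block M i\<close>, such that the \<open>i\<close>-th block of the value of the reduction depends, up to an
  error \<open>3 / 2 ^ i\<close>, only on whether bit \<open>b i\<close> is set. So the reduction gives a block sequence
  \<open>v\<^sub>i\<close> for which \<open>\<Sum>i\<in>A. v\<^sub>i\<close> converges in Tsirelson space exactly if \<open>A\<close> is in the ideal
  (\<open>block_splitting_of_reduction\<close>). Two facts on Tsirelson space exclude this.

  First, \<open>k\<close> blocks that lie beyond \<open>k\<close> have norm at least half the sum of their norms
  (\<open>sum_tnorm_blocks_le\<close>). In the case of \<open>c\<^sub>0\<close> the norms of the blocks in one fibre are bounded below,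
  because a sum over infinitely many of them diverges; hence every fibre has a finite set of
  blocks, arbitrarily far out, whose sum has norm at least \<open>1/2\<close>. The sum over the union of these sets
  diverges although the union is in the ideal (\<open>coef_blocks_ne_vanishing_ideal\<close>).

  Secondly, in Tsirelson space suitable repeated averages of bounded block sequences are small. In the
  case of \<open>l\<^sub>p\<close> the lower estimate shows that \<open>\<parallel>v\<^sub>i\<parallel> \<le> C / 2 ^ l i\<close> for almost all \<open>i\<close> in each fibre of
  large index (\<open>weights_dominate_blocks\<close>): otherwise a set of small mass would have a large sum.
  Using the fibres as a supply of vectors of every dyadic size, one builds sets of mass \<open>1\<close> over
  which the \<open>v\<^sub>i\<close> form an average repeated \<open>q\<close> times; its norm is at most about \<open>C / 2 ^ q\<close>
  (\<open>thin_averages\<close>). A union of such sets for \<open>q = 0, 1, 2, \<dots>\<close> has infinite mass although the sum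
  over it converges (\<open>coef_blocks_ne_summable_ideal\<close>).\<close>

section \<open>The Tsirelson norm of a restriction\<close>

definition tnorm :: "nat set \<Rightarrow> (nat \<Rightarrow> real) \<Rightarrow> real"
  where "tnorm E a = tsirelson_norm (1/2) (restr E a)"

lemma fin_supp_restr_finite: "finite E \<Longrightarrow> fin_supp (restr E a)"
  by (rule finite_subset[of _ E]) (auto simp: restr_def)

lemma restr_restr: "restr E (restr F a) = restr (E \<inter> F) a"
  by (auto simp: restr_def)

lemma tnorm_ge: "finite E \<Longrightarrow> n \<in> E \<Longrightarrow> \<bar>a n\<bar> \<le> tnorm E a"
  using tsirelson_norm_ge[of "1/2" "restr E a" n] fin_supp_restr_finite[of E a]
  by (simp add: tnorm_def restr_def)

lemma tnorm_nonneg: "finite E \<Longrightarrow> 0 \<le> tnorm E a"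
  using tsirelson_norm_ge[of "1/2" "restr E a" 0] fin_supp_restr_finite[of E a]
  by (simp add: tnorm_def)

lemma tnorm_empty [simp]: "tnorm {} a = 0"
  using tsirelson_norm_zero[of "1/2"] by (simp add: tnorm_def restr_def)

lemma tnorm_add: "finite E \<Longrightarrow> tnorm E (\<lambda>n. a n + b n) \<le> tnorm E a + tnorm E b"
  unfolding tnorm_def restr_add by (rule tsirelson_norm_triangle) (auto intro: fin_supp_restr_finite)

lemma tnorm_cong: "(\<And>n. n \<in> E \<Longrightarrow> a n = b n) \<Longrightarrow> tnorm E a = tnorm E b"
proof -
  assume "\<And>n. n \<in> E \<Longrightarrow> a n = b n"
  then have "restr E a = restr E b" by (auto simp: restr_def)
  then show ?thesis by (simp add: tnorm_def)
qed

lemma tnorm_minus: "finite E \<Longrightarrow> tnorm E (\<lambda>n. - a n) = tnorm E a"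
  using tsirelson_norm_scale[of "1/2" "restr E a" "-1"] fin_supp_restr_finite[of E a]
    restr_scale[of E "-1" a]
  by (simp add: tnorm_def)

lemma tnorm_diff_triangle:
  assumes "finite E"
  shows "tnorm E (\<lambda>n. a n - c n) \<le> tnorm E (\<lambda>n. a n - b n) + tnorm E (\<lambda>n. b n - c n)"
  using tnorm_add[OF assms, of "\<lambda>n. a n - b n" "\<lambda>n. b n - c n"] by simp

lemma tnorm_diff_commute: "finite E \<Longrightarrow> tnorm E (\<lambda>n. a n - b n) = tnorm E (\<lambda>n. b n - a n)"
  using tnorm_minus[of E "\<lambda>n. a n - b n"] by simp

lemma tnorm_le_sum:
  assumes "finite E" shows "tnorm E a \<le> (\<Sum>n\<in>E. \<bar>a n\<bar>)"
proof -
  have "tsirelson_step (1/2) m (restr E a) \<le> (\<Sum>n\<in>E. \<bar>restr E a n\<bar>)" for m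
    by (rule tsirelson_step_le_sum) (use assms in \<open>auto simp: restr_def\<close>)
  then have "tnorm E a \<le> (\<Sum>n\<in>E. \<bar>restr E a n\<bar>)"
    unfolding tnorm_def
    by (intro LIMSEQ_le_const2[OF tsirelson_norm_tendsto[OF _ _ fin_supp_restr_finite]])
      (use assms in auto)
  also have "\<dots> = (\<Sum>n\<in>E. \<bar>a n\<bar>)" by (rule sum.cong) (auto simp: restr_def)
  finally show ?thesis .
qed

lemma tsirelson_step_restr_le:
  assumes "fin_supp x"
  shows "tsirelson_step (1/2) m (restr E x) \<le> tsirelson_step (1/2) m x"
  using assms
proof (induction m arbitrary: x E)
  case 0
  have "\<bar>restr E x n\<bar> \<le> tsirelson_step (1/2) 0 x" for n
    using tsirelson_step_ge[OF 0, of n _ 0] tsirelson_step_nonneg[OF 0, of _ 0]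
    by (simp add: restr_def del: tsirelson_step.simps)
  then show ?case using fin_supp_finite_range[OF fin_supp_restr[OF 0]] by simp
next
  case (Suc m)
  show ?case
  proof (rule tsirelson_step_SucI[OF fin_supp_restr[OF Suc.prems]])
    show "tsirelson_step (1/2) m (restr E x) \<le> tsirelson_step (1/2) (Suc m) x"
      using Suc.IH[OF Suc.prems, of E] tsirelson_step_mono[of m "Suc m" "1/2" x] by linarith
    fix k F assume adm: "admissible k F"
    have "(\<Sum>j=1..k. tsirelson_step (1/2) m (restr (F j) (restr E x)))
        \<le> (\<Sum>j=1..k. tsirelson_step (1/2) m (restr (F j) x))"
    proof (rule sum_mono)
      fix j
      have "restr (F j) (restr E x) = restr E (restr (F j) x)" by (auto simp: restr_def)
      then show "tsirelson_step (1/2) m (restr (F j) (restr E x)) \<le> tsirelson_step (1/2) m (restr (F j) x)"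
        using Suc.IH[OF fin_supp_restr[OF Suc.prems]] by simp
    qed
    then show "1/2 * (\<Sum>j=1..k. tsirelson_step (1/2) m (restr (F j) (restr E x)))
        \<le> tsirelson_step (1/2) (Suc m) x"
      using tsirelson_step_Suc_ge[OF Suc.prems _ adm, of "1/2" m] by linarith
  qed simp
qed

lemma tnorm_mono:
  assumes "finite F" "E \<subseteq> F" shows "tnorm E a \<le> tnorm F a"
proof -
  have "restr E a = restr E (restr F a)" using assms(2) by (auto simp: restr_def fun_eq_iff)
  then have "tsirelson_step (1/2) m (restr E a) \<le> tsirelson_step (1/2) m (restr F a)" for m
    using tsirelson_step_restr_le[OF fin_supp_restr_finite[OF assms(1)]] by metis
  then show ?thesis unfolding tnorm_def
    by (intro LIMSEQ_le[OF tsirelson_norm_tendsto tsirelson_norm_tendsto])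
      (use assms finite_subset[OF assms(2,1)] in \<open>auto intro: fin_supp_restr_finite\<close>)
qed

lemma tnorm_Un:
  assumes "finite E" "finite F" shows "tnorm (E \<union> F) a \<le> tnorm E a + tnorm F a"
proof -
  have "restr (E \<union> F) a = (\<lambda>n. restr E a n + restr (F - E) a n)" by (auto simp: restr_def)
  then have "tnorm (E \<union> F) a \<le> tnorm E a + tnorm (F - E) a"
    using tsirelson_norm_triangle[of "1/2" "restr E a" "restr (F - E) a"] assms
    by (simp add: tnorm_def fin_supp_restr_finite)
  also have "\<dots> \<le> tnorm E a + tnorm F a" using tnorm_mono[OF assms(2), of "F - E" a] by simp
  finally show ?thesis .
qed

lemma tnorm_UN:
  assumes "finite I" "\<And>i. i \<in> I \<Longrightarrow> finite (F i)"
  shows "tnorm (\<Union>i\<in>I. F i) a \<le> (\<Sum>i\<in>I. tnorm (F i) a)"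
  using assms
proof (induction I rule: finite_induct)
  case (insert i I)
  have "tnorm (F i \<union> (\<Union>i\<in>I. F i)) a \<le> tnorm (F i) a + tnorm (\<Union>i\<in>I. F i) a"
    using insert by (intro tnorm_Un) auto
  then show ?case using insert by (simp add: add_mono order_trans)
qed simp

lemma tnorm_admissible_le:
  assumes "finite E" "admissible k F"
  shows "(\<Sum>j=1..k. tnorm (F j \<inter> E) a) \<le> 2 * tnorm E a"
proof -
  note fs = fin_supp_restr_finite[OF assms(1)]
  have "(\<lambda>m. \<Sum>j=1..k. tsirelson_step (1/2) m (restr (F j \<inter> E) a)) \<longlonglongrightarrow> (\<Sum>j=1..k. tnorm (F j \<inter> E) a)"
    unfolding tnorm_def
    by (intro tendsto_sum tsirelson_norm_tendsto fin_supp_restr_finite) (use assms in auto)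
  moreover have "(\<Sum>j=1..k. tsirelson_step (1/2) m (restr (F j \<inter> E) a)) \<le> 2 * tnorm E a" for m
  proof -
    have "1/2 * (\<Sum>j=1..k. tsirelson_step (1/2) m (restr (F j \<inter> E) a))
        \<le> tsirelson_step (1/2) (Suc m) (restr E a)"
      using tsirelson_step_Suc_ge[OF fs _ assms(2), of "1/2" m a] by (simp add: restr_restr)
    also have "\<dots> \<le> tnorm E a"
      unfolding tnorm_def
      by (rule incseq_le[OF incseq_SucI tsirelson_norm_tendsto]) (use fs in auto)
    finally show ?thesis by simp
  qed
  ultimately show ?thesis by (intro LIMSEQ_le_const2) auto
qed

text \<open>The limit norm satisfies the implicit equation of Tsirelson space. Only the upper bound is stated
  here; since only finitely many sums over admissible families occur, the maximum is attained by one
  family.\<close>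

lemma tnorm_cases:
  assumes "finite E"
  obtains "tnorm E a = 0"
  | n where "n \<in> E" "tnorm E a \<le> \<bar>a n\<bar>"
  | k F where "admissible k F" "tnorm E a \<le> 1/2 * (\<Sum>j=1..k. tnorm (F j \<inter> E) a)"
proof -
  let ?x = "restr E a"
  note fs = fin_supp_restr_finite[OF assms, of a]
  let ?S = "{\<Sum>j=1..k. tsirelson_norm (1/2) (restr (F j) ?x) | k F. admissible k F}"
  let ?R = "range (\<lambda>n. \<bar>?x n\<bar>)"
  have finS: "finite ?S" by (rule finite_admissible_sums[OF fs]) (rule tsirelson_norm_zero)
  have neS: "?S \<noteq> {}" by (rule admissible_sums_nonempty)
  have finR: "finite ?R" by (rule fin_supp_finite_range[OF fs])
  have step_le: "tsirelson_step (1/2) m y \<le> tsirelson_norm (1/2) y" if "fin_supp y" for m y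
    by (rule incseq_le[OF incseq_SucI tsirelson_norm_tendsto]) (use that in auto)
  have "tsirelson_step (1/2) m ?x \<le> max (Max ?R) (1/2 * Max ?S)" for m
  proof (induction m)
    case (Suc m)
    show ?case
    proof (rule tsirelson_step_SucI[OF fs _ Suc])
      fix k F assume adm: "admissible k F"
      have "(\<Sum>j=1..k. tsirelson_step (1/2) m (restr (F j) ?x))
          \<le> (\<Sum>j=1..k. tsirelson_norm (1/2) (restr (F j) ?x))"
        by (intro sum_mono step_le fin_supp_restr fs)
      also have "\<dots> \<le> Max ?S" using adm by (intro Max_ge finS) auto
      finally show "1/2 * (\<Sum>j=1..k. tsirelson_step (1/2) m (restr (F j) ?x))
          \<le> max (Max ?R) (1/2 * Max ?S)" by simp
    qed simp
  qed simp
  then have "tsirelson_norm (1/2) ?x \<le> max (Max ?R) (1/2 * Max ?S)"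
    by (intro LIMSEQ_le_const2[OF tsirelson_norm_tendsto]) (use fs in auto)
  then consider "tnorm E a \<le> Max ?R" | "tnorm E a \<le> 1/2 * Max ?S"
    unfolding tnorm_def by linarith
  then show thesis
  proof cases
    case 1
    have "Max ?R \<in> ?R" by (rule Max_in[OF finR]) simp
    then obtain n where "tnorm E a \<le> \<bar>?x n\<bar>" using 1 by auto
    then show thesis
      using that(1) that(2)[of n] tnorm_nonneg[OF assms, of a] by (auto simp: restr_def split: if_splits)
  next
    case 2
    have "Max ?S \<in> ?S" by (rule Max_in[OF finS neS])
    then obtain k F where "admissible k F" "tnorm E a \<le> 1/2 * (\<Sum>j=1..k. tnorm (F j \<inter> E) a)"
      using 2 by (auto simp: restr_restr tnorm_def)
    then show thesis by (rule that(3))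
  qed
qed

section \<open>Convergence of series along the unit vector basis\<close>

lemma c00_seq_sum: "c00_seq (\<Sum>n\<in>E. a n *\<^sub>R c00_unit n) = restr E a" if "finite E"
  using that
proof (induction E rule: finite_induct)
  case empty show ?case by (simp add: zero_tsirelson_c00.rep_eq restr_def)
next
  case (insert n E)
  then show ?case
    by (auto simp: plus_tsirelson_c00.rep_eq scaleR_tsirelson_c00.rep_eq c00_unit.rep_eq restr_def)
qed

lemma norm_sum_tsirelson_unit:
  assumes "finite E" shows "norm (\<Sum>n\<in>E. a n *\<^sub>R tsirelson_unit n) = tnorm E a"
proof -
  have "(\<Sum>n\<in>E. a n *\<^sub>R tsirelson_unit n) = to_completion (\<Sum>n\<in>E. a n *\<^sub>R c00_unit n)"
    by (simp add: tsirelson_unit_def linear_sum[OF linear_to_completion] to_completion_scaleR)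
  then show ?thesis
    using c00_seq_sum[OF assms, of a]
    by (simp add: norm_to_completion norm_tsirelson_c00.rep_eq tnorm_def)
qed

lemma coef_tsirelson_iff:
  "a \<in> coef tsirelson_unit \<longleftrightarrow> (\<forall>e>0. \<exists>m. \<forall>n. tnorm {m..<n} a < e)"
proof -
  have "a \<in> coef tsirelson_unit \<longleftrightarrow> (\<forall>e>0. \<exists>N. \<forall>m\<ge>N. \<forall>n. tnorm {m..<n} a < e)"
    unfolding coef_def mem_Collect_eq summable_Cauchy by (simp add: norm_sum_tsirelson_unit)
  also have "\<dots> \<longleftrightarrow> (\<forall>e>0. \<exists>m. \<forall>n. tnorm {m..<n} a < e)"
    by (meson order.strict_trans1 tnorm_mono finite_atLeastLessThan ivl_subset order_refl le_refl)
  finally show ?thesis .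
qed

lemma coef_diff: "a \<in> coef x \<Longrightarrow> b \<in> coef x \<Longrightarrow> (\<lambda>n. a n - b n) \<in> coef x"
  by (simp add: coef_def scaleR_diff_left summable_diff)

lemma coef_cong_diff:
  assumes "(\<lambda>n. a n - b n) \<in> coef x"
  shows "a \<in> coef x \<longleftrightarrow> b \<in> coef x"
proof -
  have "b \<in> coef x" if "a \<in> coef x" using coef_diff[OF that assms] by simp
  moreover have "a \<in> coef x" if "b \<in> coef x"
    using summable_add[of "\<lambda>n. b n *\<^sub>R x n" "\<lambda>n. (a n - b n) *\<^sub>R x n"] assms that
    by (simp add: coef_def scaleR_diff_left)
  ultimately show ?thesis by blast
qed

text \<open>Sets \<open>F m\<close> of norm at least \<open>d\<close> arbitrarily far out contradict the Cauchy criterion, because the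
  norm grows with the set.\<close>

lemma not_coefI:
  assumes "0 < d" "\<And>m. finite (F m) \<and> F m \<subseteq> {m..} \<and> d \<le> tnorm (F m) a"
  shows "a \<notin> coef tsirelson_unit"
proof
  assume "a \<in> coef tsirelson_unit"
  then obtain m where m: "\<And>n. tnorm {m..<n} a < d" using assms(1) by (auto simp: coef_tsirelson_iff)
  have "F m \<subseteq> {m..<Suc (Max (F m))}" using assms(2)[of m] by (auto simp: less_Suc_eq_le)
  then have "tnorm (F m) a \<le> tnorm {m..<Suc (Max (F m))} a" by (intro tnorm_mono) auto
  then show False using m assms(2)[of m] by (meson not_le order_trans)
qed

text \<open>A window far out misses \<open>F 0, \<dots>, F (K - 1)\<close>, so a tail of the convergent series of norms
  bounds its norm.\<close>

lemma coef_UN_I: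
  assumes fin: "\<And>k. finite (F k)" and le: "\<And>k. tnorm (F k) a \<le> g k" and "summable g"
  shows "restr (\<Union>k. F k) a \<in> coef tsirelson_unit"
  unfolding coef_tsirelson_iff
proof (intro allI impI)
  fix e :: real assume "0 < e"
  then obtain K where K: "\<And>n. norm (sum g {K..<n}) < e"
    using \<open>summable g\<close> unfolding summable_Cauchy by blast
  have g0: "0 \<le> g k" for k using le[of k] tnorm_nonneg[OF fin, of k a] by linarith
  define m where "m = Suc (Max (\<Union>k<K. F k))"
  have m: "x < m" if "k < K" "x \<in> F k" for x k
    unfolding m_def using that fin by (intro le_imp_less_Suc Max_ge) auto
  have "tnorm {m..<n} (restr (\<Union>k. F k) a) < e" for n
  proof -
    let ?W = "{m..<n} \<inter> (\<Union>k. F k)"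
    have "\<forall>x\<in>?W. \<exists>k. x \<in> F k" by blast
    then obtain f where f: "\<And>x. x \<in> ?W \<Longrightarrow> x \<in> F (f x)" by metis
    have K': "K \<le> f x" if "x \<in> ?W" for x
      using m[of "f x" x] f[OF that] that by (meson IntD1 atLeastLessThan_iff not_le)
    define K' where "K' = Suc (Max (f ` ?W))"
    have sub: "?W \<subseteq> (\<Union>k\<in>{K..<K'}. F k)"
    proof
      fix x assume x: "x \<in> ?W"
      then have "f x < K'" unfolding K'_def by (intro le_imp_less_Suc Max_ge) auto
      then show "x \<in> (\<Union>k\<in>{K..<K'}. F k)" using K'[OF x] f[OF x] by auto
    qed
    have "tnorm {m..<n} (restr (\<Union>k. F k) a) = tnorm ?W a"
      by (simp add: tnorm_def restr_restr)
    also have "\<dots> \<le> tnorm (\<Union>k\<in>{K..<K'}. F k) a" using fin sub by (intro tnorm_mono) auto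
    also have "\<dots> \<le> (\<Sum>k\<in>{K..<K'}. tnorm (F k) a)" using fin by (intro tnorm_UN) auto
    also have "\<dots> \<le> sum g {K..<K'}" by (intro sum_mono le)
    also have "\<dots> < e" using K[of K'] by simp
    finally show ?thesis .
  qed
  then show "\<exists>m. \<forall>n. tnorm {m..<n} (restr (\<Union>k. F k) a) < e" by blast
qed

section \<open>Baire category and Borel functions\<close>

definition comeager :: "'a::topological_space set \<Rightarrow> bool"
  where "comeager G \<longleftrightarrow> (\<exists>\<U>. countable \<U> \<and> (\<forall>U\<in>\<U>. open U \<and> closure U = UNIV) \<and> \<Inter>\<U> \<subseteq> G)"

lemma comeager_open_dense: "open U \<Longrightarrow> closure U = UNIV \<Longrightarrow> comeager U"
  unfolding comeager_def by (rule exI[of _ "{U}"]) auto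

lemma comeager_superset: "comeager G \<Longrightarrow> G \<subseteq> H \<Longrightarrow> comeager H"
  unfolding comeager_def by (meson subset_trans)

lemma comeager_INT:
  assumes "countable I" "\<And>i. i \<in> I \<Longrightarrow> comeager (G i)"
  shows "comeager (\<Inter>i\<in>I. G i)"
proof -
  from assms(2) have "\<forall>i\<in>I. \<exists>\<U>. countable \<U> \<and> (\<forall>U\<in>\<U>. open U \<and> closure U = UNIV) \<and> \<Inter>\<U> \<subseteq> G i"
    unfolding comeager_def by blast
  from bchoice[OF this] obtain \<U> where \<U>: "\<forall>i\<in>I. countable (\<U> i) \<and> (\<forall>U\<in>\<U> i. open U \<and> closure U = UNIV) \<and> \<Inter>(\<U> i) \<subseteq> G i"
    by blast
  show ?thesis unfolding comeager_def
  proof (intro exI[of _ "\<Union>i\<in>I. \<U> i"] conjI)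
    show "countable (\<Union>i\<in>I. \<U> i)" using assms(1) \<U> by (intro countable_UN) auto
    show "\<forall>U\<in>(\<Union>i\<in>I. \<U> i). open U \<and> closure U = UNIV" using \<U> by blast
    show "\<Inter>(\<Union>i\<in>I. \<U> i) \<subseteq> (\<Inter>i\<in>I. G i)"
    proof (intro subsetI INT_I)
      fix x i assume "x \<in> \<Inter>(\<Union>i\<in>I. \<U> i)" "i \<in> I"
      then have "x \<in> \<Inter>(\<U> i)" by auto
      then show "x \<in> G i" using \<U> \<open>i \<in> I\<close> by blast
    qed
  qed
qed

lemma comeager_Int: "comeager G \<Longrightarrow> comeager H \<Longrightarrow> comeager (G \<inter> H)"
  using comeager_INT[of "{G, H}" id] by auto

definition baire_property :: "'a::topological_space set \<Rightarrow> bool"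
  where "baire_property S \<longleftrightarrow> (\<exists>U G. open U \<and> comeager G \<and> S \<inter> G = U \<inter> G)"

lemma baire_propertyI: "open U \<Longrightarrow> comeager G \<Longrightarrow> S \<inter> G = U \<inter> G \<Longrightarrow> baire_property S"
  unfolding baire_property_def by (intro exI conjI)

lemma baire_property_open: "open U \<Longrightarrow> baire_property U"
  unfolding baire_property_def by (intro exI[of _ U] exI[of _ UNIV]) (auto intro: comeager_open_dense)

lemma baire_property_Compl:
  assumes "baire_property S" shows "baire_property (- S)"
proof -
  obtain U G where UG: "open U" "comeager G" "S \<inter> G = U \<inter> G"
    using assms by (auto simp: baire_property_def)
  let ?V = "- closure U"
  have "closure (U \<union> ?V) = UNIV"
    using closure_subset[of ?V] by auto
  then have "comeager (U \<union> ?V)" using UG by (intro comeager_open_dense) auto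
  then have "comeager (G \<inter> (U \<union> ?V))" using UG comeager_Int by blast
  moreover have "open ?V" by auto
  moreover have "- S \<inter> (G \<inter> (U \<union> ?V)) = ?V \<inter> (G \<inter> (U \<union> ?V))"
    using UG(3) closure_subset[of U] by blast
  ultimately show ?thesis using baire_propertyI by metis
qed

lemma baire_property_UN:
  fixes S :: "nat \<Rightarrow> 'a::topological_space set"
  assumes "\<And>i. baire_property (S i)" shows "baire_property (\<Union>i. S i)"
proof -
  have "\<forall>i. \<exists>U G. open U \<and> comeager G \<and> S i \<inter> G = U \<inter> G"
    by (intro allI assms[unfolded baire_property_def])
  from choice[OF this] obtain U where "\<forall>i. \<exists>G. open (U i) \<and> comeager G \<and> S i \<inter> G = U i \<inter> G"
    by blast
  from choice[OF this] obtain G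
    where UG: "\<And>i. open (U i)" "\<And>i. comeager (G i)" "\<And>i. S i \<inter> G i = U i \<inter> G i"
    by blast
  have "comeager (\<Inter>i. G i)" using UG by (intro comeager_INT) auto
  moreover have "(\<Union>i. S i) \<inter> (\<Inter>i. G i) = (\<Union>i. U i) \<inter> (\<Inter>i. G i)"
    using UG(3) by blast
  moreover have "open (\<Union>i. U i)" using UG(1) by auto
  ultimately show ?thesis using baire_propertyI by metis
qed

text \<open>The sets that are open modulo a meagre set form a \<open>\<sigma>\<close>-algebra; the complement of an open set \<open>U\<close> is
  replaced by the complement of the closure of \<open>U\<close>.\<close>

lemma baire_property_borel:
  assumes "S \<in> sets borel" shows "baire_property S"
proof -
  have "S \<in> sigma_sets UNIV {S. open S}" using assms by (simp add: borel_def)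
  then show ?thesis
  proof induction
    case (Basic a) then show ?case by (simp add: baire_property_open)
  next
    case Empty show ?case by (rule baire_property_open) simp
  next
    case (Compl a) then show ?case using baire_property_Compl by (simp add: Compl_eq_Diff_UNIV)
  next
    case (Union a) then show ?case by (intro baire_property_UN) auto
  qed
qed

lemma borel_measurable_continuous_on_comeager:
  fixes h :: "'a::topological_space \<Rightarrow> 'b::second_countable_topology"
  assumes "h \<in> borel_measurable borel"
  obtains G where "comeager G" "continuous_on G h"
proof -
  obtain B :: "'b set set" where B: "countable B" "topological_basis B"
    using ex_countable_basis by blast
  have "\<forall>b\<in>B. \<exists>U G. open U \<and> comeager G \<and> h -` b \<inter> G = U \<inter> G"
  proof
    fix b assume "b \<in> B"
    then have "open b" using B(2) topological_basis_open by blast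
    then have "h -` b \<in> sets borel" using measurable_sets_borel[OF assms, of b] by simp
    then show "\<exists>U G. open U \<and> comeager G \<and> h -` b \<inter> G = U \<inter> G"
      by (rule baire_property_borel[unfolded baire_property_def])
  qed
  from bchoice[OF this] obtain U where "\<forall>b\<in>B. \<exists>G. open (U b) \<and> comeager G \<and> h -` b \<inter> G = U b \<inter> G"
    by blast
  from bchoice[OF this] obtain G where UG: "\<And>b. b \<in> B \<Longrightarrow> open (U b)" "\<And>b. b \<in> B \<Longrightarrow> comeager (G b)"
    "\<And>b. b \<in> B \<Longrightarrow> h -` b \<inter> G b = U b \<inter> G b"
    by blast
  let ?G = "\<Inter>b\<in>B. G b"
  have "continuous_on ?G h"
    unfolding continuous_on_open_invariant
  proof (intro allI impI)
    fix V :: "'b set" assume "open V"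
    then obtain B' where B': "B' \<subseteq> B" "\<Union>B' = V" using B(2) unfolding topological_basis_def by blast
    have "(\<Union>b\<in>B'. U b) \<inter> ?G = h -` V \<inter> ?G"
      using B' UG(3) by blast
    moreover have "open (\<Union>b\<in>B'. U b)" using UG(1) B'(1) by blast
    ultimately show "\<exists>A. open A \<and> A \<inter> ?G = h -` V \<inter> ?G" by blast
  qed
  moreover have "comeager ?G" using UG(2) B(1) by (intro comeager_INT) auto
  ultimately show thesis by (intro that)
qed

section \<open>Baire category in the Cantor space\<close>

definition cyl :: "(nat \<Rightarrow> bool) \<Rightarrow> nat \<Rightarrow> (nat \<Rightarrow> bool) set"
  where "cyl x n = {y. \<forall>k<n. y k = x k}"

lemma open_cyl: "open (cyl x n)"
proof -
  have "cyl x n = (\<Inter>k\<in>{..<n}. (\<lambda>y. y k) -` {x k})" by (auto simp: cyl_def)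
  moreover have "open ((\<lambda>y::nat \<Rightarrow> bool. y k) -` {x k})" for k
    by (rule open_vimage) (auto simp: open_discrete intro: continuous_intros)
  ultimately show ?thesis by auto
qed

lemma open_cantorD:
  assumes "open U" "x \<in> U" obtains n where "cyl x n \<subseteq> U"
proof -
  have "openin (product_topology (\<lambda>i. euclidean) UNIV) U" using assms(1) by (simp add: open_fun_def)
  then obtain X where X: "x \<in> Pi\<^sub>E UNIV X" "finite {i. X i \<noteq> topspace euclidean}" "Pi\<^sub>E UNIV X \<subseteq> U"
    using product_topology_open_contains_basis[of "\<lambda>i. euclidean" UNIV U x] assms(2) by auto
  define n where "n = Suc (Max {i. X i \<noteq> UNIV})"
  have "X i = UNIV" if "i \<ge> n" for i
    using that Max_ge[of "{i. X i \<noteq> UNIV}" i] X(2) unfolding n_def by fastforce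
  then have "y i \<in> X i" if "y \<in> cyl x n" for y i
    using that X(1) by (cases "i < n") (auto simp: cyl_def PiE_iff)
  then have "y \<in> Pi\<^sub>E UNIV X" if "y \<in> cyl x n" for y
    using that by (auto simp: PiE_iff)
  then show thesis using X(3) by (intro that[of n]) blast
qed

lemma comeager_cantor_Int:
  fixes G :: "(nat \<Rightarrow> bool) set"
  assumes "comeager G" "open U" "U \<noteq> {}"
  shows "G \<inter> U \<noteq> {}"
proof -
  obtain \<U> where \<U>: "countable \<U>" "\<And>U. U \<in> \<U> \<Longrightarrow> open U \<and> closure U = UNIV" "\<Inter>\<U> \<subseteq> G"
    using assms(1) unfolding comeager_def by blast
  let ?X = "euclidean :: (nat \<Rightarrow> bool) topology"
  have "compact (UNIV :: bool set)" by (rule finite_imp_compact) simp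
  then have "compact_space (euclidean :: bool topology)"
    by (simp add: compact_space_def)
  then have "compact_space (product_topology (\<lambda>_::nat. euclidean :: bool topology) UNIV)"
    by (simp add: compact_space_product_topology)
  then have "compact_space ?X" by (simp only: euclidean_product_topology)
  moreover have "Hausdorff_space (euclidean :: bool topology)"
    unfolding Hausdorff_space_def
  proof (intro allI impI)
    fix a b :: bool assume "a \<in> topspace euclidean \<and> b \<in> topspace euclidean \<and> a \<noteq> b"
    then show "\<exists>U V. openin euclidean U \<and> openin euclidean V \<and> a \<in> U \<and> b \<in> V \<and> disjnt U V"
      by (intro exI[of _ "{a}"] exI[of _ "{b}"]) (auto simp: open_discrete)
  qed
  then have "Hausdorff_space (product_topology (\<lambda>_::nat. euclidean :: bool topology) UNIV)"
    by (simp only: Hausdorff_space_product_topology) blast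
  then have "Hausdorff_space ?X" by (simp only: euclidean_product_topology)
  ultimately have lc: "locally_compact_space ?X \<and> regular_space ?X"
    by (blast intro: compact_imp_locally_compact_space compact_Hausdorff_imp_regular_space)
  have "?X closure_of (\<Inter>\<U>) = topspace ?X"
    by (rule Baire_category[OF disjI2[OF lc] \<U>(1)]) (use \<U>(2) in auto)
  then have "closure (\<Inter>\<U>) = UNIV" by simp
  then have "\<Inter>\<U> \<inter> U \<noteq> {}" using assms(2,3) open_Int_closure_eq_empty[of U "\<Inter>\<U>"] by auto
  then show ?thesis using \<U>(3) by blast
qed

text \<open>Replacing the first \<open>L\<close> bits of a point. Every finite modification of a point has this form, and for
  fixed \<open>L\<close> and \<open>e\<close> the map pulls dense open sets back to dense open sets.\<close>

definition graft :: "nat \<Rightarrow> (nat \<Rightarrow> bool) \<Rightarrow> (nat \<Rightarrow> bool) \<Rightarrow> nat \<Rightarrow> bool"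
  where "graft L e x = (\<lambda>k. if k < L then e k else x k)"

lemma continuous_on_graft: "continuous_on S (graft L e)"
  unfolding graft_def
proof (rule continuous_on_coordinatewise_then_product)
  show "continuous_on S (\<lambda>x. if i < L then e i else x i)" for i
    by (cases "i < L") (auto intro: continuous_on_subset[OF continuous_on_product_coordinates])
qed

lemma open_dense_vimage_graft:
  assumes "open U" "closure U = UNIV"
  shows "open (graft L e -` U)" "closure (graft L e -` U) = UNIV"
proof -
  show "open (graft L e -` U)" by (rule open_vimage[OF assms(1) continuous_on_graft])
  show "closure (graft L e -` U) = UNIV"
  proof (intro set_eqI iffI UNIV_I, unfold closure_iff_nhds_not_empty, intro allI impI)
    fix x and A W :: "(nat \<Rightarrow> bool) set" assume W: "W \<subseteq> A" "open W" "x \<in> W"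
    obtain n where n: "cyl x n \<subseteq> W" using open_cantorD[OF W(2,3)] .
    have "graft L e x \<in> cyl (graft L e x) (max n L)" by (simp add: cyl_def)
    then have "U \<inter> cyl (graft L e x) (max n L) \<noteq> {}"
      using open_Int_closure_eq_empty[OF open_cyl, of "graft L e x" "max n L" U] assms(2) by auto
    then obtain y where y: "y \<in> U" "y \<in> cyl (graft L e x) (max n L)" by blast
    have "graft L e (graft L x y) = y" using y(2) by (auto simp: graft_def cyl_def)
    moreover have "graft L x y \<in> cyl x n" using y(2) by (auto simp: graft_def cyl_def)
    ultimately have "graft L x y \<in> graft L e -` U \<inter> A" using n W(1) y(1) by auto
    then show "graft L e -` U \<inter> A \<noteq> {}" by blast
  qed
qed

text \<open>There are only countably many ways to modify finitely many bits, and each pulls a comeager set back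
  to a comeager set.\<close>

lemma comeager_tail_invariant:
  fixes G :: "(nat \<Rightarrow> bool) set"
  assumes "comeager G"
  shows "comeager {x. \<forall>L y. (\<forall>k\<ge>L. y k = x k) \<longrightarrow> y \<in> G}"
proof -
  obtain \<U> where \<U>: "countable \<U>" "\<And>U. U \<in> \<U> \<Longrightarrow> open U \<and> closure U = UNIV" "\<Inter>\<U> \<subseteq> G"
    using assms(1) unfolding comeager_def by blast
  let ?E = "{S :: nat set. finite S}"
  let ?G = "\<Inter>(L, S, U) \<in> UNIV \<times> ?E \<times> \<U>. graft L (\<lambda>k. k \<in> S) -` U"
  have "countable (UNIV \<times> ?E \<times> \<U> :: (nat \<times> nat set \<times> _) set)"
    using \<U>(1) by (intro countable_SIGMA countable_Collect_finite) auto
  then have "comeager ?G"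
    using \<U>(2) by (intro comeager_INT) (auto intro!: comeager_open_dense open_dense_vimage_graft)
  moreover have "?G \<subseteq> {x. \<forall>L y. (\<forall>k\<ge>L. y k = x k) \<longrightarrow> y \<in> G}"
  proof clarify
    fix x L y assume x: "x \<in> ?G" and y: "\<forall>k\<ge>L. y k = x k"
    have "y = graft L (\<lambda>k. k \<in> {k. k < L \<and> y k}) x" using y by (auto simp: graft_def not_less)
    moreover have "graft L (\<lambda>k. k \<in> {k. k < L \<and> y k}) x \<in> U" if "U \<in> \<U>" for U
    proof -
      have "(L, {k. k < L \<and> y k}, U) \<in> UNIV \<times> ?E \<times> \<U>" using that by auto
      from INT_D[OF x this] show ?thesis by simp
    qed
    ultimately have "y \<in> \<Inter>\<U>" by auto
    then show "y \<in> G" using \<U>(3) by blast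
  qed
  ultimately show ?thesis by (rule comeager_superset)
qed

section \<open>Fusion: a Borel function that splits into blocks\<close>

lemma abs_tnorm_diff_le:
  assumes "finite E" shows "\<bar>tnorm E a - tnorm E b\<bar> \<le> (\<Sum>m\<in>E. \<bar>a m - b m\<bar>)"
proof -
  have "tnorm E a \<le> tnorm E (\<lambda>n. a n - b n) + tnorm E b"
    using tnorm_add[OF assms, of "\<lambda>n. a n - b n" b] by simp
  moreover have "tnorm E b \<le> tnorm E (\<lambda>n. a n - b n) + tnorm E a"
    using tnorm_add[OF assms, of "\<lambda>n. b n - a n" a] tnorm_diff_commute[OF assms, of a b] by simp
  ultimately show ?thesis using tnorm_le_sum[OF assms, of "\<lambda>n. a n - b n"] by linarith
qed

lemma continuous_on_tnorm:
  assumes "finite E" "\<And>m. m \<in> E \<Longrightarrow> continuous_on S (\<lambda>x. d x m)"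
  shows "continuous_on S (\<lambda>x. tnorm E (d x))"
  unfolding continuous_on_def
proof
  fix x assume x: "x \<in> S"
  have "((\<lambda>y. \<Sum>m\<in>E. \<bar>d y m - d x m\<bar>) \<longlongrightarrow> (\<Sum>m\<in>E. \<bar>d x m - d x m\<bar>)) (at x within S)"
    using assms(2) x by (intro tendsto_intros) (auto simp: continuous_on_def)
  then have "((\<lambda>y. \<Sum>m\<in>E. \<bar>d y m - d x m\<bar>) \<longlongrightarrow> 0) (at x within S)" by simp
  then have "((\<lambda>y. tnorm E (d y) - tnorm E (d x)) \<longlongrightarrow> 0) (at x within S)"
    by (rule Lim_null_comparison[rotated]) (simp add: abs_tnorm_diff_le[OF assms(1)])
  then show "((\<lambda>y. tnorm E (d y)) \<longlongrightarrow> tnorm E (d x)) (at x within S)"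
    by (rule LIM_zero_cancel)
qed

lemma finite_prefixes: "finite {e :: nat \<Rightarrow> bool. \<forall>k\<ge>L. \<not> e k}"
proof -
  have "{e :: nat \<Rightarrow> bool. \<forall>k\<ge>L. \<not> e k} \<subseteq> (\<lambda>S k. k \<in> S) ` Pow {..<L}"
  proof
    fix e :: "nat \<Rightarrow> bool" assume "e \<in> {e. \<forall>k\<ge>L. \<not> e k}"
    then have "{k. e k} \<in> Pow {..<L}" by (auto simp: not_le[symmetric])
    then show "e \<in> (\<lambda>S k. k \<in> S) ` Pow {..<L}" by (intro image_eqI[of _ _ "{k. e k}"]) auto
  qed
  then show ?thesis by (rule finite_subset) simp
qed

text \<open>One step of the fusion. The bits below \<open>L\<close> remain free, and the bits in \<open>{L..<n}\<close> are fixed to those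
  of \<open>Q\<close>. Changing free bits changes \<open>h x\<close> by a vector of the coefficient space, whose tails tend to
  \<open>0\<close>; Baire category makes this uniform in the remaining bits, which gives the first estimate, for
  the coordinates from \<open>M\<close> on. Afterwards continuity of \<open>h\<close> on \<open>C\<close> makes the bits from \<open>n\<close> on
  irrelevant for the coordinates below \<open>M\<close>. Membership in the sets \<open>W j\<close> serves to put all limits of the
  fusion into \<open>C\<close>.\<close>

lemma fusion_stage:
  fixes h :: "(nat \<Rightarrow> bool) \<Rightarrow> nat \<Rightarrow> real" and W :: "nat \<Rightarrow> (nat \<Rightarrow> bool) set"
  assumes C: "comeager C" and inv: "\<And>x y. x \<in> C \<Longrightarrow> \<forall>k\<ge>L. y k = x k \<Longrightarrow> y \<in> C"
    and h: "continuous_on C h" and W: "\<And>j. open (W j)" "\<And>j. C \<subseteq> W j"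
    and coef: "\<And>x y. \<forall>k\<ge>L. y k = x k \<Longrightarrow> (\<lambda>m. h x m - h y m) \<in> coef tsirelson_unit"
    and \<delta>: "0 < \<delta>"
  shows "\<exists>Q n M. L \<le> n \<and> M0 < M \<and> (\<forall>k<L. Q k = P k) \<and>
    (\<forall>x. (\<forall>k\<in>{L..<n}. x k = Q k) \<longrightarrow> (\<forall>j\<le>i. x \<in> W j)) \<and>
    (\<forall>x\<in>C. (\<forall>k\<in>{L..<n}. x k = Q k) \<longrightarrow>
      (\<forall>y N. (\<forall>k\<ge>L. y k = x k) \<longrightarrow> tnorm {M..<N} (\<lambda>m. h x m - h y m) \<le> \<delta>) \<and>
      (\<forall>y\<in>C. (\<forall>k<n. y k = x k) \<longrightarrow> (\<Sum>m<M. \<bar>h x m - h y m\<bar>) \<le> \<delta>))"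
proof -
  define E where "E = {e :: nat \<Rightarrow> bool. \<forall>k\<ge>L. \<not> e k}"
  have finE: "finite E" unfolding E_def by (rule finite_prefixes)
  have hm: "continuous_on C (\<lambda>x. h x m)" for m
    using h by (rule continuous_on_product_then_coordinatewise)
  have graft_C: "graft L e x \<in> C" if "x \<in> C" for e x
    using inv[OF that, of "graft L e x"] by (simp add: graft_def)
  have as_graft: "\<exists>e\<in>E. y = graft L e x" if "\<forall>k\<ge>L. y k = x k" for x y
    by (rule bexI[of _ "\<lambda>k. k < L \<and> y k"]) (use that in \<open>auto simp: graft_def not_less E_def\<close>)
  have hg: "continuous_on C (\<lambda>x. h (graft L e x) m)" for e m
    by (rule continuous_on_compose2[OF hm continuous_on_graft]) (use graft_C in auto)
  define d where "d e x = (\<lambda>m. h x m - h (graft L e x) m)" for e x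
  \<comment> \<open>The points of \<open>C\<close> at which the tails from \<open>M\<close> on are not yet small.\<close>
  define bad where "bad M = {x \<in> C. \<exists>e\<in>E. \<exists>N. \<delta> / 2 < tnorm {M..<N} (d e x)}" for M
  have "\<exists>U. open U \<and> U \<inter> C = bad M" for M
  proof -
    have "\<exists>A. open A \<and> A \<inter> C = {x \<in> C. \<delta> / 2 < tnorm {M..<N} (d e x)}" for e N
      unfolding d_def
      by (intro open_Collect_less_Int continuous_on_tnorm continuous_intros hm hg) auto
    then have "\<forall>p. \<exists>A. open A \<and> A \<inter> C = {x \<in> C. \<delta> / 2 < tnorm {M..<snd p} (d (fst p) x)}"
      by blast
    from choice[OF this] obtain A
      where A: "\<And>p. open (A p)" "\<And>p. A p \<inter> C = {x \<in> C. \<delta> / 2 < tnorm {M..<snd p} (d (fst p) x)}"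
      by blast
    have "(\<Union>p\<in>E \<times> UNIV. A p) \<inter> C = (\<Union>p\<in>E \<times> UNIV. {x \<in> C. \<delta> / 2 < tnorm {M..<snd p} (d (fst p) x)})"
      unfolding A(2)[symmetric] by blast
    also have "\<dots> = bad M" by (auto simp: bad_def) blast
    finally have "(\<Union>p\<in>E \<times> UNIV. A p) \<inter> C = bad M" .
    moreover have "open (\<Union>p\<in>E \<times> UNIV. A p)" by (intro open_UN ballI A(1))
    ultimately show ?thesis by (intro exI conjI)
  qed
  then have "\<forall>M. \<exists>U. open U \<and> U \<inter> C = bad M" by (intro allI)
  from choice[OF this] obtain U where U: "\<And>M. open (U M)" "\<And>M. U M \<inter> C = bad M" by blast
  \<comment> \<open>A point of this set that is not in \<open>U M\<close> has a whole neighbourhood outside \<open>U M\<close>.\<close>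
  have "comeager (U M \<union> - closure (U M))" for M
  proof (rule comeager_open_dense)
    show "closure (U M \<union> - closure (U M)) = UNIV"
      using closure_subset[of "- closure (U M)"] by auto
  qed (use U in auto)
  then have "comeager (C \<inter> (\<Inter>M. U M \<union> - closure (U M)))"
    using C by (intro comeager_Int comeager_INT) auto
  moreover have "P \<in> cyl P L" by (simp add: cyl_def)
  ultimately obtain x0 where x0: "x0 \<in> C" "x0 \<in> cyl P L" "\<And>M. x0 \<in> U M \<union> - closure (U M)"
    using comeager_cantor_Int[OF _ open_cyl[of P L]] by blast
  have "\<forall>e\<in>E. \<exists>M. \<forall>N. tnorm {M..<N} (d e x0) < \<delta> / 2"
  proof
    fix e
    have "d e x0 \<in> coef tsirelson_unit" unfolding d_def by (rule coef) (simp add: graft_def)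
    then show "\<exists>M. \<forall>N. tnorm {M..<N} (d e x0) < \<delta> / 2"
      using half_gt_zero[OF \<delta>] unfolding coef_tsirelson_iff by blast
  qed
  from bchoice[OF this] obtain g where g: "\<And>e N. e \<in> E \<Longrightarrow> tnorm {g e..<N} (d e x0) < \<delta> / 2"
    by blast
  define M where "M = Suc M0 + sum g E"
  have gM: "g e \<le> M" if "e \<in> E" for e
    unfolding M_def using member_le_sum[OF that, of g] finE by simp
  have "x0 \<notin> bad M"
  proof
    assume "x0 \<in> bad M"
    then obtain e N where e: "e \<in> E" "\<delta> / 2 < tnorm {M..<N} (d e x0)" unfolding bad_def by blast
    have "tnorm {M..<N} (d e x0) \<le> tnorm {g e..<N} (d e x0)"
      using gM[OF e(1)] by (intro tnorm_mono) auto
    then show False using g[OF e(1), of N] e(2) by simp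
  qed
  then have "x0 \<in> - closure (U M)" using x0 U(2)[of M] by blast
  then obtain n0 where n0: "cyl x0 n0 \<subseteq> - closure (U M)"
    using open_cantorD[of "- closure (U M)" x0] by auto
  have good: "tnorm {M..<N} (d e x) \<le> \<delta> / 2" if "x \<in> C" "x \<in> cyl x0 n0" "e \<in> E" for x e N
  proof -
    have "x \<notin> U M" using n0 that(2) closure_subset[of "U M"] by blast
    then have "x \<notin> bad M" using U(2)[of M] that(1) by blast
    then show ?thesis using that unfolding bad_def not_less[symmetric] by blast
  qed
  have "\<forall>e. \<exists>n. cyl (graft L e x0) n \<subseteq> (\<Inter>j\<in>{..i}. W j)"
  proof
    fix e
    have "open (\<Inter>j\<in>{..i}. W j)" by (intro open_INT ballI W(1)) simp
    moreover have "graft L e x0 \<in> (\<Inter>j\<in>{..i}. W j)" using W(2) graft_C[OF x0(1)] by blast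
    ultimately show "\<exists>n. cyl (graft L e x0) n \<subseteq> (\<Inter>j\<in>{..i}. W j)" by (rule open_cantorD) blast
  qed
  from choice[OF this] obtain p where p: "\<And>e. cyl (graft L e x0) (p e) \<subseteq> (\<Inter>j\<in>{..i}. W j)"
    by blast
  have "\<forall>e. \<exists>n. \<forall>y\<in>C \<inter> cyl (graft L e x0) n. (\<Sum>m<M. \<bar>h y m - h (graft L e x0) m\<bar>) < \<delta> / 2"
  proof
    fix e
    let ?z = "graft L e x0"
    have "\<exists>A. open A \<and> A \<inter> C = {y \<in> C. (\<Sum>m<M. \<bar>h y m - h ?z m\<bar>) < \<delta> / 2}"
      by (intro open_Collect_less_Int continuous_intros hm)
    then obtain A where A: "open A" "A \<inter> C = {y \<in> C. (\<Sum>m<M. \<bar>h y m - h ?z m\<bar>) < \<delta> / 2}" by blast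
    have "?z \<in> A \<inter> C" unfolding A(2) using graft_C[OF x0(1), of e] \<delta> by simp
    then have "?z \<in> A" by simp
    then obtain n where "cyl ?z n \<subseteq> A" using open_cantorD[OF A(1)] by blast
    then show "\<exists>n. \<forall>y\<in>C \<inter> cyl ?z n. (\<Sum>m<M. \<bar>h y m - h ?z m\<bar>) < \<delta> / 2"
      using A(2) by blast
  qed
  from choice[OF this] obtain q
    where q: "\<And>e y. y \<in> C \<Longrightarrow> y \<in> cyl (graft L e x0) (q e) \<Longrightarrow>
      (\<Sum>m<M. \<bar>h y m - h (graft L e x0) m\<bar>) < \<delta> / 2"
    by blast
  define n where "n = L + n0 + sum p E + sum q E"
  have pn: "p e \<le> n" "q e \<le> n" if "e \<in> E" for e
    unfolding n_def using member_le_sum[OF that, of p] member_le_sum[OF that, of q] finE by auto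
  have cylE: "\<exists>e\<in>E. \<forall>y. (\<forall>k<n. y k = x k) \<longrightarrow> y \<in> cyl (graft L e x0) (p e) \<inter> cyl (graft L e x0) (q e)"
    if "\<forall>k\<in>{L..<n}. x k = x0 k" for x
  proof -
    define e where "e = (\<lambda>k. k < L \<and> x k)"
    have e: "e \<in> E" by (simp add: E_def e_def)
    have "x k = graft L e x0 k" if "k < n" for k
      using \<open>\<forall>k\<in>{L..<n}. x k = x0 k\<close> that by (auto simp: graft_def e_def)
    then have "\<forall>y. (\<forall>k<n. y k = x k) \<longrightarrow> y \<in> cyl (graft L e x0) (p e) \<inter> cyl (graft L e x0) (q e)"
      using pn[OF e] by (auto simp: cyl_def)
    with e show ?thesis by blast
  qed
  have mem: "x \<in> W j" if x: "\<forall>k\<in>{L..<n}. x k = x0 k" and j: "j \<le> i" for x j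
    using cylE[OF x] p j by blast
  have tail: "tnorm {M..<N} (\<lambda>m. h x m - h y m) \<le> \<delta>"
    if xC: "x \<in> C" and x: "\<forall>k\<in>{L..<n}. x k = x0 k" and y: "\<forall>k\<ge>L. y k = x k" for x y N
  proof -
    let ?x = "graft L x0 x"
    have xx: "?x \<in> C" "?x \<in> cyl x0 n0" using graft_C[OF xC] x by (auto simp: cyl_def graft_def n_def)
    have "\<forall>k\<ge>L. x k = ?x k" by (simp add: graft_def)
    from as_graft[OF this] obtain e where e: "e \<in> E" "x = graft L e ?x" by blast
    have "\<forall>k\<ge>L. y k = ?x k" using y by (simp add: graft_def)
    from as_graft[OF this] obtain e' where e': "e' \<in> E" "y = graft L e' ?x" by blast
    have "tnorm {M..<N} (\<lambda>m. h x m - h y m)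
        \<le> tnorm {M..<N} (\<lambda>m. h x m - h ?x m) + tnorm {M..<N} (\<lambda>m. h ?x m - h y m)"
      by (rule tnorm_diff_triangle) simp
    also have "tnorm {M..<N} (\<lambda>m. h x m - h ?x m) = tnorm {M..<N} (d e ?x)"
      unfolding d_def e(2)[symmetric] by (rule tnorm_diff_commute) simp
    also have "tnorm {M..<N} (\<lambda>m. h ?x m - h y m) = tnorm {M..<N} (d e' ?x)"
      unfolding d_def e'(2)[symmetric] by (rule refl)
    finally show ?thesis using good[OF xx e(1), of N] good[OF xx e'(1), of N] by simp
  qed
  have head: "(\<Sum>m<M. \<bar>h x m - h y m\<bar>) \<le> \<delta>"
    if xC: "x \<in> C" and x: "\<forall>k\<in>{L..<n}. x k = x0 k" and y: "y \<in> C" "\<forall>k<n. y k = x k" for x y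
  proof -
    obtain e where e: "x \<in> cyl (graft L e x0) (q e)" "y \<in> cyl (graft L e x0) (q e)"
      using cylE[OF x] y(2) by blast
    have "(\<Sum>m<M. \<bar>h x m - h y m\<bar>)
        \<le> (\<Sum>m<M. \<bar>h x m - h (graft L e x0) m\<bar> + \<bar>h y m - h (graft L e x0) m\<bar>)"
      by (rule sum_mono) linarith
    then show ?thesis using q[OF xC e(1)] q[OF y(1) e(2)] by (simp add: sum.distrib)
  qed
  have "L \<le> n" "M0 < M" "\<forall>k<L. x0 k = P k"
    using x0(2) by (auto simp: n_def M_def cyl_def)
  then show ?thesis
    by (intro exI[of _ x0] exI[of _ n] exI[of _ M] conjI ballI allI impI)
      (assumption | erule (1) mem | erule (2) tail | erule (3) head | simp)+
qed

lemma comeager_open_sequence: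
  fixes G :: "'a::topological_space set"
  assumes "comeager G"
  shows "\<exists>W :: nat \<Rightarrow> 'a set. (\<forall>j. open (W j)) \<and> comeager (\<Inter>j. W j) \<and> (\<Inter>j. W j) \<subseteq> G"
proof -
  obtain \<U> where \<U>: "countable \<U>" "\<And>U. U \<in> \<U> \<Longrightarrow> open U \<and> closure U = UNIV" "\<Inter>\<U> \<subseteq> G"
    using assms unfolding comeager_def by blast
  let ?W = "from_nat_into (insert UNIV \<U>)"
  have W: "?W j \<in> insert UNIV \<U>" for j by (rule from_nat_into) simp
  show ?thesis
  proof (intro exI[of _ ?W] conjI)
    have *: "open (?W j) \<and> closure (?W j) = UNIV" for j
      using W[of j] \<U>(2)[of "?W j"] by (cases "?W j = UNIV") simp_all
    then show op: "\<forall>j. open (?W j)" by simp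
    have "closure (?W j) = UNIV" for j using * by simp
    then show "comeager (\<Inter>j. ?W j)"
      using op by (intro comeager_INT comeager_open_dense) auto
    have "range ?W = insert UNIV \<U>" using \<U>(1) by (intro range_from_nat_into) auto
    then show "(\<Inter>j. ?W j) \<subseteq> G" using \<U>(3) by auto
  qed
qed

text \<open>Stage \<open>i\<close> chooses the coordinate \<open>b i\<close>, then the pattern of \<open>P\<close> up to the next stage, together with
  \<open>M (Suc i)\<close>. Block \<open>i\<close> is insensitive to the bits after \<open>b i\<close> by the continuity
  estimate of stage \<open>i\<close>, and to the bits before \<open>b i\<close> by the tail estimate of stage \<open>i - 1\<close>.
  The errors are \<open>(1/2) ^ i\<close> and \<open>2 * (1/2) ^ i\<close>. The hypothesis on \<open>l\<close> provides coordinates of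
  every prescribed value of \<open>l\<close>, so that the chosen ones again realise the sequence \<open>l\<close>.\<close>

lemma fusion:
  fixes h :: "(nat \<Rightarrow> bool) \<Rightarrow> nat \<Rightarrow> real" and l :: "nat \<Rightarrow> nat"
  assumes h: "h \<in> borel_measurable borel"
    and coef: "\<And>x y L. \<forall>k\<ge>L. y k = x k \<Longrightarrow> (\<lambda>m. h x m - h y m) \<in> coef tsirelson_unit"
    and l: "\<And>t L. \<exists>b\<ge>L. l b = t"
  obtains b M P where "strict_mono b" "strict_mono M" "M 0 = 0" "\<And>i. l (b i) = l i" "\<And>i. \<not> P (b i)"
    "\<And>i A B. (i \<in> A \<longleftrightarrow> i \<in> B) \<Longrightarrow>
      tnorm {M i..<M (Suc i)} (\<lambda>m. h (\<lambda>k. k \<in> b ` A \<or> P k) m - h (\<lambda>k. k \<in> b ` B \<or> P k) m)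
        \<le> 3 * (1/2) ^ i"
proof -
  obtain G where G: "comeager G" "continuous_on G h"
    using borel_measurable_continuous_on_comeager[OF h] .
  from comeager_open_sequence[OF G(1)] obtain W :: "nat \<Rightarrow> _"
    where "\<forall>j. open (W j)" and W2: "comeager (\<Inter>j. W j)" and W3: "(\<Inter>j. W j) \<subseteq> G"
    by (elim exE conjE) (rule that)
  then have W1: "open (W j)" for j by simp
  \<comment> \<open>Making the comeager set invariant under finite changes allows all bits to be switched freely.\<close>
  define C where "C = {x. \<forall>L y. (\<forall>k\<ge>L. y k = x k) \<longrightarrow> y \<in> (\<Inter>j. W j)}"
  have C: "comeager C" unfolding C_def by (rule comeager_tail_invariant[OF W2])
  have CW: "C \<subseteq> W j" for j unfolding C_def by auto
  have inv: "y \<in> C" if "x \<in> C" "\<forall>k\<ge>L. y k = x k" for x y L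
    unfolding C_def
  proof (intro CollectI allI impI)
    fix L' z assume "\<forall>k\<ge>L'. z k = y k"
    then have "\<forall>k\<ge>max L L'. z k = x k" using that(2) by auto
    then show "z \<in> (\<Inter>j. W j)" using that(1) unfolding C_def by blast
  qed
  have hC: "continuous_on C h" using CW W3 by (intro continuous_on_subset[OF G(2)]) blast
  define R where "R i P L M P' L' M' b \<longleftrightarrow> L \<le> b \<and> b < L' \<and> l b = l i \<and> M < M' \<and>
    (\<forall>k<L. P' k = P k) \<and> \<not> P' b \<and>
    (\<forall>x. (\<forall>k\<in>{Suc b..<L'}. x k = P' k) \<longrightarrow> (\<forall>j\<le>i. x \<in> W j)) \<and>
    (\<forall>x\<in>C. (\<forall>k\<in>{Suc b..<L'}. x k = P' k) \<longrightarrow>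
      (\<forall>y N. (\<forall>k\<ge>Suc b. y k = x k) \<longrightarrow> tnorm {M'..<N} (\<lambda>m. h x m - h y m) \<le> (1/2) ^ i) \<and>
      (\<forall>y\<in>C. (\<forall>k<L'. y k = x k) \<longrightarrow> (\<Sum>m<M'. \<bar>h x m - h y m\<bar>) \<le> (1/2) ^ i))"
    for i L M L' M' b and P P' :: "nat \<Rightarrow> bool"
  have step: "\<exists>P' L' M' b. R i P L M P' L' M' b" for i L M and P :: "nat \<Rightarrow> bool"
  proof -
    obtain b where b: "L \<le> b" "l b = l i" using l by blast
    have "\<exists>Q n N. Suc b \<le> n \<and> M < N \<and> (\<forall>k<Suc b. Q k = (P(b := False)) k) \<and>
      (\<forall>x. (\<forall>k\<in>{Suc b..<n}. x k = Q k) \<longrightarrow> (\<forall>j\<le>i. x \<in> W j)) \<and>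
      (\<forall>x\<in>C. (\<forall>k\<in>{Suc b..<n}. x k = Q k) \<longrightarrow>
        (\<forall>y N'. (\<forall>k\<ge>Suc b. y k = x k) \<longrightarrow> tnorm {N..<N'} (\<lambda>m. h x m - h y m) \<le> (1/2) ^ i) \<and>
        (\<forall>y\<in>C. (\<forall>k<n. y k = x k) \<longrightarrow> (\<Sum>m<N. \<bar>h x m - h y m\<bar>) \<le> (1/2) ^ i))"
      by (rule fusion_stage[OF C inv hC W1 CW coef]) auto
    then obtain Q n N where Q: "Suc b \<le> n" "M < N" "\<forall>k<Suc b. Q k = (P(b := False)) k"
      "\<forall>x. (\<forall>k\<in>{Suc b..<n}. x k = Q k) \<longrightarrow> (\<forall>j\<le>i. x \<in> W j)"
      "\<forall>x\<in>C. (\<forall>k\<in>{Suc b..<n}. x k = Q k) \<longrightarrow>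
        (\<forall>y N'. (\<forall>k\<ge>Suc b. y k = x k) \<longrightarrow> tnorm {N..<N'} (\<lambda>m. h x m - h y m) \<le> (1/2) ^ i) \<and>
        (\<forall>y\<in>C. (\<forall>k<n. y k = x k) \<longrightarrow> (\<Sum>m<N. \<bar>h x m - h y m\<bar>) \<le> (1/2) ^ i)"
      by (elim exE conjE) (rule that)
    have "\<forall>k<L. Q k = P k" "\<not> Q b" using Q(3) b(1) by auto
    then have "R i P L M Q n N b" unfolding R_def using b Q(1,2) Q(4,5) by (intro conjI) auto
    then show ?thesis by blast
  qed
  have "\<exists>f :: nat \<Rightarrow> (nat \<Rightarrow> bool) \<times> nat \<times> nat \<times> nat. \<forall>i. (i = 0 \<longrightarrow> f i = (\<lambda>_. False, 0, 0, 0)) \<and>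
      R i (fst (f i)) (fst (snd (f i))) (fst (snd (snd (f i)))) (fst (f (Suc i))) (fst (snd (f (Suc i))))
        (fst (snd (snd (f (Suc i))))) (snd (snd (snd (f (Suc i)))))"
    (is "\<exists>f. \<forall>i. _ \<and> ?R i (f i) (f (Suc i))")
  proof (rule dependent_nat_choice)
    fix s :: "(nat \<Rightarrow> bool) \<times> nat \<times> nat \<times> nat" and i
    obtain P' L' M' b where "R i (fst s) (fst (snd s)) (fst (snd (snd s))) P' L' M' b" using step by blast
    then show "\<exists>s'. (Suc i = 0 \<longrightarrow> s' = (\<lambda>_. False, 0, 0, 0)) \<and> ?R i s s'"
      by (intro exI[of _ "(P', L', M', b)"]) simp
  qed simp
  then obtain f where f0: "f 0 = (\<lambda>_. False, 0, 0, 0)" and fR: "\<And>i. ?R i (f i) (f (Suc i))" by blast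
  define Ps where "Ps i = fst (f i)" for i
  define L where "L i = fst (snd (f i))" for i
  define M where "M i = fst (snd (snd (f i)))" for i
  define b where "b i = snd (snd (snd (f (Suc i))))" for i
  have R: "R i (Ps i) (L i) (M i) (Ps (Suc i)) (L (Suc i)) (M (Suc i)) (b i)" for i
    using fR[of i] unfolding Ps_def L_def M_def b_def .
  note R1 = R[unfolded R_def] note R2 = R1[THEN conjunct2] note R3 = R2[THEN conjunct2]
  note R4 = R3[THEN conjunct2] note R5 = R4[THEN conjunct2] note R6 = R5[THEN conjunct2]
  note R7 = R6[THEN conjunct2] note R8 = R7[THEN conjunct2]
  note Lb = R1[THEN conjunct1] R2[THEN conjunct1] and lb = R3[THEN conjunct1] and M = R4[THEN conjunct1]
    and Pb = R6[THEN conjunct1]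
  have PP: "Ps (Suc i) k = Ps i k" if "k < L i" for i k
    using R5[THEN conjunct1] that by simp
  have memW: "x \<in> W j" if "\<forall>k\<in>{Suc (b i)..<L (Suc i)}. x k = Ps (Suc i) k" "j \<le> i" for x i j
    using R7[THEN conjunct1] that by simp
  have tail: "tnorm {M (Suc i)..<N} (\<lambda>m. h x m - h y m) \<le> (1/2) ^ i"
    if "x \<in> C" "\<forall>k\<in>{Suc (b i)..<L (Suc i)}. x k = Ps (Suc i) k" "\<forall>k\<ge>Suc (b i). y k = x k" for x y i N
    by (rule R8[THEN bspec, THEN mp, THEN conjunct1, THEN spec, THEN spec, THEN mp, OF that])
  have head: "(\<Sum>m<M (Suc i). \<bar>h x m - h y m\<bar>) \<le> (1/2) ^ i"
    if "x \<in> C" "\<forall>k\<in>{Suc (b i)..<L (Suc i)}. x k = Ps (Suc i) k" "y \<in> C" "\<forall>k<L (Suc i). y k = x k" for x y i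
    by (rule R8[THEN bspec, THEN mp, THEN conjunct2, THEN bspec, THEN mp, OF that])
  have smL: "strict_mono L" by (rule strict_mono_Suc_iff[THEN iffD2]) (use Lb in \<open>auto intro: le_less_trans\<close>)
  have smM: "strict_mono M" by (rule strict_mono_Suc_iff[THEN iffD2]) (use M in auto)
  have smb: "strict_mono b"
    by (rule strict_mono_Suc_iff[THEN iffD2]) (use Lb in \<open>auto intro: less_le_trans\<close>)
  have Li: "i \<le> L i" for i using smL by (rule strict_mono_imp_increasing)
  have bi: "i \<le> b i" for i using smb by (rule strict_mono_imp_increasing)
  have Leq: "L i \<le> L j \<longleftrightarrow> i \<le> j" for i j using smL by (rule strict_mono_less_eq)
  define P where "P k = Ps (Suc k) k" for k
  have PsP: "Ps j k = Ps i k" if "i \<le> j" "k < L i" for i j k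
    using that(1)
  proof (induction j rule: dec_induct)
    case (step j)
    have "L i \<le> L j" using step Leq by simp
    then show ?case using step PP[of k j] that(2) by simp
  qed simp
  have P: "Ps i k = P k" if "k < L i" for i k
  proof -
    have "k < L (Suc k)" using Li[of "Suc k"] by simp
    then show ?thesis unfolding P_def
      using PsP[of i "Suc k" k] PsP[of "Suc k" i k] that by (cases "i \<le> Suc k") auto
  qed
  define X where "X A k \<longleftrightarrow> k \<in> b ` A \<or> P k" for A k
  have X_eq: "X A k = Ps (Suc i) k" if "k \<in> {Suc (b i)..<L (Suc i)}" for A i k
  proof -
    have "k \<noteq> b j" for j
    proof (cases "j \<le> i")
      case True
      then have "b j \<le> b i" using strict_mono_less_eq[OF smb] by blast
      then show ?thesis using that by auto
    next
      case False
      then have "L (Suc i) \<le> b j" using Lb(1)[of j] Leq[of "Suc i" j] by linarith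
      then show ?thesis using that by auto
    qed
    then show ?thesis using P[of k "Suc i"] that by (auto simp: X_def)
  qed
  have XC: "X A \<in> C" for A
    unfolding C_def
  proof (intro CollectI allI impI INT_I)
    fix n y j assume y: "\<forall>k\<ge>n. y k = X A k"
    show "y \<in> W j"
    proof (rule memW[where i = "max n j"])
      show "\<forall>k\<in>{Suc (b (max n j))..<L (Suc (max n j))}. y k = Ps (Suc (max n j)) k"
      proof
        fix k assume k: "k \<in> {Suc (b (max n j))..<L (Suc (max n j))}"
        then have "n \<le> k" using bi[of "max n j"] by auto
        then show "y k = Ps (Suc (max n j)) k" using y X_eq[OF k] by simp
      qed
    qed simp
  qed
  show thesis
  proof (rule that[of b M P])
    show "M 0 = 0" by (simp add: M_def f0)
    show "\<not> P (b i)" for i using Pb[of i] P[of "b i" "Suc i"] Lb(2)[of i] by simp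
    fix i :: nat and A B :: "nat set" assume iff: "i \<in> A \<longleftrightarrow> i \<in> B"
    \<comment> \<open>\<open>D\<close> agrees with \<open>A\<close> up to bit \<open>i\<close> and with \<open>B\<close> from bit \<open>i\<close> on.\<close>
    define D where "D = (A \<inter> {..i}) \<union> (B \<inter> {i<..})"
    let ?J = "{M i..<M (Suc i)}"
    have "X D k = X A k" if "k < L (Suc i)" for k
    proof -
      have le: "j \<le> i" if "k = b j" for j
        using Lb(1)[of j] Leq[of "Suc i" j] that \<open>k < L (Suc i)\<close> by linarith
      have "j \<in> D \<longleftrightarrow> j \<in> A" if "k = b j" for j
        using le[OF that] by (auto simp: D_def)
      then show ?thesis unfolding X_def by auto
    qed
    then have "(\<Sum>m<M (Suc i). \<bar>h (X A) m - h (X D) m\<bar>) \<le> (1/2) ^ i"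
      using X_eq by (intro head XC) auto
    moreover have "tnorm ?J (\<lambda>m. h (X A) m - h (X D) m) \<le> (\<Sum>m\<in>?J. \<bar>h (X A) m - h (X D) m\<bar>)"
      by (rule tnorm_le_sum) simp
    moreover have "(\<Sum>m\<in>?J. \<bar>h (X A) m - h (X D) m\<bar>) \<le> (\<Sum>m<M (Suc i). \<bar>h (X A) m - h (X D) m\<bar>)"
      by (rule sum_mono2) auto
    ultimately have AD: "tnorm ?J (\<lambda>m. h (X A) m - h (X D) m) \<le> (1/2) ^ i" by linarith
    have DB: "tnorm ?J (\<lambda>m. h (X D) m - h (X B) m) \<le> 2 * (1/2) ^ i"
    proof (cases i)
      case 0
      then have "D = B" using iff by (auto simp: D_def not_less)
      then have "tnorm ?J (\<lambda>m. h (X D) m - h (X B) m) \<le> 0" using tnorm_le_sum[of ?J "\<lambda>m. 0"] by simp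
      also have "0 \<le> 2 * (1/2 :: real) ^ i" by simp
      finally show ?thesis .
    next
      case (Suc i')
      have "X B k = X D k" if "k \<ge> Suc (b i')" for k
      proof -
        have le: "i \<le> j" if "k = b j" for j
          using strict_mono_less_eq[OF smb, of j i'] that \<open>k \<ge> Suc (b i')\<close> Suc by linarith
        have "j \<in> D \<longleftrightarrow> j \<in> B" if "k = b j" for j
          using iff le[OF that] by (cases "j = i") (auto simp: D_def)
        then show ?thesis unfolding X_def by auto
      qed
      then have "tnorm {M (Suc i')..<M (Suc i)} (\<lambda>m. h (X D) m - h (X B) m) \<le> (1/2) ^ i'"
        using X_eq by (intro tail XC) auto
      then show ?thesis using Suc by simp
    qed
    have "tnorm ?J (\<lambda>m. h (X A) m - h (X B) m) \<le> 3 * (1/2) ^ i"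
      using tnorm_diff_triangle[of ?J "h (X A)" "h (X B)" "h (X D)"] AD DB by simp
    then show "tnorm ?J (\<lambda>m. h (\<lambda>k. k \<in> b ` A \<or> P k) m - h (\<lambda>k. k \<in> b ` B \<or> P k) m) \<le> 3 * (1/2) ^ i"
      unfolding X_def .
  qed (use smb smM lb in auto)
qed

section \<open>From a reduction to a block sequence\<close>

abbreviation block :: "(nat \<Rightarrow> nat) \<Rightarrow> nat \<Rightarrow> nat set"
  where "block M i \<equiv> {M i..<M (Suc i)}"

lemma block_nonempty: "strict_mono M \<Longrightarrow> block M i \<noteq> {}"
  using strict_monoD[of M i "Suc i"] by auto

lemma block_less:
  assumes "strict_mono M" "i < j" "x \<in> block M i" "y \<in> block M j" shows "x < y"
proof -
  have "M (Suc i) \<le> M j" using strict_mono_less_eq[OF assms(1)] assms(2) by simp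
  then show ?thesis using assms(3,4) by simp
qed

lemma block_ge: "strict_mono M \<Longrightarrow> x \<in> block M i \<Longrightarrow> i \<le> x"
  using strict_mono_imp_increasing[of M i] by simp

lemma blocks_cover:
  fixes M :: "nat \<Rightarrow> nat"
  assumes "strict_mono M" "M 0 = 0"
  shows "\<exists>i. m \<in> block M i"
proof -
  have *: "m < M (Suc m)" using strict_mono_imp_increasing[OF assms(1), of "Suc m"] by simp
  define j where "j = (LEAST j. m < M j)"
  have j: "m < M j" unfolding j_def by (rule LeastI[of _ "Suc m"]) (rule *)
  then have "j \<noteq> 0" using assms(2) by (cases j) auto
  then obtain i where i: "j = Suc i" by (cases j) auto
  have "\<not> m < M i" using not_less_Least[of i "\<lambda>j. m < M j"] i unfolding j_def by simp
  then show ?thesis using i j by (intro exI[of _ i]) auto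
qed

lemma blocks_unique:
  fixes M :: "nat \<Rightarrow> nat"
  assumes "strict_mono M" "m \<in> block M i" "m \<in> block M j"
  shows "i = j"
proof (rule ccontr)
  assume "i \<noteq> j"
  then consider "Suc i \<le> j" | "Suc j \<le> i" by linarith
  then show False
    using strict_mono_less_eq[OF assms(1)] assms(2,3) by cases (metis atLeastLessThan_iff leD order_trans)+
qed

text \<open>The vector \<open>V\<close> collects, on each block, the effect of switching on the single bit of that block. The
  true effect of switching on the bits of \<open>A\<close> differs from the restriction of \<open>V\<close> to the blocks of
  \<open>A\<close> by blocks of norm at most \<open>3 * (1/2) ^ i\<close>, hence by a vector of the coefficient space.\<close>

lemma block_splitting:
  fixes h :: "(nat \<Rightarrow> bool) \<Rightarrow> nat \<Rightarrow> real" and l :: "nat \<Rightarrow> nat"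
  assumes h: "h \<in> borel_measurable borel"
    and coef: "\<And>x y L. \<forall>k\<ge>L. y k = x k \<Longrightarrow> (\<lambda>m. h x m - h y m) \<in> coef tsirelson_unit"
    and l: "\<And>t L. \<exists>b\<ge>L. l b = t"
  obtains b M P V where "strict_mono b" "strict_mono M" "\<And>i. l (b i) = l i" "\<And>i. \<not> P (b i)"
    "\<And>A. (\<lambda>m. h (\<lambda>k. k \<in> b ` A \<or> P k) m - h P m) \<in> coef tsirelson_unit
      \<longleftrightarrow> restr (\<Union>i\<in>A. block M i) V \<in> coef tsirelson_unit"
proof (rule fusion[OF h coef l])
  fix b M P assume bM: "strict_mono b" "strict_mono M" "M 0 = 0" "\<And>i. l (b i) = l i" "\<And>i. \<not> P (b i)"
    and split: "\<And>i A B. (i \<in> A \<longleftrightarrow> i \<in> B) \<Longrightarrow>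
      tnorm (block M i) (\<lambda>m. h (\<lambda>k. k \<in> b ` A \<or> P k) m - h (\<lambda>k. k \<in> b ` B \<or> P k) m)
        \<le> 3 * (1/2) ^ i"
  define X where "X A = (\<lambda>k. k \<in> b ` A \<or> P k)" for A
  have XP: "X {} = P" by (auto simp: X_def)
  have "\<forall>m. \<exists>i. m \<in> block M i" using blocks_cover[OF bM(2,3)] by blast
  from choice[OF this] obtain I where I: "\<And>m. m \<in> block M (I m)" by blast
  have I_eq: "I m = i" if "m \<in> block M i" for m i
    by (rule blocks_unique[OF bM(2) I that])
  define V where "V m = h (X {I m}) m - h P m" for m
  show thesis
  proof (rule that[of b M P V])
    fix A
    let ?U = "\<Union>i\<in>A. block M i"
    define D where "D = (\<lambda>m. (h (X A) m - h P m) - restr ?U V m)"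
    have "tnorm (block M i) D \<le> 3 * (1/2) ^ i" for i
    proof -
      let ?B = "if i \<in> A then {i} else {}"
      have "D m = h (X A) m - h (X ?B) m" if m: "m \<in> block M i" for m
      proof -
        have "m \<in> ?U \<longleftrightarrow> i \<in> A" using m blocks_unique[OF bM(2) m] by blast
        then show ?thesis using I_eq[OF m] XP unfolding D_def V_def restr_def by auto
      qed
      then have "tnorm (block M i) D = tnorm (block M i) (\<lambda>m. h (X A) m - h (X ?B) m)"
        by (rule tnorm_cong)
      also have "\<dots> \<le> 3 * (1/2) ^ i" unfolding X_def by (rule split) auto
      finally show ?thesis .
    qed
    then have "restr (\<Union>i. block M i) D \<in> coef tsirelson_unit"
      by (rule coef_UN_I[rotated]) (auto intro: summable_mult summable_geometric)
    moreover have "(\<Union>i. block M i) = UNIV" using I by blast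
    then have "restr (\<Union>i. block M i) D = D" by (simp add: restr_def)
    ultimately have "D \<in> coef tsirelson_unit" by simp
    then show "(\<lambda>m. h (\<lambda>k. k \<in> b ` A \<or> P k) m - h P m) \<in> coef tsirelson_unit
      \<longleftrightarrow> restr ?U V \<in> coef tsirelson_unit"
      using coef_cong_diff[of "\<lambda>m. h (X A) m - h P m" "restr ?U V"] unfolding D_def X_def by blast
  qed (use bM in auto)
qed

text \<open>The reduction is restricted to the sequences with values \<open>0\<close> and \<open>w k\<close> in coordinate \<open>k\<close>. The bit at
  \<open>b i\<close> is off in the pattern, so switching on the bits of \<open>A\<close> adds exactly the sequence on the
  right-hand side.\<close>

lemma block_splitting_of_reduction:
  fixes w :: "nat \<Rightarrow> real" and l :: "nat \<Rightarrow> nat"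
  assumes red: "{(x, y). (\<lambda>n. x n - y n) \<in> I} \<le>\<^sub>B E_rel tsirelson_unit"
    and fin: "\<And>x. finite {n. x n \<noteq> 0} \<Longrightarrow> x \<in> I"
    and l: "\<And>t L. \<exists>b\<ge>L. l b = t"
  obtains b M V where "strict_mono b" "strict_mono M" "\<And>i. l (b i) = l i"
    "\<And>A. restr (\<Union>i\<in>A. block M i) V \<in> coef tsirelson_unit
      \<longleftrightarrow> (\<lambda>k. if k \<in> b ` A then w k else 0) \<in> I"
proof -
  obtain \<theta> where \<theta>: "\<theta> \<in> borel_measurable borel"
    and iff: "\<And>x y. (\<lambda>n. x n - y n) \<in> I \<longleftrightarrow> (\<lambda>n. \<theta> x n - \<theta> y n) \<in> coef tsirelson_unit"
    using red unfolding borel_reducible_def E_rel_def by auto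
  define f where "f x = (\<lambda>k. if x k then w k else 0)" for x :: "nat \<Rightarrow> bool"
  have "continuous_on UNIV f"
    unfolding f_def
  proof (rule continuous_on_coordinatewise_then_product)
    show "continuous_on UNIV (\<lambda>x::nat \<Rightarrow> bool. if x k then w k else 0)" for k
      by (rule continuous_on_compose2[of UNIV "\<lambda>c. if c then w k else 0" UNIV "\<lambda>x. x k"])
        (auto intro: continuous_on_product_coordinates)
  qed
  then have "f \<in> borel_measurable borel" by (rule borel_measurable_continuous_onI)
  then have h: "(\<lambda>x. \<theta> (f x)) \<in> borel_measurable borel" using \<theta> by (rule measurable_compose)
  have coef: "(\<lambda>m. \<theta> (f x) m - \<theta> (f y) m) \<in> coef tsirelson_unit" if "\<forall>k\<ge>L. y k = x k" for x y L
  proof -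
    have "{n. f x n - f y n \<noteq> 0} \<subseteq> {..<L}" using that by (auto simp: f_def not_le[symmetric])
    then have "(\<lambda>n. f x n - f y n) \<in> I" by (intro fin) (rule finite_subset, auto)
    then show ?thesis using iff by blast
  qed
  show thesis
  proof (rule block_splitting[OF h coef l])
    fix b M P V
    assume b: "strict_mono b" and M: "strict_mono M" and lb: "\<And>i. l (b i) = l i" and P: "\<And>i. \<not> P (b i)"
      and V: "\<And>A. (\<lambda>m. \<theta> (f (\<lambda>k. k \<in> b ` A \<or> P k)) m - \<theta> (f P) m) \<in> coef tsirelson_unit
        \<longleftrightarrow> restr (\<Union>i\<in>A. block M i) V \<in> coef tsirelson_unit"
    show thesis
    proof (rule that[OF b M lb])
      fix A
      have "(\<lambda>k. if k \<in> b ` A then w k else 0) = (\<lambda>k. f (\<lambda>k. k \<in> b ` A \<or> P k) k - f P k)"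
        by (rule ext) (use P in \<open>auto simp: f_def\<close>)
      then show "restr (\<Union>i\<in>A. block M i) V \<in> coef tsirelson_unit
          \<longleftrightarrow> (\<lambda>k. if k \<in> b ` A then w k else 0) \<in> I"
        using iff V by simp
    qed
  qed
qed

section \<open>Blocks and the vanishing ideal\<close>

text \<open>Blocks indexed by \<open>A\<close> start at or beyond their index, so \<open>card A\<close> of them with indices at least
  \<open>card A\<close> form an admissible family.\<close>

lemma sum_tnorm_blocks_le:
  assumes M: "strict_mono M" and A: "finite A" "\<And>i. i \<in> A \<Longrightarrow> card A \<le> i"
  shows "(\<Sum>i\<in>A. tnorm (block M i) a) \<le> 2 * tnorm (\<Union>i\<in>A. block M i) a"
proof (cases "A = {}")
  case False
  define xs where "xs = sorted_list_of_set A"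
  have xs: "set xs = A" "distinct xs" "sorted_wrt (<) xs" "length xs = card A"
    using A(1) by (auto simp: xs_def)
  have nth: "xs ! j \<in> A" if "j < card A" for j using xs(1,4) that nth_mem by metis
  define F where "F j = block M (xs ! (j - 1))" for j
  have fin: "finite (F j)" and ne: "F j \<noteq> {}" for j
    using block_nonempty[OF M] by (auto simp: F_def)
  have c: "1 \<le> card A" using False A(1) by (simp add: Suc_le_eq card_gt_0_iff)
  have "admissible (card A) F"
    unfolding admissible_def
  proof (intro conjI ballI c fin ne)
    have "xs ! 0 \<in> A" using nth c by simp
    then have "card A \<le> x" if "x \<in> F 1" for x
      using A(2) block_ge[OF M] that unfolding F_def by (metis diff_self_eq_0 order_trans)
    then show "card A \<le> Min (F 1)" using fin ne by (simp add: Min_ge_iff)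
    fix j assume j: "j \<in> {1..<card A}"
    have "xs ! (j - 1) < xs ! j"
      using j xs(3,4) by (intro sorted_wrt_nth_less[of "(<)"]) auto
    then have lt: "x < y" if "x \<in> F j" "y \<in> F (Suc j)" for x y
      using block_less[OF M, of "xs ! (j - 1)" "xs ! j" x y] that by (simp add: F_def)
    show "Max (F j) < Min (F (Suc j))"
      by (rule lt[OF Max_in[OF fin ne] Min_in[OF fin ne]])
  qed
  then have *: "(\<Sum>j=1..card A. tnorm (F j \<inter> (\<Union>i\<in>A. block M i)) a) \<le> 2 * tnorm (\<Union>i\<in>A. block M i) a"
    using A(1) by (intro tnorm_admissible_le) auto
  have "(\<Sum>j=1..card A. tnorm (F j \<inter> (\<Union>i\<in>A. block M i)) a) = (\<Sum>j=1..card A. tnorm (F j) a)"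
  proof (rule sum.cong[OF refl])
    fix j assume j: "j \<in> {1..card A}"
    then have "j - 1 < card A" by auto
    then have "F j \<subseteq> (\<Union>i\<in>A. block M i)" using nth unfolding F_def by blast
    then show "tnorm (F j \<inter> (\<Union>i\<in>A. block M i)) a = tnorm (F j) a" by (simp add: Int_absorb2)
  qed
  also have "\<dots> = (\<Sum>j<card A. tnorm (block M (xs ! j)) a)"
    by (simp add: sum.atLeast1_atMost_eq F_def)
  also have "\<dots> = (\<Sum>i\<in>A. tnorm (block M i) a)"
    using sum.distinct_set_conv_list[OF xs(2), of "\<lambda>i. tnorm (block M i) a"] xs(1,4)
    by (simp add: sum_list_sum_nth atLeast0LessThan)
  finally show ?thesis using * by simp
qed simp

lemma infinite_fibre:
  fixes l :: "nat \<Rightarrow> nat"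
  assumes "\<And>t L. \<exists>b\<ge>L. l b = t"
  shows "infinite {i. N \<le> i \<and> l i = t}"
  unfolding infinite_nat_iff_unbounded_le
proof
  fix n
  obtain b where "b \<ge> max n N" "l b = t" using assms by blast
  then show "\<exists>i\<ge>n. i \<in> {i. N \<le> i \<and> l i = t}" by auto
qed

lemma restr_blocks_not_coef:
  assumes M: "strict_mono M" and S: "\<And>n. finite (S n)" "\<And>n. S n \<subseteq> {n..}" "\<And>n. S n \<subseteq> A"
    and d: "0 < d" "\<And>n. d \<le> tnorm (\<Union>i\<in>S n. block M i) V"
  shows "restr (\<Union>i\<in>A. block M i) V \<notin> coef tsirelson_unit"
proof (rule not_coefI[OF d(1)])
  fix n
  let ?F = "\<Union>i\<in>S n. block M i"
  have "?F \<subseteq> {n..}"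
  proof
    fix x assume "x \<in> ?F"
    then obtain i where i: "i \<in> S n" "x \<in> block M i" by blast
    then have "n \<le> i" using S(2)[of n] by auto
    then show "x \<in> {n..}" using block_ge[OF M i(2)] by simp
  qed
  moreover have "tnorm ?F (restr (\<Union>i\<in>A. block M i) V) = tnorm ?F V"
    by (rule tnorm_cong) (use S(3)[of n] in \<open>auto simp: restr_def\<close>)
  ultimately show "finite ?F \<and> ?F \<subseteq> {n..} \<and> d \<le> tnorm ?F (restr (\<Union>i\<in>A. block M i) V)"
    using S(1)[of n] d(2)[of n] by simp
qed

text \<open>Within one fibre of \<open>l\<close> the norms of the blocks are bounded below, as otherwise an infinite
  subset of the fibre would give a convergent sum. Sufficiently many blocks of fibre \<open>t\<close>, far
  enough out, then have a sum of norm at least \<open>1/2\<close>. The union over \<open>t\<close> of such finite sets meets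
  every fibre in a finite set.\<close>

lemma coef_blocks_ne_vanishing_ideal:
  fixes l :: "nat \<Rightarrow> nat"
  assumes M: "strict_mono M" and l: "\<And>t L. \<exists>b\<ge>L. l b = t"
    and iff: "\<And>A. restr (\<Union>i\<in>A. block M i) V \<in> coef tsirelson_unit \<longleftrightarrow> (\<forall>t. finite {i \<in> A. l i = t})"
  shows False
proof -
  have bd: "\<exists>d>0. \<exists>N. \<forall>i\<ge>N. l i = t \<longrightarrow> d \<le> tnorm (block M i) V" for t
  proof (rule ccontr)
    assume *: "\<not> ?thesis"
    have "\<forall>n. \<exists>i\<ge>n. l i = t \<and> tnorm (block M i) V \<le> (1/2) ^ n"
    proof
      fix n
      have "(0::real) < (1/2) ^ n" by simp
      then show "\<exists>i\<ge>n. l i = t \<and> tnorm (block M i) V \<le> (1/2) ^ n"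
        using * by (metis less_imp_le not_le)
    qed
    from choice[OF this] obtain g where g: "\<And>n. n \<le> g n" "\<And>n. l (g n) = t"
      "\<And>n. tnorm (block M (g n)) V \<le> (1/2) ^ n" by blast
    have "restr (\<Union>n. block M (g n)) V \<in> coef tsirelson_unit"
      by (rule coef_UN_I[OF _ g(3)]) (auto intro: summable_geometric)
    also have "(\<Union>n. block M (g n)) = (\<Union>i\<in>range g. block M i)" by blast
    finally have "finite {i \<in> range g. l i = t}" by (rule iff[THEN iffD1, THEN spec])
    moreover have "{i \<in> range g. l i = t} = range g" using g(2) by auto
    moreover have "infinite (range g)"
      unfolding infinite_nat_iff_unbounded_le using g(1) by blast
    ultimately show False by simp
  qed
  have "\<forall>t. \<exists>p. 0 < fst p \<and> (\<forall>i\<ge>snd p. l i = t \<longrightarrow> fst p \<le> tnorm (block M i) V)"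
  proof
    fix t
    obtain d N where "0 < d" "\<forall>i\<ge>N. l i = t \<longrightarrow> d \<le> tnorm (block M i) V" using bd by blast
    then show "\<exists>p. 0 < fst p \<and> (\<forall>i\<ge>snd p. l i = t \<longrightarrow> fst p \<le> tnorm (block M i) V)"
      by (intro exI[of _ "(d, N)"]) simp
  qed
  from choice[OF this] obtain p
    where p': "\<forall>t. 0 < fst (p t) \<and> (\<forall>i\<ge>snd (p t). l i = t \<longrightarrow> fst (p t) \<le> tnorm (block M i) V)" ..
  have p: "0 < fst (p t)" "snd (p t) \<le> i \<Longrightarrow> l i = t \<Longrightarrow> fst (p t) \<le> tnorm (block M i) V" for t i
    using p' by simp_all
  \<comment> \<open>So many blocks of fibre \<open>t\<close> have norms adding up to at least \<open>1\<close>.\<close>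
  define k where "k t = nat \<lceil>1 / fst (p t)\<rceil>" for t
  have k: "1 \<le> real (k t) * fst (p t)" for t
  proof -
    have "1 / fst (p t) \<le> real (k t)" unfolding k_def by linarith
    then show ?thesis using p(1)[of t] by (simp add: field_simps)
  qed
  have "\<forall>t. \<exists>T. finite T \<and> card T = k t \<and> T \<subseteq> {i. t + k t + snd (p t) \<le> i \<and> l i = t}"
    using infinite_arbitrarily_large[OF infinite_fibre[OF l]] by blast
  from choice[OF this] obtain S where S: "\<And>t. finite (S t)" "\<And>t. card (S t) = k t"
    "\<And>t. S t \<subseteq> {i. t + k t + snd (p t) \<le> i \<and> l i = t}" by blast
  have low: "1/2 \<le> tnorm (\<Union>i\<in>S t. block M i) V" for t
  proof -
    have "1 \<le> (\<Sum>i\<in>S t. fst (p t))" using k[of t] S(2) by simp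
    also have "\<dots> \<le> (\<Sum>i\<in>S t. tnorm (block M i) V)" using S(3)[of t] p(2) by (intro sum_mono) auto
    also have "\<dots> \<le> 2 * tnorm (\<Union>i\<in>S t. block M i) V"
      using S(2,3)[of t] S(1) by (intro sum_tnorm_blocks_le M) auto
    finally show ?thesis by simp
  qed
  have "{i \<in> \<Union>(range S). l i = t} \<subseteq> S t" for t using S(3) by blast
  then have "\<forall>t. finite {i \<in> \<Union>(range S). l i = t}" using S(1) finite_subset by blast
  then have "restr (\<Union>i\<in>\<Union>(range S). block M i) V \<in> coef tsirelson_unit" using iff by blast
  moreover have "restr (\<Union>i\<in>\<Union>(range S). block M i) V \<notin> coef tsirelson_unit"
    by (rule restr_blocks_not_coef[OF M, of S _ "1/2"]) (use S low in \<open>auto, force\<close>)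
  ultimately show False by simp
qed

section \<open>Thin averages of blocks\<close>

definition succ_family :: "nat set set \<Rightarrow> bool"
  where "succ_family \<E> \<longleftrightarrow> finite \<E> \<and> (\<forall>E\<in>\<E>. finite E) \<and>
    (\<forall>E\<in>\<E>. \<forall>F\<in>\<E>. E \<noteq> F \<longrightarrow> (\<forall>x\<in>E. \<forall>y\<in>F. x < y) \<or> (\<forall>x\<in>E. \<forall>y\<in>F. y < x))"

text \<open>The number \<open>c\<close> bounds what \<open>B\<close> contributes when it is cut into successive pieces, up to an error \<open>\<eta>\<close>
  for each piece. A bound on \<open>tnorm B a\<close> alone would not suffice for the induction: in the implicit
  equation of the norm a vector is cut into pieces, whose number is limited only by where they start.\<close>

definition thin :: "nat set \<Rightarrow> (nat \<Rightarrow> real) \<Rightarrow> real \<Rightarrow> real \<Rightarrow> bool"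
  where "thin B a c \<eta> \<longleftrightarrow>
    (\<forall>\<E>. succ_family \<E> \<longrightarrow> (\<Sum>E\<in>\<E>. tnorm (E \<inter> B) a) \<le> c + \<eta> * card \<E>)"

lemma thin_mono: "thin B a c \<eta> \<Longrightarrow> c \<le> c' \<Longrightarrow> \<eta> \<le> \<eta>' \<Longrightarrow> thin B a c' \<eta>'"
  unfolding thin_def by (meson add_mono mult_right_mono of_nat_0_le_iff order_trans)

lemma thin_tnorm: "thin B a c \<eta> \<Longrightarrow> finite B \<Longrightarrow> tnorm B a \<le> c + \<eta>"
  unfolding thin_def succ_family_def by (drule spec[of _ "{B}"]) simp

lemma succ_familyD:
  assumes "succ_family \<E>" "E \<in> \<E>" "F \<in> \<E>" "E \<noteq> F"
  shows "(\<forall>x\<in>E. \<forall>y\<in>F. x < y) \<or> (\<forall>x\<in>E. \<forall>y\<in>F. y < x)"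
  using assms unfolding succ_family_def by blast

text \<open>A piece \<open>E\<close> is charged \<open>c\<close> for the first block that it meets. Of the pieces that meet a given block,
  at most one meets an earlier block as well, because the pieces are successive; so the remaining
  contributions sum to at most \<open>c\<close> for each block.\<close>

lemma thin_blocks:
  fixes c :: real
  assumes M: "strict_mono M" and A: "finite A" and c: "0 \<le> c" "\<And>i. i \<in> A \<Longrightarrow> tnorm (block M i) a \<le> c"
  shows "thin (\<Union>i\<in>A. block M i) a (card A * c) c"
  unfolding thin_def
proof (intro allI impI)
  fix \<E> assume \<E>: "succ_family \<E>"
  let ?B = "\<Union>i\<in>A. block M i"
  \<comment> \<open>The first block that \<open>E\<close> meets; an arbitrary value if there is none.\<close>
  define s where "s E = (LEAST i. i \<in> A \<and> E \<inter> block M i \<noteq> {})" for E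
  have s: "s E \<in> A \<and> E \<inter> block M (s E) \<noteq> {} \<and> s E \<le> i" if "i \<in> A" "E \<inter> block M i \<noteq> {}" for E i
    using LeastI[of "\<lambda>i. i \<in> A \<and> E \<inter> block M i \<noteq> {}" i] Least_le[of "\<lambda>i. i \<in> A \<and> E \<inter> block M i \<noteq> {}" i] that
    unfolding s_def by blast
  have le_c: "tnorm (E \<inter> block M i) a \<le> c" if "i \<in> A" for E i
    using tnorm_mono[of "block M i" "E \<inter> block M i" a] c(2)[OF that] by simp
  let ?t = "\<lambda>E i. if s E < i then tnorm (E \<inter> block M i) a else 0"
  have one: "tnorm (E \<inter> ?B) a \<le> c + (\<Sum>i\<in>A. ?t E i)" for E
  proof -
    have "E \<inter> ?B = (\<Union>i\<in>A. E \<inter> block M i)" by blast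
    then have "tnorm (E \<inter> ?B) a \<le> (\<Sum>i\<in>A. tnorm (E \<inter> block M i) a)"
      using tnorm_UN[OF A, of "\<lambda>i. E \<inter> block M i" a] by simp
    also have "\<dots> \<le> (\<Sum>i\<in>A. (if i = s E then c else 0) + ?t E i)"
    proof (rule sum_mono)
      fix i assume i: "i \<in> A"
      show "tnorm (E \<inter> block M i) a \<le> (if i = s E then c else 0) + ?t E i"
      proof (cases "E \<inter> block M i = {}")
        case True then show ?thesis using c(1) tnorm_empty by simp
      next
        case False
        then have "s E \<le> i" using s i by blast
        then show ?thesis using le_c[OF i, of E] by auto
      qed
    qed
    also have "\<dots> = (if s E \<in> A then c else 0) + (\<Sum>i\<in>A. ?t E i)"
      using A by (simp add: sum.distrib sum.delta)
    also have "\<dots> \<le> c + (\<Sum>i\<in>A. ?t E i)" using c(1) by simp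
    finally show ?thesis .
  qed
  have col: "(\<Sum>E\<in>\<E>. ?t E i) \<le> c" if i: "i \<in> A" for i
  proof (cases "\<exists>E\<in>\<E>. s E < i \<and> E \<inter> block M i \<noteq> {}")
    case True
    then obtain E where E: "E \<in> \<E>" "s E < i" "E \<inter> block M i \<noteq> {}" by blast
    have "?t F i \<le> (if F = E then c else 0)" if F: "F \<in> \<E>" for F
    proof (cases "F = E \<or> \<not> s F < i \<or> F \<inter> block M i = {}")
      case True then show ?thesis using le_c[OF i] c(1) tnorm_empty by auto
    next
      case False
      then have F': "F \<noteq> E" "s F < i" "F \<inter> block M i \<noteq> {}" by auto
      obtain e f where ef: "e \<in> E" "e \<in> block M i" "f \<in> F" "f \<in> block M i" using E F' by blast
      obtain e' f' where ef': "e' \<in> E" "e' \<in> block M (s E)" "f' \<in> F" "f' \<in> block M (s F)"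
        using s[OF i E(3)] s[OF i F'(3)] by blast
      have "e' < f" "f' < e"
        using block_less[OF M E(2) ef'(2) ef(4)] block_less[OF M F'(2) ef'(4) ef(2)] by auto
      then have False using succ_familyD[OF \<E> F E(1) F'(1)] ef ef' by fastforce
      then show ?thesis ..
    qed
    then have "(\<Sum>E\<in>\<E>. ?t E i) \<le> (\<Sum>F\<in>\<E>. if F = E then c else 0)" by (rule sum_mono)
    also have "\<dots> = c" using E(1) \<E> by (simp add: sum.delta succ_family_def)
    finally show ?thesis .
  next
    case False
    then have "?t E i = 0" if "E \<in> \<E>" for E using that tnorm_empty by auto
    then show ?thesis using c(1) by simp
  qed
  have "(\<Sum>E\<in>\<E>. tnorm (E \<inter> ?B) a) \<le> (\<Sum>E\<in>\<E>. c + (\<Sum>i\<in>A. ?t E i))" by (intro sum_mono one)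
  also have "\<dots> = c * card \<E> + (\<Sum>i\<in>A. \<Sum>E\<in>\<E>. ?t E i)"
    by (simp add: sum.distrib sum.swap[of _ A])
  also have "\<dots> \<le> c * card \<E> + (\<Sum>i\<in>A. c)" by (intro add_left_mono sum_mono col)
  finally show "(\<Sum>E\<in>\<E>. tnorm (E \<inter> ?B) a) \<le> card A * c + c * card \<E>" by simp
qed

text \<open>The norm of the piece \<open>E\<close> of \<open>\<Union>i<r. B i\<close> is computed by an admissible family. Let \<open>B s\<close> be the
  first set that it meets inside \<open>E\<close>. The number of its members is at most the least element of its
  first member, hence at most some point of \<open>B s\<close>, hence less than \<open>m i\<close> for all \<open>i > s\<close>. The part in \<open>B s\<close> costs at most \<open>K\<close>; only the later
  parts keep the factor \<open>1/2\<close>.\<close>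

lemma tnorm_split_UN:
  fixes B :: "nat \<Rightarrow> nat set" and m :: "nat \<Rightarrow> nat"
  assumes E: "finite E" and B: "\<And>i. i < r \<Longrightarrow> finite (B i)" "\<And>i. i < r \<Longrightarrow> tnorm (B i) a \<le> K" and K: "0 \<le> K"
    and m: "\<And>i j x. j < i \<Longrightarrow> i < r \<Longrightarrow> x \<in> B j \<Longrightarrow> x < m i"
  shows "\<exists>\<F> s. succ_family \<F> \<and> (\<forall>F\<in>\<F>. F \<subseteq> E \<and> F \<noteq> {}) \<and> (\<forall>i<r. s < i \<longrightarrow> card \<F> \<le> m i) \<and>
    tnorm (E \<inter> (\<Union>i<r. B i)) a \<le> K + 1/2 * (\<Sum>i<r. if s < i then \<Sum>F\<in>\<F>. tnorm (F \<inter> B i) a else 0)"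
proof -
  let ?B = "\<Union>i<r. B i"
  let ?c = "\<lambda>\<F> s. succ_family \<F> \<and> (\<forall>F\<in>\<F>. F \<subseteq> E \<and> F \<noteq> {}) \<and> (\<forall>i<r. s < i \<longrightarrow> card \<F> \<le> m i) \<and>
    tnorm (E \<inter> ?B) a \<le> K + 1/2 * (\<Sum>i<r. if s < i then \<Sum>F\<in>\<F>. tnorm (F \<inter> B i) a else 0)"
  have triv: "\<exists>\<F> s. ?c \<F> s" if "tnorm (E \<inter> ?B) a \<le> K"
    by (rule exI[of _ "{}"], rule exI[of _ 0]) (use that in \<open>simp add: succ_family_def cong: if_cong\<close>)
  have finEB: "finite (E \<inter> ?B)" using E by simp
  from finEB show ?thesis
  proof (rule tnorm_cases[where a = a])
    assume "tnorm (E \<inter> ?B) a = 0" then show ?thesis using triv K by simp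
  next
    fix n assume n: "n \<in> E \<inter> ?B" "tnorm (E \<inter> ?B) a \<le> \<bar>a n\<bar>"
    then obtain i where i: "i < r" "n \<in> B i" by blast
    then have "\<bar>a n\<bar> \<le> K" using tnorm_ge[OF B(1)[OF i(1)] i(2), of a] B(2)[OF i(1)] by simp
    then show ?thesis using triv n(2) by simp
  next
    fix k G assume adm: "admissible k G"
      and le: "tnorm (E \<inter> ?B) a \<le> 1/2 * (\<Sum>j=1..k. tnorm (G j \<inter> (E \<inter> ?B)) a)"
    show ?thesis
    proof (cases "\<exists>i<r. \<exists>j\<in>{1..k}. G j \<inter> E \<inter> B i \<noteq> {}")
      case False
      then have "G j \<inter> (E \<inter> ?B) = {}" if "j \<in> {1..k}" for j using that by blast
      then have "(\<Sum>j=1..k. tnorm (G j \<inter> (E \<inter> ?B)) a) = 0" by simp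
      then show ?thesis using triv le K by simp
    next
      case True
      define Q where "Q i \<longleftrightarrow> i < r \<and> (\<exists>j\<in>{1..k}. G j \<inter> E \<inter> B i \<noteq> {})" for i
      define s where "s = (LEAST i. Q i)"
      have "Q s" using True LeastI_ex[of Q] unfolding s_def Q_def by blast
      then have s: "s < r" "\<exists>j\<in>{1..k}. G j \<inter> E \<inter> B s \<noteq> {}" by (auto simp: Q_def)
      have empty: "G j \<inter> E \<inter> B i = {}" if "i < s" "j \<in> {1..k}" for i j
      proof -
        have "\<not> Q i" by (rule not_less_Least) (use that(1) in \<open>simp add: s_def\<close>)
        then show ?thesis using that s(1) unfolding Q_def by auto
      qed
      have finG: "finite (G j)" "G j \<noteq> {}" if "j \<in> {1..k}" for j
        using adm that by (auto simp: admissible_def)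
      obtain j x where x: "j \<in> {1..k}" "x \<in> G j" "x \<in> B s" using s(2) by blast
      have "k \<le> x"
      proof -
        have k1: "k \<le> Min (G 1)" "1 \<in> {1..k}" using adm x(1) by (auto simp: admissible_def)
        obtain y where y: "y \<in> G 1" using finG[OF k1(2)] by blast
        have "Min (G 1) \<le> x"
        proof (cases "j = 1")
          case True then show ?thesis using x(2) finG[OF k1(2)] by simp
        next
          case False
          then have "y < x" using admissible_less[OF adm, of 1 j y x] x y by auto
          moreover have "Min (G 1) \<le> y" using y finG[OF k1(2)] by simp
          ultimately show ?thesis by simp
        qed
        then show ?thesis using k1 by simp
      qed
      define \<F> where "\<F> = (\<lambda>j. G j \<inter> E) ` {1..k} - {{}}"
      have "card \<F> \<le> card ((\<lambda>j. G j \<inter> E) ` {1..k})" unfolding \<F>_def by (rule card_mono) auto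
      also have "\<dots> \<le> k" using card_image_le[of "{1..k}" "\<lambda>j. G j \<inter> E"] by simp
      finally have cardF: "card \<F> \<le> k" .
      have "succ_family \<F>"
        unfolding succ_family_def
      proof (intro conjI ballI impI)
        show "finite \<F>" by (simp add: \<F>_def)
        show "finite F" if "F \<in> \<F>" for F using that E by (auto simp: \<F>_def)
        fix F F' assume F: "F \<in> \<F>" "F' \<in> \<F>" "F \<noteq> F'"
        then obtain i j where ij: "F = G i \<inter> E" "F' = G j \<inter> E" "i \<in> {1..k}" "j \<in> {1..k}"
          unfolding \<F>_def by blast
        then have "i < j \<or> j < i" using F(3) by (metis nat_neq_iff)
        then show "(\<forall>x\<in>F. \<forall>y\<in>F'. x < y) \<or> (\<forall>x\<in>F. \<forall>y\<in>F'. y < x)"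
        proof
          assume "i < j"
          then show ?thesis using admissible_less[OF adm, of i j] ij by auto
        next
          assume "j < i"
          then show ?thesis using admissible_less[OF adm, of j i] ij by auto
        qed
      qed
      moreover have "\<forall>F\<in>\<F>. F \<subseteq> E \<and> F \<noteq> {}" by (auto simp: \<F>_def)
      moreover have "\<forall>i<r. s < i \<longrightarrow> card \<F> \<le> m i"
        using m[OF _ _ x(3)] \<open>k \<le> x\<close> cardF by (meson less_imp_le order_trans)
      moreover have "tnorm (E \<inter> ?B) a \<le> K + 1/2 * (\<Sum>i<r. if s < i then \<Sum>F\<in>\<F>. tnorm (F \<inter> B i) a else 0)"
      proof -
        have col: "(\<Sum>j=1..k. tnorm (G j \<inter> E \<inter> B i) a) = (\<Sum>F\<in>\<F>. tnorm (F \<inter> B i) a)" for i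
        proof -
          have "(\<Sum>F\<in>(\<lambda>j. G j \<inter> E) ` {1..k}. tnorm (F \<inter> B i) a) = (\<Sum>j=1..k. tnorm (G j \<inter> E \<inter> B i) a)"
          proof (subst sum.reindex_nontrivial)
            fix j j' assume jj: "j \<in> {1..k}" "j' \<in> {1..k}" "j \<noteq> j'" "G j \<inter> E = G j' \<inter> E"
            then have "G j \<inter> E = {}" using admissible_disjoint[OF adm jj(1-3)] by blast
            then show "tnorm (G j \<inter> E \<inter> B i) a = 0" by simp
          qed auto
          also have "(\<Sum>F\<in>(\<lambda>j. G j \<inter> E) ` {1..k}. tnorm (F \<inter> B i) a) = (\<Sum>F\<in>\<F>. tnorm (F \<inter> B i) a)"
            unfolding \<F>_def by (rule sum.mono_neutral_right) auto
          finally show ?thesis ..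
        qed
        have start: "(\<Sum>j=1..k. tnorm (G j \<inter> E \<inter> B s) a) \<le> 2 * K"
        proof -
          have "(\<Sum>j=1..k. tnorm (G j \<inter> (E \<inter> B s)) a) \<le> 2 * tnorm (E \<inter> B s) a"
            using E by (intro tnorm_admissible_le adm) auto
          also have "tnorm (E \<inter> B s) a \<le> tnorm (B s) a" using B(1)[OF s(1)] by (intro tnorm_mono) auto
          also have "\<dots> \<le> K" by (rule B(2)[OF s(1)])
          finally show ?thesis by (simp add: Int_assoc)
        qed
        have "(\<Sum>j=1..k. tnorm (G j \<inter> (E \<inter> ?B)) a) \<le> (\<Sum>j=1..k. \<Sum>i<r. tnorm (G j \<inter> E \<inter> B i) a)"
        proof (rule sum_mono)
          fix j
          have "G j \<inter> (E \<inter> ?B) = (\<Union>i<r. G j \<inter> E \<inter> B i)" by blast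
          then show "tnorm (G j \<inter> (E \<inter> ?B)) a \<le> (\<Sum>i<r. tnorm (G j \<inter> E \<inter> B i) a)"
            using tnorm_UN[of "{..<r}" "\<lambda>i. G j \<inter> E \<inter> B i" a] E by simp
        qed
        also have "\<dots> = (\<Sum>i<r. \<Sum>j=1..k. tnorm (G j \<inter> E \<inter> B i) a)" by (rule sum.swap)
        also have "\<dots> \<le> (\<Sum>i<r. (if i = s then 2 * K else 0) + (if s < i then \<Sum>F\<in>\<F>. tnorm (F \<inter> B i) a else 0))"
        proof (rule sum_mono)
          fix i assume "i \<in> {..<r}"
          consider "i < s" | "i = s" | "s < i" by linarith
          then show "(\<Sum>j=1..k. tnorm (G j \<inter> E \<inter> B i) a)
            \<le> (if i = s then 2 * K else 0) + (if s < i then \<Sum>F\<in>\<F>. tnorm (F \<inter> B i) a else 0)"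
          proof cases
            case 1
            then have "(\<Sum>j=1..k. tnorm (G j \<inter> E \<inter> B i) a) = 0" using empty by (intro sum.neutral) auto
            then show ?thesis using 1 by simp
          next
            case 2 then show ?thesis using start by simp
          next
            case 3 then show ?thesis using col by simp
          qed
        qed
        also have "\<dots> = 2 * K + (\<Sum>i<r. if s < i then \<Sum>F\<in>\<F>. tnorm (F \<inter> B i) a else 0)"
          using s(1) by (simp add: sum.distrib sum.delta)
        finally show ?thesis using le by simp
      qed
      ultimately show ?thesis by blast
    qed
  qed
qed

text \<open>This is where averaging gains a factor \<open>1/2\<close>: the bounds \<open>c\<close> of the \<open>r\<close> sets add up to \<open>r * c\<close>, but the
  union satisfies half of that. All admissible families of the pieces \<open>E\<close> that start before \<open>B i\<close> are
  combined to one successive family, to which thinness of \<open>B i\<close> applies. It has at most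
  \<open>m i * card \<E>\<close> members, so \<open>\<zeta> i\<close> has to be small compared with the end \<open>m i\<close> of the sets before \<open>B i\<close>.\<close>

lemma thin_UN:
  fixes B :: "nat \<Rightarrow> nat set" and m :: "nat \<Rightarrow> nat" and \<zeta> :: "nat \<Rightarrow> real" and c K \<eta> :: real
  assumes B: "\<And>i. i < r \<Longrightarrow> finite (B i)" "\<And>i. i < r \<Longrightarrow> thin (B i) a c (\<zeta> i)"
    and K: "0 \<le> K" "\<And>i. i < r \<Longrightarrow> c + \<zeta> i \<le> K"
    and m: "\<And>i j x. j < i \<Longrightarrow> i < r \<Longrightarrow> x \<in> B j \<Longrightarrow> x < m i"
    and \<zeta>: "\<And>i. i < r \<Longrightarrow> 0 \<le> \<zeta> i" "\<And>i. i < r \<Longrightarrow> \<zeta> i * m i \<le> \<eta>"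
  shows "thin (\<Union>i<r. B i) a (r * c / 2) (K + r * \<eta> / 2)"
  unfolding thin_def
proof (intro allI impI)
  fix \<E> assume \<E>: "succ_family \<E>"
  then have finE: "finite \<E>" "\<And>E. E \<in> \<E> \<Longrightarrow> finite E" by (auto simp: succ_family_def)
  let ?B = "\<Union>i<r. B i"
  have "\<forall>E\<in>\<E>. \<exists>\<F> s. succ_family \<F> \<and> (\<forall>F\<in>\<F>. F \<subseteq> E \<and> F \<noteq> {}) \<and> (\<forall>i<r. s < i \<longrightarrow> card \<F> \<le> m i) \<and>
    tnorm (E \<inter> ?B) a \<le> K + 1/2 * (\<Sum>i<r. if s < i then \<Sum>F\<in>\<F>. tnorm (F \<inter> B i) a else 0)"
  proof
    fix E assume "E \<in> \<E>"
    have "tnorm (B i) a \<le> K" if "i < r" for i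
      using thin_tnorm[OF B(2)[OF that] B(1)[OF that]] K(2)[OF that] by simp
    then show "\<exists>\<F> s. succ_family \<F> \<and> (\<forall>F\<in>\<F>. F \<subseteq> E \<and> F \<noteq> {}) \<and> (\<forall>i<r. s < i \<longrightarrow> card \<F> \<le> m i) \<and>
      tnorm (E \<inter> ?B) a \<le> K + 1/2 * (\<Sum>i<r. if s < i then \<Sum>F\<in>\<F>. tnorm (F \<inter> B i) a else 0)"
      by (intro tnorm_split_UN finE(2) \<open>E \<in> \<E>\<close> B(1) K(1) m)
  qed
  from bchoice[OF this] obtain \<F> where "\<forall>E\<in>\<E>. \<exists>s. succ_family (\<F> E) \<and> (\<forall>F\<in>\<F> E. F \<subseteq> E \<and> F \<noteq> {}) \<and>
    (\<forall>i<r. s < i \<longrightarrow> card (\<F> E) \<le> m i) \<and>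
    tnorm (E \<inter> ?B) a \<le> K + 1/2 * (\<Sum>i<r. if s < i then \<Sum>F\<in>\<F> E. tnorm (F \<inter> B i) a else 0)" ..
  from bchoice[OF this] obtain s where s: "\<forall>E\<in>\<E>. succ_family (\<F> E) \<and> (\<forall>F\<in>\<F> E. F \<subseteq> E \<and> F \<noteq> {}) \<and>
    (\<forall>i<r. s E < i \<longrightarrow> card (\<F> E) \<le> m i) \<and>
    tnorm (E \<inter> ?B) a \<le> K + 1/2 * (\<Sum>i<r. if s E < i then \<Sum>F\<in>\<F> E. tnorm (F \<inter> B i) a else 0)" ..
  have col: "(\<Sum>E\<in>\<E>. if s E < i then \<Sum>F\<in>\<F> E. tnorm (F \<inter> B i) a else 0) \<le> c + \<eta> * card \<E>"
    if i: "i < r" for i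
  proof -
    let ?E = "{E \<in> \<E>. s E < i}"
    let ?G = "\<Union>E\<in>?E. \<F> E"
    have finF: "finite (\<F> E)" if "E \<in> \<E>" for E using s that by (auto simp: succ_family_def)
    have "card ?G \<le> (\<Sum>E\<in>?E. card (\<F> E))" using finE by (intro card_UN_le) auto
    also have "\<dots> \<le> (\<Sum>E\<in>?E. m i)" using s i by (intro sum_mono) auto
    also have "\<dots> \<le> m i * card \<E>" using finE by (simp add: card_mono)
    finally have cardG: "card ?G \<le> m i * card \<E>" .
    have "succ_family ?G"
      unfolding succ_family_def
    proof (intro conjI ballI impI)
      show "finite ?G" using finE finF by auto
      show "finite F" if "F \<in> ?G" for F using that s by (auto simp: succ_family_def)
      fix F F' assume F: "F \<in> ?G" "F' \<in> ?G" "F \<noteq> F'"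
      then obtain E E' where E: "E \<in> \<E>" "E' \<in> \<E>" "F \<in> \<F> E" "F' \<in> \<F> E'" by blast
      show "(\<forall>x\<in>F. \<forall>y\<in>F'. x < y) \<or> (\<forall>x\<in>F. \<forall>y\<in>F'. y < x)"
      proof (cases "E = E'")
        case True
        then show ?thesis using succ_familyD[of "\<F> E" F F'] s E F(3) by blast
      next
        case False
        have "F \<subseteq> E" "F' \<subseteq> E'" using s E by blast+
        then show ?thesis using succ_familyD[OF \<E> E(1,2) False] by blast
      qed
    qed
    moreover have "\<F> E \<inter> \<F> E' = {}" if "E \<in> \<E>" "E' \<in> \<E>" "E \<noteq> E'" for E E'
    proof (rule ccontr)
      assume "\<F> E \<inter> \<F> E' \<noteq> {}"
      then obtain F where "F \<in> \<F> E" "F \<in> \<F> E'" by blast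
      then have "F \<subseteq> E \<inter> E'" "F \<noteq> {}" using s that by blast+
      then show False using succ_familyD[OF \<E> that] by fastforce
    qed
    then have "(\<Sum>F\<in>?G. tnorm (F \<inter> B i) a) = (\<Sum>E\<in>?E. \<Sum>F\<in>\<F> E. tnorm (F \<inter> B i) a)"
      using finE finF by (intro sum.UNION_disjoint) auto
    then have "(\<Sum>E\<in>\<E>. if s E < i then \<Sum>F\<in>\<F> E. tnorm (F \<inter> B i) a else 0) = (\<Sum>F\<in>?G. tnorm (F \<inter> B i) a)"
      using finE by (simp add: sum.inter_filter)
    ultimately have "(\<Sum>E\<in>\<E>. if s E < i then \<Sum>F\<in>\<F> E. tnorm (F \<inter> B i) a else 0) \<le> c + \<zeta> i * card ?G"
      using B(2)[OF i] unfolding thin_def by auto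
    also have "\<zeta> i * card ?G \<le> \<zeta> i * (real (m i) * real (card \<E>))"
      using cardG by (intro mult_left_mono \<zeta>(1)[OF i]) (simp only: of_nat_mult[symmetric] of_nat_le_iff)
    also have "\<dots> \<le> \<eta> * card \<E>" using mult_right_mono[OF \<zeta>(2)[OF i], of "real (card \<E>)"] by (simp add: mult.assoc)
    finally show ?thesis by simp
  qed
  have "(\<Sum>E\<in>\<E>. tnorm (E \<inter> ?B) a)
      \<le> (\<Sum>E\<in>\<E>. K + 1/2 * (\<Sum>i<r. if s E < i then \<Sum>F\<in>\<F> E. tnorm (F \<inter> B i) a else 0))"
    using s by (intro sum_mono) blast
  also have "\<dots> = K * card \<E> + 1/2 * (\<Sum>E\<in>\<E>. \<Sum>i<r. if s E < i then \<Sum>F\<in>\<F> E. tnorm (F \<inter> B i) a else 0)"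
    by (simp add: sum.distrib sum_distrib_left)
  also have "(\<Sum>E\<in>\<E>. \<Sum>i<r. if s E < i then \<Sum>F\<in>\<F> E. tnorm (F \<inter> B i) a else 0)
      = (\<Sum>i<r. \<Sum>E\<in>\<E>. if s E < i then \<Sum>F\<in>\<F> E. tnorm (F \<inter> B i) a else 0)" by (rule sum.swap)
  also have "\<dots> \<le> (\<Sum>i<r. c + \<eta> * card \<E>)" using col by (intro sum_mono) auto
  finally show "(\<Sum>E\<in>\<E>. tnorm (E \<inter> ?B) a) \<le> real r * c / 2 + (K + real r * \<eta> / 2) * real (card \<E>)"
    by (simp add: algebra_simps)
qed

section \<open>Blocks and the summable ideal\<close>

abbreviation (input) wt :: "(nat \<Rightarrow> nat) \<Rightarrow> nat \<Rightarrow> real"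
  where "wt l i \<equiv> (1/2) ^ l i"

text \<open>Only \<open>S 0, \<dots>, S (N - 1)\<close> contain numbers below \<open>N\<close>, so their masses bound the partial sum up to \<open>N\<close>.\<close>

lemma summable_indicator_UN:
  fixes S :: "nat \<Rightarrow> nat set" and w :: "nat \<Rightarrow> real"
  assumes S: "\<And>n. finite (S n)" "\<And>n. S n \<subseteq> {n..}" and w: "\<And>i. 0 \<le> w i"
    and g: "\<And>n. sum w (S n) \<le> g n" "summable g"
  shows "summable (\<lambda>i. if i \<in> (\<Union>n. S n) then w i else 0)"
proof (rule summableI_nonneg_bounded)
  show "0 \<le> (if i \<in> (\<Union>n. S n) then w i else 0)" for i using w by simp
  have g0: "0 \<le> g n" for n using g(1)[of n] sum_nonneg[of "S n" w] w by (meson order_trans)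
  fix N
  have "(\<Sum>i<N. if i \<in> (\<Union>n. S n) then w i else 0) \<le> (\<Sum>i<N. \<Sum>n<N. if i \<in> S n then w i else 0)"
  proof (rule sum_mono)
    fix i assume i: "i \<in> {..<N}"
    show "(if i \<in> (\<Union>n. S n) then w i else 0) \<le> (\<Sum>n<N. if i \<in> S n then w i else 0)"
    proof (cases "i \<in> (\<Union>n. S n)")
      case True
      then obtain n where n: "i \<in> S n" by blast
      then have "n \<in> {..<N}" using S(2)[of n] i by auto
      then have "(if i \<in> S n then w i else 0) \<le> (\<Sum>n<N. if i \<in> S n then w i else 0)"
        using w by (intro member_le_sum) auto
      then show ?thesis using n by auto
    qed (use w in \<open>auto intro!: sum_nonneg\<close>)
  qed
  also have "\<dots> = (\<Sum>n<N. \<Sum>i<N. if i \<in> S n then w i else 0)" by (rule sum.swap)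
  also have "\<dots> \<le> (\<Sum>n<N. g n)"
  proof (rule sum_mono)
    fix n
    have "(\<Sum>i<N. if i \<in> S n then w i else 0) = sum w ({..<N} \<inter> S n)"
      by (simp add: sum.inter_restrict)
    also have "\<dots> \<le> sum w (S n)" using S(1) w by (intro sum_mono2) auto
    finally show "(\<Sum>i<N. if i \<in> S n then w i else 0) \<le> g n" using g(1)[of n] by simp
  qed
  also have "\<dots> \<le> suminf g" using g(2) g0 by (intro sum_le_suminf) auto
  finally show "(\<Sum>i<N. if i \<in> (\<Union>n. S n) then w i else 0) \<le> suminf g" .
qed

text \<open>Otherwise, for every \<open>k\<close> some fibre \<open>t \<ge> k\<close> has infinitely many blocks of norm above
  \<open>4 ^ k / 2 ^ t\<close>. Far out, \<open>2 ^ (t - k)\<close> of them have total weight \<open>1 / 2 ^ k\<close>, but by the lower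
  estimate their sum has norm at least \<open>2 ^ k / 2\<close>.\<close>

lemma weights_dominate_blocks:
  fixes l :: "nat \<Rightarrow> nat"
  assumes M: "strict_mono M"
    and imp: "\<And>A. summable (\<lambda>i. if i \<in> A then wt l i else 0)
      \<Longrightarrow> restr (\<Union>i\<in>A. block M i) V \<in> coef tsirelson_unit"
  shows "\<exists>C>0. \<exists>k. \<forall>t\<ge>k. finite {i. l i = t \<and> C * (1/2) ^ t < tnorm (block M i) V}"
proof (rule ccontr)
  assume *: "\<not> ?thesis"
  have "\<forall>k. \<exists>t\<ge>k. infinite {i. l i = t \<and> 4 ^ k * (1/2) ^ t < tnorm (block M i) V}"
    using * by (meson zero_less_numeral zero_less_power)
  from choice[OF this] obtain t
    where t: "\<And>k. k \<le> t k" "\<And>k. infinite {i. l i = t k \<and> 4 ^ k * (1/2) ^ t k < tnorm (block M i) V}"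
    by blast
  have "\<forall>k. \<exists>T. finite T \<and> card T = 2 ^ (t k - k) \<and>
    T \<subseteq> {i. l i = t k \<and> 4 ^ k * (1/2) ^ t k < tnorm (block M i) V} - {..<k + 2 ^ t k}"
    using infinite_arbitrarily_large[OF Diff_infinite_finite[OF _ t(2)]] by blast
  from choice[OF this] obtain S where S: "\<And>k. finite (S k)" "\<And>k. card (S k) = 2 ^ (t k - k)"
    "\<And>k. S k \<subseteq> {i. l i = t k \<and> 4 ^ k * (1/2) ^ t k < tnorm (block M i) V} - {..<k + 2 ^ t k}" by blast
  have pow: "2 ^ (t k - k) * (1/2 :: real) ^ t k = (1/2) ^ k" for k
  proof -
    have "(2::real) ^ t k = 2 ^ (t k - k) * 2 ^ k" using t(1)[of k] by (simp flip: power_add)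
    then show ?thesis by (simp add: power_one_over field_simps)
  qed
  have ge: "k \<le> i" "2 ^ t k \<le> i" if "i \<in> S k" for i k using S(3)[of k] that by auto
  have "sum (wt l) (S k) \<le> (1/2) ^ k" for k
  proof -
    have "sum (wt l) (S k) = (\<Sum>i\<in>S k. (1/2) ^ t k)" using S(3)[of k] by (intro sum.cong) auto
    then show ?thesis using S(2)[of k] pow[of k] by simp
  qed
  then have "summable (\<lambda>i. if i \<in> (\<Union>k. S k) then wt l i else 0)"
    using S(1) ge(1) by (intro summable_indicator_UN[where g = "\<lambda>k. (1/2) ^ k"]) (auto intro: summable_geometric)
  then have "restr (\<Union>i\<in>(\<Union>k. S k). block M i) V \<in> coef tsirelson_unit" by (rule imp)
  moreover have low: "1/2 \<le> tnorm (\<Union>i\<in>S k. block M i) V" for k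
  proof -
    have "(1::real) \<le> 4 ^ k * (1/2) ^ k" by (simp flip: power_mult_distrib)
    also have "\<dots> = (\<Sum>i\<in>S k. 4 ^ k * (1/2) ^ t k)"
      using S(2)[of k] pow[of k] by (simp add: mult.left_commute)
    also have "\<dots> \<le> (\<Sum>i\<in>S k. tnorm (block M i) V)" using S(3)[of k] by (intro sum_mono) (auto simp: less_imp_le subset_iff)
    also have "\<dots> \<le> 2 * tnorm (\<Union>i\<in>S k. block M i) V"
    proof (rule sum_tnorm_blocks_le[OF M S(1)])
      fix i assume "i \<in> S k"
      have "card (S k) \<le> 2 ^ t k" using S(2)[of k] by (simp add: power_increasing)
      then show "card (S k) \<le> i" using ge(2)[OF \<open>i \<in> S k\<close>] by simp
    qed
    finally show ?thesis by simp
  qed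
  have "restr (\<Union>i\<in>(\<Union>k. S k). block M i) V \<notin> coef tsirelson_unit"
    by (rule restr_blocks_not_coef[OF M, of S _ "1/2"]) (use S(1) low ge(1) in auto)
  ultimately show False by simp
qed

text \<open>Induction on the number \<open>q\<close> of repetitions. For \<open>q = 0\<close> one takes \<open>2 ^ d\<close> blocks of the fibre \<open>s + d\<close>
  with \<open>d\<close> large.
  In the step, \<open>2 ^ d\<close> successive sets of mass \<open>(1/2) ^ (s + d)\<close> are united, and each is
  chosen with an error that is small relative to the end of the preceding ones, as
  \<open>thin_UN\<close> requires. The fibres provide blocks of each weight arbitrarily far out, so the weights
  can be chosen after the supports of the earlier blocks are known.\<close>

lemma thin_averages:
  fixes l :: "nat \<Rightarrow> nat"
  assumes M: "strict_mono M" and l: "\<And>t L. \<exists>b\<ge>L. l b = t" and C: "0 < C"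
    and fin: "\<And>t. k \<le> t \<Longrightarrow> finite {i. l i = t \<and> C * (1/2) ^ t < tnorm (block M i) V}"
    and \<epsilon>: "0 < \<epsilon>"
  shows "\<exists>A. finite A \<and> A \<subseteq> {N..} \<and> sum (wt l) A = (1/2) ^ s \<and>
    thin (\<Union>i\<in>A. block M i) V (C * (1/2) ^ s * (1/2) ^ q) (C * (1/2) ^ s * \<epsilon>)"
  using \<epsilon>
proof (induction q arbitrary: s \<epsilon> N)
  case 0
  obtain d0 where d0: "(1/2) ^ d0 < \<epsilon>" using real_arch_pow_inv[OF 0, of "1/2"] by auto
  define d where "d = max d0 k"
  have "(1/2 :: real) ^ d \<le> (1/2) ^ d0" unfolding d_def by (rule power_decreasing) auto
  then have d: "(1/2) ^ d \<le> \<epsilon>" using d0 by linarith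
  have kd: "k \<le> s + d" by (simp add: d_def)
  let ?bad = "{i. l i = s + d \<and> C * (1/2) ^ (s + d) < tnorm (block M i) V}"
  have "infinite ({i. N \<le> i \<and> l i = s + d} - ?bad)"
    by (rule Diff_infinite_finite[OF fin[OF kd] infinite_fibre[OF l]])
  then obtain A where A: "finite A" "card A = 2 ^ d" "A \<subseteq> {i. N \<le> i \<and> l i = s + d} - ?bad"
    using infinite_arbitrarily_large by blast
  have pow: "2 ^ d * (1/2 :: real) ^ (s + d) = (1/2) ^ s"
    by (simp add: power_add power_one_over)
  have "thin (\<Union>i\<in>A. block M i) V (card A * (C * (1/2) ^ (s + d))) (C * (1/2) ^ (s + d))"
    using C A(3) by (intro thin_blocks M A(1)) auto
  then have "thin (\<Union>i\<in>A. block M i) V (C * (1/2) ^ s * (1/2) ^ 0) (C * (1/2) ^ s * \<epsilon>)"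
  proof (rule thin_mono)
    show "card A * (C * (1/2) ^ (s + d)) \<le> C * (1/2) ^ s * (1/2) ^ 0"
      using A(2) pow by (simp add: mult.left_commute)
    show "C * (1/2) ^ (s + d) \<le> C * (1/2) ^ s * \<epsilon>"
      using C d by (simp add: power_add)
  qed
  moreover have "sum (wt l) A = (\<Sum>i\<in>A. (1/2) ^ (s + d))" using A(3) by (intro sum.cong) auto
  then have "sum (wt l) A = (1/2) ^ s" using A(2) pow by simp
  ultimately show ?case using A by (intro exI[of _ A]) auto
next
  case (Suc q)
  have "0 < \<epsilon> / 4" using Suc.prems by simp
  from real_arch_pow_inv[OF this, of "1/2"] obtain d where d: "(1/2) ^ d < \<epsilon> / 4" by auto
  \<comment> \<open>The bound by \<open>1\<close> gives \<open>\<zeta> i \<le> ?c\<close> below, hence the bound \<open>2 * ?c\<close> for each set of the union.\<close>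
  define e where "e = min 1 \<epsilon>"
  have e: "0 < e" "e \<le> 1" "e \<le> \<epsilon>" using Suc.prems by (auto simp: e_def)
  let ?c = "C * (1/2) ^ (s + d)"
  have c0: "0 < ?c" using C by simp
  let ?Q = "\<lambda>p p'. snd p \<le> snd p' \<and> finite (fst p') \<and> fst p' \<subseteq> {snd p..<snd p'} \<and>
    sum (wt l) (fst p') = (1/2) ^ (s + d) \<and>
    thin (\<Union>i\<in>fst p'. block M i) V (?c * (1/2) ^ q) (?c * (e / (1 + M (snd p))))"
  \<comment> \<open>The second component is a strict upper bound of the first one.\<close>
  have "\<exists>f :: nat \<Rightarrow> nat set \<times> nat. \<forall>i. N \<le> snd (f i) \<and> ?Q (f i) (f (Suc i))"
  proof (rule dependent_nat_choice)
    show "\<exists>x :: nat set \<times> nat. N \<le> snd x" by (rule exI[of _ "({}, N)"]) simp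
    fix p :: "nat set \<times> nat" and i :: nat assume p: "N \<le> snd p"
    have "0 < e / (1 + M (snd p))" using e by (simp add: add_pos_nonneg)
    from Suc.IH[OF this, of "snd p" "s + d"] obtain A where A: "finite A" "A \<subseteq> {snd p..}"
      "sum (wt l) A = (1/2) ^ (s + d)"
      "thin (\<Union>i\<in>A. block M i) V (?c * (1/2) ^ q) (?c * (e / (1 + M (snd p))))" by blast
    let ?n = "Suc (Max (insert (snd p) A))"
    have "x < ?n" if "x \<in> A \<or> x = snd p" for x
      using A(1) that by (intro le_imp_less_Suc Max_ge) auto
    then have "snd p < ?n" "A \<subseteq> {snd p..<?n}" using A(2) by auto
    then show "\<exists>p'. N \<le> snd p' \<and> ?Q p p'" using A p by (intro exI[of _ "(A, ?n)"]) simp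
  qed
  then obtain f where f: "\<And>i. N \<le> snd (f i)" "\<And>i. ?Q (f i) (f (Suc i))" by blast
  define A where "A i = fst (f (Suc i))" for i
  define n where "n i = snd (f i)" for i
  define \<zeta> where "\<zeta> i = ?c * (e / (1 + M (n i)))" for i
  have A: "finite (A i)" "A i \<subseteq> {n i..<n (Suc i)}" "sum (wt l) (A i) = (1/2) ^ (s + d)"
    "thin (\<Union>j\<in>A i. block M j) V (?c * (1/2) ^ q) (\<zeta> i)" and n: "N \<le> n i" "n i \<le> n (Suc i)" for i
    using f[of i] unfolding A_def n_def \<zeta>_def by blast+
  have n_mono: "n i \<le> n j" if "i \<le> j" for i j by (rule lift_Suc_mono_le[of n, OF n(2) that])
  let ?U = "\<Union>i<2 ^ d. A i"
  have before: "x < M (n i)" if ji: "j < i" and x: "x \<in> (\<Union>a\<in>A j. block M a)" for x i j :: nat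
  proof -
    obtain a where a: "a \<in> A j" "x \<in> block M a" using x by blast
    have "Suc a \<le> n (Suc j)" using a(1) A(2)[of j] by auto
    also have "\<dots> \<le> n i" using n_mono ji by simp
    finally have "M (Suc a) \<le> M (n i)" using strict_mono_less_eq[OF M] by simp
    then show ?thesis using a(2) by simp
  qed
  have \<zeta>: "0 \<le> \<zeta> i" "\<zeta> i * M (n i) \<le> ?c * e" "\<zeta> i \<le> ?c" for i
  proof -
    have m: "0 \<le> real (M (n i))" by simp
    show "0 \<le> \<zeta> i" using c0 e m by (simp add: \<zeta>_def)
    have "e * M (n i) \<le> e * (1 + M (n i))" using e m by (intro mult_left_mono) auto
    then have "e / (1 + M (n i)) * M (n i) \<le> e" using m by (simp add: pos_divide_le_eq add_pos_nonneg)
    then show "\<zeta> i * M (n i) \<le> ?c * e"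
      using mult_left_mono[OF _ less_imp_le[OF c0], of "e / (1 + M (n i)) * M (n i)" e]
      by (simp add: \<zeta>_def mult.assoc)
    have "e / (1 + M (n i)) \<le> 1" using e m by (simp add: pos_divide_le_eq add_pos_nonneg)
    then show "\<zeta> i \<le> ?c" using c0 unfolding \<zeta>_def by (intro mult_left_le) auto
  qed
  have pow: "2 ^ d * (1/2 :: real) ^ (s + d) = (1/2) ^ s"
    by (simp add: power_add power_one_over)
  have "thin (\<Union>i<2 ^ d. \<Union>j\<in>A i. block M j) V (real (2 ^ d) * (?c * (1/2) ^ q) / 2)
      (2 * ?c + real (2 ^ d) * (?c * e) / 2)"
  proof (rule thin_UN[OF _ A(4) _ _ before \<zeta>(1,2)])
    show "finite (\<Union>j\<in>A i. block M j)" for i using A(1) by simp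
    show "0 \<le> 2 * ?c" using c0 by simp
    have "?c * (1/2) ^ q \<le> ?c" using c0 by (intro mult_left_le) (auto simp: power_le_one)
    then show "?c * (1/2) ^ q + \<zeta> i \<le> 2 * ?c" for i using \<zeta>(3)[of i] by linarith
  qed
  then have "thin (\<Union>i<2 ^ d. \<Union>j\<in>A i. block M j) V (C * (1/2) ^ s * (1/2) ^ Suc q) (C * (1/2) ^ s * \<epsilon>)"
  proof (rule thin_mono)
    show "real (2 ^ d) * (?c * (1/2) ^ q) / 2 \<le> C * (1/2) ^ s * (1/2) ^ Suc q"
      by (simp add: power_add power_one_over)
    have "2 * (C * (u * v)) + r * (C * (u * v) * e) / 2 = C * u * (2 * v + (r * v) * e / 2)"
      for u v r :: real by (simp add: algebra_simps)
    from this[of "(1/2) ^ s" "(1/2) ^ d" "2 ^ d"]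
    have "2 * ?c + real (2 ^ d) * (?c * e) / 2 = C * (1/2) ^ s * (2 * (1/2) ^ d + e / 2)"
      by (simp add: power_add power_one_over)
    also have "\<dots> \<le> C * (1/2) ^ s * \<epsilon>" using C d e by (intro mult_left_mono) auto
    finally show "2 * ?c + real (2 ^ d) * (?c * e) / 2 \<le> C * (1/2) ^ s * \<epsilon>" .
  qed
  also have "(\<Union>i<2 ^ d. \<Union>j\<in>A i. block M j) = (\<Union>j\<in>?U. block M j)" by blast
  finally have "thin (\<Union>j\<in>?U. block M j) V (C * (1/2) ^ s * (1/2) ^ Suc q) (C * (1/2) ^ s * \<epsilon>)" .
  moreover have "sum (wt l) ?U = (1/2) ^ s"
  proof -
    have disj: "A i \<inter> A j = {}" if "i < j" for i j
    proof -
      have "n (Suc i) \<le> n j" using that n_mono by simp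
      then show ?thesis using A(2)[of i] A(2)[of j] by fastforce
    qed
    have "sum (wt l) ?U = (\<Sum>i<2 ^ d. sum (wt l) (A i))"
      using A(1) disj by (intro sum.UNION_disjoint) (auto, metis Int_iff empty_iff nat_neq_iff)
    then show ?thesis using A(3) pow by simp
  qed
  moreover have "?U \<subseteq> {N..}"
  proof
    fix x assume "x \<in> ?U"
    then obtain i where "x \<in> A i" by blast
    then show "x \<in> {N..}" using A(2)[of i] n(1)[of i] by auto
  qed
  moreover have "finite ?U" using A(1) by simp
  ultimately show ?case by (intro exI[of _ ?U]) simp
qed

text \<open>The sets \<open>S n\<close> have mass \<open>1\<close>, lie beyond \<open>n\<close>, and carry vectors whose norms are summable. Their
  union is not summable, but the sum over it converges.\<close>

lemma coef_blocks_ne_summable_ideal: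
  fixes l :: "nat \<Rightarrow> nat"
  assumes M: "strict_mono M" and l: "\<And>t L. \<exists>b\<ge>L. l b = t"
    and iff: "\<And>A. restr (\<Union>i\<in>A. block M i) V \<in> coef tsirelson_unit
      \<longleftrightarrow> summable (\<lambda>i. if i \<in> A then wt l i else 0)"
  shows False
proof -
  obtain C k where C: "0 < C"
    and fin: "\<And>t. k \<le> t \<Longrightarrow> finite {i. l i = t \<and> C * (1/2) ^ t < tnorm (block M i) V}"
    using weights_dominate_blocks[OF M, of l V] iff by blast
  have "\<forall>n. \<exists>A. finite A \<and> A \<subseteq> {n..} \<and> sum (wt l) A = (1/2) ^ 0 \<and>
    thin (\<Union>i\<in>A. block M i) V (C * (1/2) ^ 0 * (1/2) ^ n) (C * (1/2) ^ 0 * (1/2) ^ n)"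
    by (intro allI thin_averages[OF M l C fin]) auto
  from choice[OF this] obtain S where S: "\<And>n. finite (S n)" "\<And>n. S n \<subseteq> {n..}"
    "\<And>n. sum (wt l) (S n) = 1" "\<And>n. thin (\<Union>i\<in>S n. block M i) V (C * (1/2) ^ n) (C * (1/2) ^ n)"
    by auto
  let ?A = "\<Union>n. S n"
  have "tnorm (\<Union>i\<in>S n. block M i) V \<le> 2 * C * (1/2) ^ n" for n
    using thin_tnorm[OF S(4)[of n]] S(1) by simp
  then have "restr (\<Union>n. \<Union>i\<in>S n. block M i) V \<in> coef tsirelson_unit"
    using S(1) by (intro coef_UN_I[where g = "\<lambda>n. 2 * C * (1/2) ^ n"])
      (auto intro!: summable_mult summable_geometric)
  also have "(\<Union>n. \<Union>i\<in>S n. block M i) = (\<Union>i\<in>?A. block M i)" by blast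
  finally have "summable (\<lambda>i. if i \<in> ?A then wt l i else 0)" by (rule iff[THEN iffD1])
  then obtain n where n: "\<And>m. norm (\<Sum>i=n..<m. if i \<in> ?A then wt l i else 0) < 1"
    unfolding summable_Cauchy using zero_less_one by blast
  define m where "m = Suc (Max (S n))"
  have "S n \<subseteq> {n..<m}" using S(1,2)[of n] unfolding m_def by (auto simp: less_Suc_eq_le)
  then have "(\<Sum>i\<in>S n. if i \<in> ?A then wt l i else 0) \<le> (\<Sum>i=n..<m. if i \<in> ?A then wt l i else 0)"
    by (intro sum_mono2) auto
  moreover have "(\<Sum>i\<in>S n. if i \<in> ?A then wt l i else 0) = sum (wt l) (S n)"
    by (rule sum.cong) auto
  ultimately show False using n[of m] S(3)[of n] by simp
qed

section \<open>The two quotients\<close>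

lemma fst_prod_decode_fibre: "\<exists>b\<ge>L. fst (prod_decode b) = t"
  by (rule exI[of _ "prod_encode (t, L)"]) (simp add: le_prod_encode_2)

lemma lp_space_fin: "fin_supp x \<Longrightarrow> x \<in> lp_space p"
  unfolding lp_space_def mem_Collect_eq
  by (rule summable_finite[of "{n. x n \<noteq> 0}"]) auto

lemma c0_space_fin: "fin_supp x \<Longrightarrow> x \<in> c0_space"
proof -
  assume "fin_supp x"
  then obtain N where "\<And>n. x n \<noteq> 0 \<Longrightarrow> n < N" unfolding finite_nat_set_iff_bounded by blast
  then have "\<forall>\<^sub>F n in sequentially. x n = 0"
    unfolding eventually_sequentially by (intro exI[of _ N]) force
  then show ?thesis unfolding c0_space_def by (simp add: tendsto_eventually)
qed

text \<open>The exponent \<open>p\<close> disappears: the \<open>p\<close>-th powers of the chosen values are \<open>(1/2) ^ l k\<close>.\<close>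

lemma indicator_lp_iff:
  assumes p: "0 < p" and b: "strict_mono b" and lb: "\<And>i. l (b i) = l i"
  shows "(\<lambda>k. if k \<in> b ` A then (1/2) powr (l k / p) else 0) \<in> lp_space p
    \<longleftrightarrow> summable (\<lambda>i. if i \<in> A then (1/2 :: real) ^ l i else 0)"
proof -
  let ?g = "\<lambda>k. if k \<in> b ` A then (1/2 :: real) ^ l k else 0"
  have "(\<lambda>k. \<bar>if k \<in> b ` A then (1/2) powr (l k / p) else 0\<bar> powr p) = ?g"
    using p by (auto simp: powr_powr powr_realpow)
  then have "(\<lambda>k. if k \<in> b ` A then (1/2) powr (l k / p) else 0) \<in> lp_space p \<longleftrightarrow> summable ?g"
    by (simp add: lp_space_def)
  also have "\<dots> \<longleftrightarrow> summable (\<lambda>i. ?g (b i))"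
    by (rule summable_mono_reindex[OF b, symmetric]) auto
  also have "(\<lambda>i. ?g (b i)) = (\<lambda>i. if i \<in> A then (1/2) ^ l i else 0)"
    using lb strict_mono_imp_inj_on[OF b, of UNIV] by (auto simp: inj_image_mem_iff)
  finally show ?thesis .
qed

lemma indicator_c0_iff:
  assumes b: "strict_mono b" and lb: "\<And>i. l (b i) = l i"
  shows "(\<lambda>k. if k \<in> b ` A then (1/2) ^ l k else 0) \<in> c0_space \<longleftrightarrow> (\<forall>t. finite {i \<in> A. l i = t})"
    (is "?f \<in> _ \<longleftrightarrow> _")
proof
  assume "?f \<in> c0_space"
  then have lim: "?f \<longlonglongrightarrow> 0" by (simp add: c0_space_def)
  show "\<forall>t. finite {i \<in> A. l i = t}"
  proof
    fix t
    obtain N where N: "\<And>k. k \<ge> N \<Longrightarrow> norm (?f k - 0) < (1/2) ^ t"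
      using LIMSEQ_D[OF lim, of "(1/2) ^ t"] by auto
    have "i < N" if "i \<in> A" "l i = t" for i
    proof (rule ccontr)
      assume "\<not> i < N"
      then have "N \<le> b i" using strict_mono_imp_increasing[OF b, of i] by simp
      from N[OF this] show False using that lb[of i] by simp
    qed
    then have "{i \<in> A. l i = t} \<subseteq> {..<N}" by auto
    then show "finite {i \<in> A. l i = t}" by (rule finite_subset) simp
  qed
next
  assume fin: "\<forall>t. finite {i \<in> A. l i = t}"
  have "?f \<longlonglongrightarrow> 0"
  proof (rule LIMSEQ_I)
    fix e :: real assume "0 < e"
    then obtain T where T: "(1/2) ^ T < e" using real_arch_pow_inv[of e "1/2"] by auto
    have "finite (b ` (\<Union>t<T. {i \<in> A. l i = t}))" using fin by blast
    then obtain N where N: "\<And>k. k \<in> b ` (\<Union>t<T. {i \<in> A. l i = t}) \<Longrightarrow> k < N"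
      unfolding finite_nat_set_iff_bounded by blast
    have "norm (?f k - 0) < e" if "k \<ge> N" for k
    proof (cases "k \<in> b ` A")
      case True
      then obtain i where i: "i \<in> A" "k = b i" by blast
      have "T \<le> l i"
      proof (rule ccontr)
        assume "\<not> T \<le> l i"
        then have "k \<in> b ` (\<Union>t<T. {i \<in> A. l i = t})" using i by auto
        from N[OF this] show False using that by simp
      qed
      then have "(1/2 :: real) ^ l i \<le> (1/2) ^ T" by (intro power_decreasing) auto
      then have "(1/2 :: real) ^ l i < e" using T by linarith
      then show ?thesis using True i(2) lb[of i] by simp
    qed (use \<open>0 < e\<close> in auto)
    then show "\<exists>N. \<forall>k\<ge>N. norm (?f k - 0) < e" by blast
  qed
  then show "?f \<in> c0_space" by (simp add: c0_space_def)
qed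

theorem proposition1p3:
  fixes p :: real
  assumes "p \<ge> 1"
  shows "\<not> lp_rel p \<le>\<^sub>B E_rel tsirelson_unit \<and> \<not> c0_rel \<le>\<^sub>B E_rel tsirelson_unit"
proof (intro conjI notI)
  let ?l = "\<lambda>n. fst (prod_decode n)"
  assume "lp_rel p \<le>\<^sub>B E_rel tsirelson_unit"
  then have red: "{(x, y). (\<lambda>n. x n - y n) \<in> lp_space p} \<le>\<^sub>B E_rel tsirelson_unit"
    by (simp add: lp_rel_def)
  show False
  proof (rule block_splitting_of_reduction[where w = "\<lambda>k. (1/2) powr (?l k / p)",
        OF red lp_space_fin fst_prod_decode_fibre])
    fix b M V
    assume b: "strict_mono b" and M: "strict_mono M" and lb: "\<And>i. ?l (b i) = ?l i"
      and V: "\<And>A. restr (\<Union>i\<in>A. block M i) V \<in> coef tsirelson_unit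
        \<longleftrightarrow> (\<lambda>k. if k \<in> b ` A then (1/2) powr (?l k / p) else 0) \<in> lp_space p"
    show False
      by (rule coef_blocks_ne_summable_ideal[OF M fst_prod_decode_fibre])
        (use V indicator_lp_iff[of p b ?l, OF _ b lb] assms in simp)
  qed
next
  let ?l = "\<lambda>n. fst (prod_decode n)"
  assume "c0_rel \<le>\<^sub>B E_rel tsirelson_unit"
  then have red: "{(x, y). (\<lambda>n. x n - y n) \<in> c0_space} \<le>\<^sub>B E_rel tsirelson_unit"
    by (simp add: c0_rel_def)
  show False
  proof (rule block_splitting_of_reduction[where w = "\<lambda>k. (1/2) ^ ?l k",
        OF red c0_space_fin fst_prod_decode_fibre])
    fix b M V
    assume b: "strict_mono b" and M: "strict_mono M" and lb: "\<And>i. ?l (b i) = ?l i"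
      and V: "\<And>A. restr (\<Union>i\<in>A. block M i) V \<in> coef tsirelson_unit
        \<longleftrightarrow> (\<lambda>k. if k \<in> b ` A then (1/2) ^ ?l k else 0) \<in> c0_space"
    show False
      by (rule coef_blocks_ne_vanishing_ideal[OF M fst_prod_decode_fibre])
        (use V indicator_c0_iff[of b ?l, OF b lb] in simp)
  qed
qed

end
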